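(* Let $\emptyset\neq\omega\subseteq G\Subset\Omega\subset\mathbb{R}^n$ be bounded domains and let $\alpha\in(0,1]$ be an exponent for which there is a constant $C_0$ with $\|w\|_{L_2(G)}\le C_0\|w\|_{L_2(\omega)}^\alpha\|w\|_{L_2(\Omega)}^{1-\alpha}$ for all harmonic $w\in L_2(\Omega)$. Assume the setting of nonconforming test spaces described in the context. For $\delta\in I$, $\varepsilon\ge0$ and $(\ell^\delta,q)\in(Y^\delta)'\times L_2(\omega)$, let $$u_\varepsilon^\delta:=\operatorname*{argmin}_{z\in X^\delta}\big\{\|B^\delta z-\ell^\delta\|_{(Y^\delta)'}^2+\|Cz-q\|_{L_2(\omega)}^2+\varepsilon^2\|z\|_{L_2(\Omega)}^2\big\}.$$ Fix constants $\varepsilon_0,c_1,c_2,C_1>0$. Then there is a constant $K$, independent of $\delta,\varepsilon,\ell,\ell^\delta,q,u$, such that the following holds. Let $\delta\in I$, $\ell\in H^{-2}(\Omega)$, $(\ell^\delta,q)\in(Y^\delta)'\times L_2(\omega)$, $u\in L_2(\Omega)$, and let $\mathrm{osc}_\delta(\ell)\ge0$ be a quantity such that for all $z\in X^\delta$, $$\sup_{0\neq v\in Y^\delta}\frac{|(B^\delta z)(v-E^\delta v)+\ell(E^\delta v)-\ell^\delta(v)|}{\|v\|_{Y^\delta}}\le C_1\big(\|\ell-Bu\|_{H^{-2}(\Omega)}+\|u-z\|_{L_2(\Omega)}+\mathrm{osc}_\delta(\ell)\big).$$ Put $\mathcal{E}_{\rm data}:=\|Au-(\ell,q)\|_{H^{-2}(\Omega)\times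 L_2(\omega)}$, $\mathcal{E}_{\rm appr}(\delta):=\min_{z\in X^\delta}\|u-z\|_{L_2(\Omega)}$, and $\mathcal{E}:=\mathcal{E}_{\rm data}+\mathcal{E}_{\rm appr}(\delta)+\mathrm{osc}_\delta(\ell)$. If $\varepsilon\in(0,\varepsilon_0]$ satisfies $c_1\mathcal{E}\le\varepsilon\|u\|_{L_2(\Omega)}\le c_2\mathcal{E}$, then $$\|u-u_\varepsilon^\delta\|_{L_2(G)}\le K\,\mathcal{E}^{\alpha}\,\max\big(\mathcal{E},\|u\|_{L_2(\Omega)}\big)^{1-\alpha}.$$
   Context: All spaces are real. A domain is a non-empty open connected set; $D\Subset E$ means that $\overline D$ is a compact subset of $E$. $H^{-2}(\Omega)=(H^2_0(\Omega))'$. The operator $A=(B,C)\in\mathcal{L}(L_2(\Omega),H^{-2}(\Omega)\times L_2(\omega))$ is $(Bz)(v):=-\int_\Omega z\,\Delta v\,dx$ ($v\in H^2_0(\Omega)$), $Cz:=z|_\omega$; the norm on the product is $(\|\cdot\|_{H^{-2}(\Omega)}^2+\|\cdot\|_{L_2(\omega)}^2)^{1/2}$. It is a known result that an exponent $\alpha\in(0,1)$ as in the claim exists when $\omega\Subset G\Subset\Omega$; for $G=\omega$ one may take $\alpha=1$. Factors with exponent $0$ are read as $1$. Setting of nonconforming test spaces: $(X^\delta)_{\delta\in I}$ is a family of finite dimensional subspaces of $L_2(\Omega)$. $(Y^\delta)_{\delta\in I}$ is a family of finite dimensional Hilbert spaces (of functions on $\Omega$), not necessarily contained in $H^2_0(\Omega)$,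 with norms $\|\cdot\|_{Y^\delta}$. There are given: (i) operators $E^\delta\in\mathcal{L}(Y^\delta,H^2_0(\Omega))$ with $\sup_{\delta\in I}\|E^\delta\|_{\mathcal{L}(Y^\delta,H^2_0(\Omega))}<\infty$; (ii) operators $B^\delta\in\mathcal{L}\big(L_2(\Omega),(H^2_0(\Omega)+Y^\delta)'\big)$ with $(B^\delta z)(v)=(Bz)(v)$ for all $z\in L_2(\Omega)$, $v\in H^2_0(\Omega)$; (iii) (generalized Fortin) operators $Q^\delta\in\mathcal{L}(H^2_0(\Omega),Y^\delta)$ with $\sup_{\delta\in I}\|Q^\delta\|_{\mathcal{L}(H^2_0(\Omega),Y^\delta)}<\infty$ and $(B^\delta z)(v-Q^\delta v)=0$ for all $z\in X^\delta$, $v\in H^2_0(\Omega)$. The norm on $(Y^\delta)'$ is $\|f\|_{(Y^\delta)'}=\sup_{0\neq v\in Y^\delta}|f(v)|/\|v\|_{Y^\delta}$. *)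

theory Defs
  imports "HOL-Analysis.Analysis"
begin

text \<open>
  Elements of function spaces on an open set \<open>S\<close> are represented by functions on the whole of
  \<open>real^'n\<close> whose values outside \<open>S\<close> are irrelevant; equality in such a space is equality almost
  everywhere on \<open>S\<close>.  Spaces are sets of representatives closed under this equality.
\<close>

type_synonym 'n fn = "real^'n \<Rightarrow> real"

definition bounded_domain :: "(real^'n) set \<Rightarrow> bool" where
  "bounded_domain S \<longleftrightarrow> open S \<and> connected S \<and> S \<noteq> {} \<and> bounded S"

definition compactly_inside :: "'a::topological_space set \<Rightarrow> 'a set \<Rightarrow> bool"  (infix "\<Subset>" 50) where
  "D \<Subset> E \<longleftrightarrow> compact (closure D) \<and> closure D \<subseteq> E"

text \<open>A power with the convention that every factor with exponent 0 is 1 (whereas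
  \<^prop>\<open>0 powr 0 = (0::real)\<close>).\<close>

definition rpow :: "real \<Rightarrow> real \<Rightarrow> real" where
  "rpow x a = (if a = 0 then 1 else x powr a)"

definition ae_eq :: "(real^'n) set \<Rightarrow> 'n::finite fn \<Rightarrow> 'n fn \<Rightarrow> bool" where
  "ae_eq S f g \<longleftrightarrow> (AE x in lebesgue_on S. f x = g x)"


subsection \<open>Classical derivatives, harmonic functions, test functions\<close>

definition partial :: "'n \<Rightarrow> 'n::finite fn \<Rightarrow> 'n fn" where
  "partial i f = (\<lambda>x. frechet_derivative f (at x) (axis i 1))"

primrec Ck_on :: "nat \<Rightarrow> (real^'n) set \<Rightarrow> 'n::finite fn \<Rightarrow> bool" where
  "Ck_on 0 S f \<longleftrightarrow> continuous_on S f"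
| "Ck_on (Suc k) S f \<longleftrightarrow> (\<forall>x\<in>S. f differentiable (at x)) \<and> (\<forall>i. Ck_on k S (partial i f))"

definition harmonic_on :: "(real^'n) set \<Rightarrow> 'n::finite fn \<Rightarrow> bool" where
  "harmonic_on S w \<longleftrightarrow> Ck_on 2 S w \<and> (\<forall>x\<in>S. (\<Sum>i\<in>UNIV. partial i (partial i w) x) = 0)"

definition test_functions :: "(real^'n) set \<Rightarrow> 'n::finite fn set" where
  "test_functions S = {\<phi>. (\<forall>k. Ck_on k UNIV \<phi>) \<and> {x. \<phi> x \<noteq> 0} \<Subset> S}"


subsection \<open>\<open>L\<^sub>2\<close> and the Sobolev space \<open>H\<^sup>2\<^sub>0\<close>\<close>

definition L2 :: "(real^'n) set \<Rightarrow> 'n::finite fn set" where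
  "L2 S = {f \<in> borel_measurable (lebesgue_on S). integrable (lebesgue_on S) (\<lambda>x. (f x)\<^sup>2)}"

definition l2norm :: "(real^'n) set \<Rightarrow> 'n::finite fn \<Rightarrow> real" where
  "l2norm S f = sqrt (LINT x|lebesgue_on S. (f x)\<^sup>2)"

definition weak_partial :: "(real^'n) set \<Rightarrow> 'n \<Rightarrow> 'n::finite fn \<Rightarrow> 'n fn \<Rightarrow> bool" where
  "weak_partial S i v g \<longleftrightarrow> v \<in> L2 S \<and> g \<in> L2 S \<and>
     (\<forall>\<phi>\<in>test_functions S.
        (LINT x|lebesgue_on S. v x * partial i \<phi> x) = - (LINT x|lebesgue_on S. g x * \<phi> x))"

text \<open>The weak derivative is determined only up to a null set; we pick a representative.\<close>

definition wpartial :: "(real^'n) set \<Rightarrow> 'n \<Rightarrow> 'n::finite fn \<Rightarrow> 'n fn" where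
  "wpartial S i v = (SOME g. weak_partial S i v g)"

definition H2 :: "(real^'n) set \<Rightarrow> 'n::finite fn set" where
  "H2 S = {v \<in> L2 S. \<forall>i. \<exists>g. weak_partial S i v g \<and> (\<forall>j. \<exists>h. weak_partial S j g h)}"

definition h2norm :: "(real^'n) set \<Rightarrow> 'n::finite fn \<Rightarrow> real" where
  "h2norm S v = sqrt ((l2norm S v)\<^sup>2 + (\<Sum>i\<in>UNIV. (l2norm S (wpartial S i v))\<^sup>2)
      + (\<Sum>i\<in>UNIV. \<Sum>j\<in>UNIV. (l2norm S (wpartial S j (wpartial S i v)))\<^sup>2))"

definition H20 :: "(real^'n) set \<Rightarrow> 'n::finite fn set" where
  "H20 S = {v \<in> H2 S. \<forall>e>0. \<exists>\<phi>\<in>test_functions S. h2norm S (\<lambda>x. v x - \<phi> x) < e}"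

definition wlaplacian :: "(real^'n) set \<Rightarrow> 'n::finite fn \<Rightarrow> 'n fn" where
  "wlaplacian S v = (\<lambda>x. \<Sum>i\<in>UNIV. wpartial S i (wpartial S i v) x)"


subsection \<open>Duals and operators\<close>

text \<open>In the following, \<open>N\<close> is the norm of the function space \<open>V\<close>.  Representatives of zero have
  norm 0, and since division by 0 yields 0 they contribute 0 to the suprema below; so these are
  suprema over the nonzero elements of \<open>V\<close> (and 0 if there are none).\<close>

definition dual_norm :: "'n::finite fn set \<Rightarrow> ('n fn \<Rightarrow> real) \<Rightarrow> ('n fn \<Rightarrow> real) \<Rightarrow> real" where
  "dual_norm V N f = (SUP v\<in>V. \<bar>f v\<bar> / N v)"

definition dual :: "'n::finite fn set \<Rightarrow> ('n fn \<Rightarrow> real) \<Rightarrow> ('n fn \<Rightarrow> real) set" where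
  "dual V N = {f.
     (\<forall>v\<in>V. \<forall>w\<in>V. f (\<lambda>x. v x + w x) = f v + f w) \<and>
     (\<forall>c. \<forall>v\<in>V. f (\<lambda>x. c * v x) = c * f v) \<and>
     (\<exists>C. \<forall>v\<in>V. \<bar>f v\<bar> \<le> C * N v)}"

text \<open>Bounded linear operators between function spaces over \<open>S\<close>.  Linearity is understood almost
  everywhere; with boundedness it implies that \<open>T\<close> respects equality almost everywhere.\<close>

definition bounded_op ::
  "(real^'n) set \<Rightarrow> 'n::finite fn set \<Rightarrow> ('n fn \<Rightarrow> real) \<Rightarrow> 'n fn set \<Rightarrow> ('n fn \<Rightarrow> real)
     \<Rightarrow> ('n fn \<Rightarrow> 'n fn) set" where
  "bounded_op S V N W M = {T.
     (\<forall>v\<in>V. T v \<in> W) \<and>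
     (\<forall>v\<in>V. \<forall>w\<in>V. ae_eq S (T (\<lambda>x. v x + w x)) (\<lambda>x. T v x + T w x)) \<and>
     (\<forall>c. \<forall>v\<in>V. ae_eq S (T (\<lambda>x. c * v x)) (\<lambda>x. c * T v x)) \<and>
     (\<exists>C. \<forall>v\<in>V. M (T v) \<le> C * N v)}"

definition op_norm ::
  "'n::finite fn set \<Rightarrow> ('n fn \<Rightarrow> real) \<Rightarrow> ('n fn \<Rightarrow> real) \<Rightarrow> ('n fn \<Rightarrow> 'n fn) \<Rightarrow> real" where
  "op_norm V N M T = (SUP v\<in>V. M (T v) / N v)"

text \<open>Bounded linear operators from \<open>V\<close> into the dual of \<open>W\<close>.\<close>

definition bounded_dual_op ::
  "'n::finite fn set \<Rightarrow> ('n fn \<Rightarrow> real) \<Rightarrow> 'n fn set \<Rightarrow> ('n fn \<Rightarrow> real)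
     \<Rightarrow> ('n fn \<Rightarrow> 'n fn \<Rightarrow> real) set" where
  "bounded_dual_op V N W M = {T.
     (\<forall>z\<in>V. T z \<in> dual W M) \<and>
     (\<forall>z\<in>V. \<forall>z'\<in>V. \<forall>w\<in>W. T (\<lambda>x. z x + z' x) w = T z w + T z' w) \<and>
     (\<forall>c. \<forall>z\<in>V. \<forall>w\<in>W. T (\<lambda>x. c * z x) w = c * T z w) \<and>
     (\<exists>C. \<forall>z\<in>V. dual_norm W M (T z) \<le> C * N z)}"

definition sum_space :: "'n::finite fn set \<Rightarrow> 'n fn set \<Rightarrow> 'n fn set" where
  "sum_space V W = {\<lambda>x. v x + w x |v w. v \<in> V \<and> w \<in> W}"

definition sum_norm ::
  "'n::finite fn set \<Rightarrow> ('n fn \<Rightarrow> real) \<Rightarrow> 'n fn set \<Rightarrow> ('n fn \<Rightarrow> real) \<Rightarrow> 'n fn \<Rightarrow> real" where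
  "sum_norm V N W M u = Inf {N v + M w |v w. v \<in> V \<and> w \<in> W \<and> u = (\<lambda>x. v x + w x)}"

text \<open>\<open>V\<close> consists of all functions equal a.e. on \<open>S\<close> to a linear combination of finitely many
  given functions; these need be neither linearly independent nor measurable.\<close>

definition fin_dim_space :: "(real^'n) set \<Rightarrow> 'n::finite fn set \<Rightarrow> bool" where
  "fin_dim_space S V \<longleftrightarrow>
     (\<exists>(m::nat) b. V = {f. \<exists>c. ae_eq S f (\<lambda>x. \<Sum>k<m. c k * b k x)})"

definition inner_product_on ::
  "(real^'n) set \<Rightarrow> 'n::finite fn set \<Rightarrow> ('n fn \<Rightarrow> 'n fn \<Rightarrow> real) \<Rightarrow> bool" where
  "inner_product_on S V ip \<longleftrightarrow>
     (\<forall>u\<in>V. \<forall>v\<in>V. ip u v = ip v u) \<and>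
     (\<forall>u\<in>V. \<forall>v\<in>V. \<forall>w\<in>V. ip (\<lambda>x. u x + v x) w = ip u w + ip v w) \<and>
     (\<forall>c. \<forall>u\<in>V. \<forall>v\<in>V. ip (\<lambda>x. c * u x) v = c * ip u v) \<and>
     (\<forall>v\<in>V. ip v v \<ge> 0) \<and>
     (\<forall>v\<in>V. ip v v = 0 \<longleftrightarrow> ae_eq S v (\<lambda>x. 0))"

definition ip_norm :: "('n::finite fn \<Rightarrow> 'n fn \<Rightarrow> real) \<Rightarrow> 'n fn \<Rightarrow> real" where
  "ip_norm ip v = sqrt (ip v v)"


subsection \<open>The operator \<open>A = (B, C)\<close>\<close>

definition Hm2 :: "(real^'n) set \<Rightarrow> ('n::finite fn \<Rightarrow> real) set" where
  "Hm2 S = dual (H20 S) (h2norm S)"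

definition hm2norm :: "(real^'n) set \<Rightarrow> ('n::finite fn \<Rightarrow> real) \<Rightarrow> real" where
  "hm2norm S f = dual_norm (H20 S) (h2norm S) f"

definition opB :: "(real^'n) set \<Rightarrow> 'n::finite fn \<Rightarrow> 'n fn \<Rightarrow> real" where
  "opB S z v = - (LINT x|lebesgue_on S. z x * wlaplacian S v x)"

definition opC :: "(real^'n) set \<Rightarrow> 'n::finite fn \<Rightarrow> 'n fn" where
  "opC \<omega> z = restrict z \<omega>"

definition opA ::
  "(real^'n) set \<Rightarrow> (real^'n) set \<Rightarrow> 'n::finite fn \<Rightarrow> ('n fn \<Rightarrow> real) \<times> 'n fn" where
  "opA S \<omega> z = (opB S z, opC \<omega> z)"

definition prod_norm ::
  "(real^'n) set \<Rightarrow> (real^'n) set \<Rightarrow> ('n::finite fn \<Rightarrow> real) \<times> 'n fn \<Rightarrow> real" where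
  "prod_norm S \<omega> p = sqrt ((hm2norm S (fst p))\<^sup>2 + (l2norm \<omega> (snd p))\<^sup>2)"

definition E_data ::
  "(real^'n) set \<Rightarrow> (real^'n) set \<Rightarrow> 'n::finite fn \<Rightarrow> ('n fn \<Rightarrow> real) \<Rightarrow> 'n fn \<Rightarrow> real" where
  "E_data S \<omega> u l q =
     prod_norm S \<omega> (\<lambda>v. fst (opA S \<omega> u) v - l v, \<lambda>x. snd (opA S \<omega> u) x - q x)"

text \<open>For a finite dimensional \<open>X\<close> the infimum is a minimum.\<close>

definition E_appr :: "(real^'n) set \<Rightarrow> 'n::finite fn set \<Rightarrow> 'n fn \<Rightarrow> real" where
  "E_appr S X u = (INF z\<in>X. l2norm S (\<lambda>x. u x - z x))"


subsection \<open>The regularized least squares approximation\<close>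

definition lsq_functional ::
  "(real^'n) set \<Rightarrow> (real^'n) set \<Rightarrow> 'n::finite fn set \<Rightarrow> ('n fn \<Rightarrow> real) \<Rightarrow> ('n fn \<Rightarrow> 'n fn \<Rightarrow> real)
     \<Rightarrow> real \<Rightarrow> ('n fn \<Rightarrow> real) \<Rightarrow> 'n fn \<Rightarrow> 'n fn \<Rightarrow> real" where
  "lsq_functional S \<omega> Y N B\<delta> \<epsilon> l\<delta> q z =
     (dual_norm Y N (\<lambda>v. B\<delta> z v - l\<delta> v))\<^sup>2 + (l2norm \<omega> (\<lambda>x. opC \<omega> z x - q x))\<^sup>2
       + \<epsilon>\<^sup>2 * (l2norm S z)\<^sup>2"

definition lsq_solution ::
  "(real^'n) set \<Rightarrow> (real^'n) set \<Rightarrow> 'n::finite fn set \<Rightarrow> 'n fn set \<Rightarrow> ('n fn \<Rightarrow> real)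
     \<Rightarrow> ('n fn \<Rightarrow> 'n fn \<Rightarrow> real) \<Rightarrow> real \<Rightarrow> ('n fn \<Rightarrow> real) \<Rightarrow> 'n fn \<Rightarrow> 'n fn" where
  "lsq_solution S \<omega> X Y N B\<delta> \<epsilon> l\<delta> q =
     arg_min (lsq_functional S \<omega> Y N B\<delta> \<epsilon> l\<delta> q) (\<lambda>z. z \<in> X)"

end

(* For z = u - u_eps, the least squares property, the Fortin operator and the consistency
   bound give ||z|| on omega and ||Bz|| of order E, and ||z|| on Omega of order max(E, ||u||).
   The adjoint of B is minus the Laplacian on H20, which is bounded below (integration by parts
   and Poincare).  Hence projecting z onto the closure of the Laplacians of test functions splits
   off a part of size ||Bz||, and the rest is weakly harmonic, so harmonic by Weyl's lemma, and
   the assumed interpolation inequality applies to it. *)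
theory Submission
  imports Defs
begin

text \<open>The interpolation inequality concerns harmonic functions only, whereas
  \<open>u - ue\<close> merely has a small image under \<open>opB\<close>; the splitting bridges
  this gap. All lower bounds for the Laplacian are proved on test functions, where two integrations
  by parts show that Hessian and Laplacian have the same L2 norm; this is why the projection is
  built from Laplacians of test functions. The coupling of \<epsilon> to the error has two separate
  uses: its upper half keeps the regularization term of the functional of order \<open>\<E>\<close>,
  its lower half turns \<open>\<epsilon> * l2norm \<Omega> ue \<le> A2 * \<E>\<close> into a bound
  of \<open>ue\<close> by a multiple of \<open>u\<close> that no longer contains \<epsilon>. On the
  discrete side, consistency compares the residual on \<open>Y\<close> with the continuous residual
  at \<open>E v\<close>, and the Fortin operator carries residuals of elements of \<open>X\<close>
  back to \<open>H20\<close>; only constants common to all \<delta> may enter there. For Weyl's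
  lemma the mollifier is shaped such that its derivative in the radius parameter is a multiple of
  the Laplacian of a test function, which weakly harmonic functions cannot see.\<close>

definition l2ip :: "(real^'n) set \<Rightarrow> 'n::finite fn \<Rightarrow> 'n fn \<Rightarrow> real" where
  "l2ip S f g = (LINT x|lebesgue_on S. f x * g x)"

section \<open>The Hilbert space L2 in terms of representatives\<close>

lemma L2D:
  assumes "f \<in> L2 S"
  shows "f \<in> borel_measurable (lebesgue_on S)" "integrable (lebesgue_on S) (\<lambda>x. (f x)\<^sup>2)"
  using assms by (auto simp: L2_def)

lemma L2_mult_integrable:
  assumes "f \<in> L2 S" "g \<in> L2 S"
  shows "integrable (lebesgue_on S) (\<lambda>x. f x * g x)"
proof (rule Bochner_Integration.integrable_bound)
  show "integrable (lebesgue_on S) (\<lambda>x. (f x)\<^sup>2 + (g x)\<^sup>2)"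
    using assms by (intro Bochner_Integration.integrable_add L2D)
  show "(\<lambda>x. f x * g x) \<in> borel_measurable (lebesgue_on S)"
    using assms by (intro borel_measurable_times L2D)
  have "norm (a * b) \<le> norm (a\<^sup>2 + b\<^sup>2)" for a b :: real
  proof -
    have "\<bar>a * b\<bar> \<le> a\<^sup>2 + b\<^sup>2"
      using sum_squares_bound[of "\<bar>a\<bar>" "\<bar>b\<bar>"] mult_nonneg_nonneg[of "\<bar>a\<bar>" "\<bar>b\<bar>"]
      unfolding abs_mult power2_abs by linarith
    then show ?thesis by auto
  qed
  then show "AE x in lebesgue_on S. norm (f x * g x) \<le> norm ((f x)\<^sup>2 + (g x)\<^sup>2)" by simp
qed

lemma L2_cmult: "f \<in> L2 S \<Longrightarrow> (\<lambda>x. c * f x) \<in> L2 S"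
  by (auto simp: L2_def power_mult_distrib)

lemma L2_add:
  assumes "f \<in> L2 S" "g \<in> L2 S"
  shows "(\<lambda>x. f x + g x) \<in> L2 S"
proof -
  have "integrable (lebesgue_on S) (\<lambda>x. (f x)\<^sup>2 + (g x)\<^sup>2 + 2 * (f x * g x))"
    using assms by (intro Bochner_Integration.integrable_add integrable_mult_right L2_mult_integrable L2D)
  then show ?thesis using assms by (auto simp: L2_def power2_sum algebra_simps)
qed

lemma L2_diff: "f \<in> L2 S \<Longrightarrow> g \<in> L2 S \<Longrightarrow> (\<lambda>x. f x - g x) \<in> L2 S"
  using L2_add[of f S "\<lambda>x. -1 * g x"] L2_cmult[of g S "-1"] by simp

lemma L2_minus: "f \<in> L2 S \<Longrightarrow> (\<lambda>x. - f x) \<in> L2 S"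
  using L2_cmult[of f S "-1"] by simp

lemma L2_zero: "(\<lambda>x. 0) \<in> L2 S"
  by (auto simp: L2_def)

lemma L2_sum: "(\<And>i. i \<in> A \<Longrightarrow> f i \<in> L2 S) \<Longrightarrow> (\<lambda>x. \<Sum>i\<in>A. f i x) \<in> L2 S"
proof (induction A rule: infinite_finite_induct)
  case (insert a F)
  then show ?case using L2_add[of "f a" S "\<lambda>x. \<Sum>i\<in>F. f i x"] by auto
qed (auto simp: L2_zero)

lemma l2ip_commute: "l2ip S f g = l2ip S g f"
  by (simp add: l2ip_def mult.commute)

lemma l2ip_add:
  assumes "f \<in> L2 S" "g \<in> L2 S" "h \<in> L2 S"
  shows "l2ip S (\<lambda>x. f x + g x) h = l2ip S f h + l2ip S g h"
  using L2_mult_integrable[of f S h] L2_mult_integrable[of g S h] assms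
  by (simp add: l2ip_def distrib_right)

lemma l2ip_diff:
  assumes "f \<in> L2 S" "g \<in> L2 S" "h \<in> L2 S"
  shows "l2ip S (\<lambda>x. f x - g x) h = l2ip S f h - l2ip S g h"
  using L2_mult_integrable[of f S h] L2_mult_integrable[of g S h] assms
  by (simp add: l2ip_def left_diff_distrib)

lemma l2ip_cmult: "l2ip S (\<lambda>x. c * f x) h = c * l2ip S f h"
  by (simp add: l2ip_def mult.assoc)

lemma l2ip_sum:
  assumes "\<And>i. i \<in> A \<Longrightarrow> f i \<in> L2 S" "h \<in> L2 S"
  shows "l2ip S (\<lambda>x. \<Sum>i\<in>A. f i x) h = (\<Sum>i\<in>A. l2ip S (f i) h)"
  unfolding l2ip_def sum_distrib_right
  by (rule Bochner_Integration.integral_sum) (use assms L2_mult_integrable in auto)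

lemma l2norm_nonneg [simp]: "0 \<le> l2norm S f"
  by (simp add: l2norm_def)

lemma l2norm_power2: "(l2norm S f)\<^sup>2 = l2ip S f f"
  by (simp add: l2norm_def l2ip_def power2_eq_square)

lemma l2norm_zero [simp]: "l2norm S (\<lambda>x. 0) = 0"
  by (simp add: l2norm_def)

lemma l2norm_cmult: "l2norm S (\<lambda>x. c * f x) = \<bar>c\<bar> * l2norm S f"
  by (simp add: l2norm_def power_mult_distrib real_sqrt_mult)

lemma l2norm_minus: "l2norm S (\<lambda>x. - f x) = l2norm S f"
  by (simp add: l2norm_def)

lemma l2norm_minus_commute: "l2norm S (\<lambda>x. f x - g x) = l2norm S (\<lambda>x. g x - f x)"
  by (simp add: l2norm_def power2_commute)

lemma l2norm_add_power2:
  assumes "f \<in> L2 S" "g \<in> L2 S"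
  shows "(l2norm S (\<lambda>x. f x + g x))\<^sup>2 = (l2norm S f)\<^sup>2 + 2 * l2ip S f g + (l2norm S g)\<^sup>2"
proof -
  have "l2ip S (\<lambda>x. f x + g x) (\<lambda>x. f x + g x)
      = l2ip S f (\<lambda>x. f x + g x) + l2ip S g (\<lambda>x. f x + g x)"
    using assms by (intro l2ip_add L2_add)
  moreover have "l2ip S f (\<lambda>x. f x + g x) = l2ip S f f + l2ip S g f"
    using l2ip_add[OF assms assms(1)] by (simp only: l2ip_commute[of S f "\<lambda>x. f x + g x"])
  moreover have "l2ip S g (\<lambda>x. f x + g x) = l2ip S f g + l2ip S g g"
    using l2ip_add[OF assms assms(2)] by (simp only: l2ip_commute[of S g "\<lambda>x. f x + g x"])
  ultimately show ?thesis
    by (simp add: l2norm_power2 l2ip_commute[of S g f])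
qed

text \<open>Nonnegativity of the squared norm of \<open>s * f + t * g\<close> as a quadratic form in
  two real parameters. The case \<open>l2norm S f = 0\<close> is separate, since it does not mean
  that the representative \<open>f\<close> vanishes identically.\<close>

lemma l2ip_le:
  assumes "f \<in> L2 S" "g \<in> L2 S"
  shows "\<bar>l2ip S f g\<bar> \<le> l2norm S f * l2norm S g"
proof -
  define a b p where "a = (l2norm S f)\<^sup>2" and "b = (l2norm S g)\<^sup>2" and "p = l2ip S f g"
  have quad: "0 \<le> s\<^sup>2 * a + 2 * s * t * p + t\<^sup>2 * b" for s t :: real
  proof -
    have "0 \<le> (l2norm S (\<lambda>x. s * f x + t * g x))\<^sup>2" by simp
    also have "\<dots> = s\<^sup>2 * a + 2 * s * t * p + t\<^sup>2 * b"
    proof -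
      have "l2ip S (\<lambda>x. s * f x) (\<lambda>x. t * g x) = s * t * p"
        using l2ip_cmult[of S t g f]
        by (simp add: p_def l2ip_cmult l2ip_commute[of S f "\<lambda>x. t * g x"] l2ip_commute[of S g f])
      then show ?thesis
        using assms by (simp add: l2norm_add_power2 L2_cmult l2norm_cmult power_mult_distrib a_def b_def)
    qed
    finally show ?thesis .
  qed
  have "a \<ge> 0" "b \<ge> 0" by (auto simp: a_def b_def)
  have "p\<^sup>2 \<le> a * b"
  proof (cases "a = 0")
    case True
    have "p = 0"
    proof (rule ccontr)
      assume "p \<noteq> 0"
      \<comment> \<open>With \<open>a = 0\<close> the form is affine in \<open>s\<close>; this value
        of \<open>s\<close> makes it equal to -1.\<close>
      have "0 \<le> 2 * (- (b + 1) / (2 * p)) * 1 * p + 1\<^sup>2 * b"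
        using quad[of "- (b + 1) / (2 * p)" 1] True by simp
      then show False using \<open>p \<noteq> 0\<close> by (simp add: field_simps)
    qed
    then show ?thesis using True by simp
  next
    case False
    then have "a > 0" using \<open>a \<ge> 0\<close> by simp
    \<comment> \<open>The choice \<open>s = -p\<close>, \<open>t = a\<close> turns the form into
      this product.\<close>
    have "0 \<le> a * (a * b - p\<^sup>2)"
      using quad[of "-p" a] by (simp add: power2_eq_square algebra_simps)
    then show ?thesis using \<open>a > 0\<close> by (simp add: zero_le_mult_iff)
  qed
  then have "\<bar>p\<bar>\<^sup>2 \<le> (l2norm S f * l2norm S g)\<^sup>2"
    by (simp add: a_def b_def power_mult_distrib)
  then show ?thesis unfolding p_def by (rule power2_le_imp_le) simp
qed

lemma l2norm_triangle:
  assumes "f \<in> L2 S" "g \<in> L2 S"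
  shows "l2norm S (\<lambda>x. f x + g x) \<le> l2norm S f + l2norm S g"
proof (rule power2_le_imp_le)
  show "(l2norm S (\<lambda>x. f x + g x))\<^sup>2 \<le> (l2norm S f + l2norm S g)\<^sup>2"
    using l2ip_le[OF assms] by (simp add: l2norm_add_power2[OF assms] power2_sum)
qed simp

lemma l2norm_triangle_diff:
  assumes "f \<in> L2 S" "g \<in> L2 S"
  shows "l2norm S (\<lambda>x. f x - g x) \<le> l2norm S f + l2norm S g"
  using l2norm_triangle[OF assms(1) L2_minus[OF assms(2)]] by (simp add: l2norm_minus)

lemma l2norm_triangle3:
  assumes "f \<in> L2 S" "g \<in> L2 S" "h \<in> L2 S"
  shows "l2norm S (\<lambda>x. f x - h x) \<le> l2norm S (\<lambda>x. f x - g x) + l2norm S (\<lambda>x. g x - h x)"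
  using l2norm_triangle[OF L2_diff[OF assms(1,2)] L2_diff[OF assms(2,3)]] by simp

lemma l2norm_sum_le:
  assumes "\<And>i. i \<in> A \<Longrightarrow> f i \<in> L2 S"
  shows "l2norm S (\<lambda>x. \<Sum>i\<in>A. f i x) \<le> (\<Sum>i\<in>A. l2norm S (f i))"
  using assms
proof (induction A rule: infinite_finite_induct)
  case (insert a F)
  then show ?case
    using l2norm_triangle[of "f a" S "\<lambda>x. \<Sum>i\<in>F. f i x"] L2_sum[of F f S] by auto
qed auto

lemma l2norm_eq_0_AE:
  assumes "f \<in> L2 S" "l2norm S f = 0"
  shows "AE x in lebesgue_on S. f x = 0"
proof -
  have "(LINT x|lebesgue_on S. (f x)\<^sup>2) = 0" using assms(2) by (simp add: l2norm_def)
  then have "AE x in lebesgue_on S. (f x)\<^sup>2 = 0"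
    using integral_nonneg_eq_0_iff_AE[of "lebesgue_on S" "\<lambda>x. (f x)\<^sup>2"] L2D(2)[OF assms(1)] by simp
  then show ?thesis by simp
qed

lemma l2norm_cong_AE:
  assumes "f \<in> L2 S" "g \<in> L2 S" "AE x in lebesgue_on S. f x = g x"
  shows "l2norm S f = l2norm S g"
  unfolding l2norm_def
  by (rule arg_cong[of _ _ sqrt], rule integral_cong_AE) (use assms in \<open>auto intro!: borel_measurable_power borel_measurable_times intro: L2D(1)\<close>)

lemma l2ip_cong_AE:
  assumes "f \<in> L2 S" "g \<in> L2 S" "h \<in> L2 S" "AE x in lebesgue_on S. f x = g x"
  shows "l2ip S f h = l2ip S g h"
  unfolding l2ip_def
  by (rule integral_cong_AE) (use assms in \<open>auto intro!: borel_measurable_power borel_measurable_times intro: L2D(1)\<close>)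

lemma L2_subset:
  assumes "f \<in> L2 S" "T \<subseteq> S" "T \<in> sets lebesgue" "S \<in> sets lebesgue"
  shows "f \<in> L2 T" and "l2norm T f \<le> l2norm S f"
proof -
  have *: "set_integrable lebesgue S (\<lambda>x. (f x)\<^sup>2)"
    using L2D(2)[OF assms(1)] assms(4)
    by (simp add: set_integrable_def integrable_restrict_space)
  then have **: "set_integrable lebesgue T (\<lambda>x. (f x)\<^sup>2)"
    by (rule set_integrable_subset) (use assms in auto)
  have "f \<in> borel_measurable (lebesgue_on T)"
    using L2D(1)[OF assms(1)] assms(2) measurable_restrict_mono by blast
  then show "f \<in> L2 T"
    using ** assms(3) by (simp add: set_integrable_def integrable_restrict_space L2_def)
  have "(LINT x:T|lebesgue. (f x)\<^sup>2) \<le> (LINT x:S|lebesgue. (f x)\<^sup>2)"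
    unfolding set_lebesgue_integral_def
    by (rule integral_mono) (use * ** assms(2) in \<open>auto simp: set_integrable_def indicator_def\<close>)
  then show "l2norm T f \<le> l2norm S f"
    using assms(3,4)
    by (simp add: l2norm_def integral_restrict_space set_lebesgue_integral_def)
qed

lemma L2_integrable:
  assumes "f \<in> L2 S" "S \<in> lmeasurable"
  shows "integrable (lebesgue_on S) f"
proof -
  have "(\<lambda>x. 1) \<in> L2 S"
    using assms(2) by (auto simp: L2_def intro!: finite_measure.integrable_const finite_measure_lebesgue_on)
  from L2_mult_integrable[OF assms(1) this] show ?thesis by simp
qed

text \<open>Along a sequence with geometric increments the increments are absolutely summable almost
  everywhere, and Fatou's lemma bounds the distance to the pointwise limit.\<close>

lemma L2_complete_fast:
  fixes f :: "nat \<Rightarrow> 'n::finite fn"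
  assumes S: "S \<in> lmeasurable" and f: "\<And>k. f k \<in> L2 S"
    and fast: "\<And>j k. k \<le> j \<Longrightarrow> l2norm S (\<lambda>x. f j x - f k x) \<le> C * (1/2)^k"
  obtains g where "g \<in> L2 S" "\<And>k. l2norm S (\<lambda>x. g x - f k x) \<le> C * (1/2)^k"
proof -
  let ?M = "lebesgue_on S"
  interpret finite_measure ?M using S by (rule finite_measure_lebesgue_on)
  have [measurable]: "f k \<in> borel_measurable ?M" for k using L2D(1)[OF f] .
  have one: "(\<lambda>x. 1) \<in> L2 S" by (auto simp: L2_def)
  have C0: "0 \<le> C" using fast[of 0 0] by simp
  have d2: "(\<lambda>x. \<bar>f (Suc k) x - f k x\<bar>) \<in> L2 S" for k
    using L2_diff[OF f[of "Suc k"] f[of k]] by (auto simp: L2_def)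
  have int: "integrable ?M (\<lambda>x. \<bar>f (Suc k) x - f k x\<bar>)" for k
    using L2_integrable[OF d2 S] .
  \<comment> \<open>\<open>S\<close> has finite measure, so pairing the increments with the constant
    1 turns their L2 bounds into summable L1 bounds.\<close>
  have bnd: "(LINT x|?M. \<bar>f (Suc k) x - f k x\<bar>) \<le> C * (1/2)^k * l2norm S (\<lambda>x. 1)" for k
  proof -
    have "(LINT x|?M. \<bar>f (Suc k) x - f k x\<bar>) = l2ip S (\<lambda>x. \<bar>f (Suc k) x - f k x\<bar>) (\<lambda>x. 1)"
      by (simp add: l2ip_def)
    also have "\<dots> \<le> l2norm S (\<lambda>x. \<bar>f (Suc k) x - f k x\<bar>) * l2norm S (\<lambda>x. 1)"
      by (rule order_trans[OF abs_ge_self l2ip_le[OF d2 one]])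
    also have "l2norm S (\<lambda>x. \<bar>f (Suc k) x - f k x\<bar>) = l2norm S (\<lambda>x. f (Suc k) x - f k x)"
      by (simp add: l2norm_def)
    also have "\<dots> * l2norm S (\<lambda>x. 1) \<le> C * (1/2)^k * l2norm S (\<lambda>x. 1)"
      by (intro mult_right_mono fast) auto
    finally show ?thesis .
  qed
  have "(\<Sum>k. \<integral>\<^sup>+x. ennreal \<bar>f (Suc k) x - f k x\<bar> \<partial>?M) \<le> (\<Sum>k. ennreal (C * (1/2)^k * l2norm S (\<lambda>x. 1)))"
    using bnd int by (intro suminf_le) (auto simp: nn_integral_eq_integral intro!: ennreal_leI)
  also have "\<dots> = ennreal (\<Sum>k. C * (1/2)^k * l2norm S (\<lambda>x. 1))"
    using C0 by (intro suminf_ennreal2) (auto intro!: summable_mult summable_mult2 summable_geometric)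
  finally have "(\<integral>\<^sup>+x. (\<Sum>k. ennreal \<bar>f (Suc k) x - f k x\<bar>) \<partial>?M) < \<infinity>"
    by (subst nn_integral_suminf) (auto simp: top.not_eq_extremum intro: le_less_trans)
  then have "AE x in ?M. (\<Sum>k. ennreal \<bar>f (Suc k) x - f k x\<bar>) \<noteq> \<infinity>"
    by (intro nn_integral_noteq_infinite) auto
  then have conv: "AE x in ?M. convergent (\<lambda>k. f k x)"
  proof eventually_elim
    case (elim x)
    then have "summable (\<lambda>k. \<bar>f (Suc k) x - f k x\<bar>)"
      by (intro summable_suminf_not_top) auto
    then have "summable (\<lambda>k. f (Suc k) x - f k x)"
      by (rule summable_rabs_cancel)
    then obtain s where "(\<lambda>n. \<Sum>k<n. f (Suc k) x - f k x) \<longlonglongrightarrow> s"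
      by (auto simp: summable_def sums_def)
    then have "(\<lambda>n. f n x - f 0 x) \<longlonglongrightarrow> s" by (simp only: sum_lessThan_telescope[of "\<lambda>k. f k x"])
    then have "(\<lambda>n. (f n x - f 0 x) + f 0 x) \<longlonglongrightarrow> s + f 0 x" by (intro tendsto_intros)
    then show ?case by (auto simp: convergent_def)
  qed
  define g where "g x = lim (\<lambda>k. f k x)" for x
  have [measurable]: "g \<in> borel_measurable ?M" unfolding g_def by measurable
  have lim: "AE x in ?M. (\<lambda>k. f k x) \<longlonglongrightarrow> g x"
    using conv by eventually_elim (simp add: g_def convergent_LIMSEQ_iff)
  have nb: "(\<integral>\<^sup>+x. ennreal ((g x - f k x)\<^sup>2) \<partial>?M) \<le> ennreal ((C * (1/2)^k)\<^sup>2)" for k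
  proof -
    have "(\<integral>\<^sup>+x. ennreal ((g x - f k x)\<^sup>2) \<partial>?M) = (\<integral>\<^sup>+x. liminf (\<lambda>j. ennreal ((f j x - f k x)\<^sup>2)) \<partial>?M)"
    proof (rule nn_integral_cong_AE)
      show "AE x in ?M. ennreal ((g x - f k x)\<^sup>2) = liminf (\<lambda>j. ennreal ((f j x - f k x)\<^sup>2))"
        using lim
      proof eventually_elim
        case (elim x)
        then have "(\<lambda>j. ennreal ((f j x - f k x)\<^sup>2)) \<longlonglongrightarrow> ennreal ((g x - f k x)\<^sup>2)"
          by (intro tendsto_intros) auto
        then show ?case by (intro lim_imp_Liminf[symmetric]) auto
      qed
    qed
    also have "\<dots> \<le> liminf (\<lambda>j. \<integral>\<^sup>+x. ennreal ((f j x - f k x)\<^sup>2) \<partial>?M)"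
      by (rule nn_integral_liminf) auto
    also have "\<dots> \<le> liminf (\<lambda>j. ennreal ((C * (1/2)^k)\<^sup>2))"
    proof (rule Liminf_mono)
      have "(\<integral>\<^sup>+x. ennreal ((f j x - f k x)\<^sup>2) \<partial>?M) \<le> ennreal ((C * (1/2)^k)\<^sup>2)" if "k \<le> j" for j
      proof -
        have "(\<integral>\<^sup>+x. ennreal ((f j x - f k x)\<^sup>2) \<partial>?M) = ennreal ((l2norm S (\<lambda>x. f j x - f k x))\<^sup>2)"
          using L2D(2)[OF L2_diff[OF f[of j] f[of k]]]
          by (subst nn_integral_eq_integral) (simp_all add: l2norm_def)
        also have "\<dots> \<le> ennreal ((C * (1/2)^k)\<^sup>2)"
          using fast[OF that] by (intro ennreal_leI power_mono) auto
        finally show ?thesis .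
      qed
      then show "\<forall>\<^sub>F j in sequentially. (\<integral>\<^sup>+x. ennreal ((f j x - f k x)\<^sup>2) \<partial>?M) \<le> ennreal ((C * (1/2)^k)\<^sup>2)"
        by (auto simp: eventually_sequentially)
    qed
    finally show ?thesis by (simp add: Liminf_const)
  qed
  have d: "(\<lambda>x. g x - f k x) \<in> L2 S" for k
  proof -
    have "integrable ?M (\<lambda>x. (g x - f k x)\<^sup>2)"
      using nb[of k] by (intro integrableI_bounded) (auto intro: le_less_trans)
    then show ?thesis by (auto simp: L2_def)
  qed
  show ?thesis
  proof
    show "g \<in> L2 S" using L2_add[OF d[of 0] f[of 0]] by simp
    fix k
    have "ennreal ((l2norm S (\<lambda>x. g x - f k x))\<^sup>2) = (\<integral>\<^sup>+x. ennreal ((g x - f k x)\<^sup>2) \<partial>?M)"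
      using L2D(2)[OF d[of k]]
      by (subst nn_integral_eq_integral) (simp_all add: l2norm_def)
    then have "(l2norm S (\<lambda>x. g x - f k x))\<^sup>2 \<le> (C * (1/2)^k)\<^sup>2"
      using nb[of k] by (metis ennreal_le_iff zero_le_power2)
    then show "l2norm S (\<lambda>x. g x - f k x) \<le> C * (1/2)^k"
      by (rule power2_le_imp_le) (use C0 in auto)
  qed
qed

section \<open>Smooth functions\<close>

abbreviation smooth :: "'n::finite fn \<Rightarrow> bool" where
  "smooth f \<equiv> \<forall>k. Ck_on k UNIV f"

lemma partial_eq:
  assumes "(f has_derivative f') (at x)"
  shows "partial i f x = f' (axis i 1)"
  using frechet_derivative_at[OF assms] by (simp add: partial_def)

lemma has_derivative_partial:
  fixes f :: "'n::finite fn"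
  assumes "f differentiable (at x)"
  shows "(f has_derivative (\<lambda>v. \<Sum>i\<in>UNIV. v $ i * partial i f x)) (at x)"
proof -
  let ?D = "frechet_derivative f (at x)"
  have D: "(f has_derivative ?D) (at x)" using assms frechet_derivative_works by blast
  interpret linear ?D using has_derivative_linear[OF D] .
  have "?D v = (\<Sum>i\<in>UNIV. v $ i * partial i f x)" for v
  proof -
    have "?D v = ?D (\<Sum>i\<in>UNIV. (v $ i) *\<^sub>R axis i 1)"
      using basis_expansion[of v] by (simp add: scalar_mult_eq_scaleR)
    also have "\<dots> = (\<Sum>i\<in>UNIV. v $ i * partial i f x)"
      by (simp add: sum scale partial_def)
    finally show ?thesis .
  qed
  then show ?thesis using D by (metis (no_types, lifting) ext)
qed


lemma has_derivative_local:
  fixes f g :: "'n::finite fn"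
  assumes "open U" "x \<in> U" "\<And>y. y \<in> U \<Longrightarrow> f y = g y"
  shows "(f has_derivative D) (at x) \<longleftrightarrow> (g has_derivative D) (at x)"
  using has_derivative_transform_within_open[of f D x UNIV U g]
    has_derivative_transform_within_open[of g D x UNIV U f] assms by auto

lemma partial_cong_open:
  fixes f g :: "'n::finite fn"
  assumes "open U" "x \<in> U" "\<And>y. y \<in> U \<Longrightarrow> f y = g y"
  shows "partial i f x = partial i g x"
  using has_derivative_local[OF assms] by (simp add: partial_def frechet_derivative_def)

lemma Ck_on_SucD: "Ck_on (Suc k) S f \<Longrightarrow> Ck_on k S f"
proof (induction k arbitrary: f)
  case 0
  then have "f differentiable_on S"
    by (auto simp: differentiable_on_def intro: differentiable_at_withinI)
  then show ?case by (simp add: differentiable_imp_continuous_on)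
qed auto

lemma smooth_partial: "smooth f \<Longrightarrow> smooth (partial i f)"
  by (metis Ck_on.simps(2))

lemma smooth_differentiable: "smooth f \<Longrightarrow> f differentiable (at x)"
  by (metis Ck_on.simps(2) UNIV_I)

lemma smooth_continuous: "smooth f \<Longrightarrow> continuous_on A f"
  by (metis Ck_on.simps(1) continuous_on_subset subset_UNIV)

lemma smooth_borel: "smooth f \<Longrightarrow> f \<in> borel_measurable borel"
  using smooth_continuous by (rule borel_measurable_continuous_onI)

text \<open>Agreement on an open set passes to \<open>partial\<close>, which drives the induction.
  The form with a separate \<open>g\<close> at every point is made for functions that coincide near
  each point with a different global convolution.\<close>

lemma Ck_on_local:
  assumes "\<And>x. x \<in> S \<Longrightarrow> \<exists>U g. open U \<and> x \<in> U \<and> Ck_on k UNIV g \<and> (\<forall>y\<in>U. f y = g y)"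
  shows "Ck_on k S f"
  using assms
proof (induction k arbitrary: f)
  case 0
  have "isCont f x" if "x \<in> S" for x
  proof -
    from 0[OF that] obtain U g where U: "open U" "x \<in> U" "continuous_on UNIV g" "\<forall>y\<in>U. f y = g y" by auto
    then have "isCont g x" by (simp add: continuous_on_eq_continuous_at)
    moreover have "\<forall>\<^sub>F y in nhds x. g y = f y"
      using U by (auto simp: eventually_nhds)
    ultimately show ?thesis by (metis isCont_cong)
  qed
  then show ?case by (simp add: continuous_at_imp_continuous_on)
next
  case (Suc k)
  show ?case unfolding Ck_on.simps
  proof (intro conjI allI ballI)
    fix x assume "x \<in> S"
    from Suc.prems[OF this] obtain U g where U: "open U" "x \<in> U" "Ck_on (Suc k) UNIV g" "\<forall>y\<in>U. f y = g y" by auto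
    then obtain D where "(g has_derivative D) (at x)" unfolding Ck_on.simps differentiable_def by blast
    then have "(f has_derivative D) (at x)"
      using has_derivative_local[OF U(1,2), of f g D] U(4) by blast
    then show "f differentiable at x" by (auto simp: differentiable_def)
  next
    fix i
    show "Ck_on k S (partial i f)"
    proof (rule Suc.IH)
      fix x assume "x \<in> S"
      from Suc.prems[OF this] obtain U g where U: "open U" "x \<in> U" "Ck_on (Suc k) UNIV g" "\<forall>y\<in>U. f y = g y" by auto
      have "\<forall>y\<in>U. partial i f y = partial i g y"
        using partial_cong_open[OF U(1), of _ f g i] U(4) by blast
      then show "\<exists>U g. open U \<and> x \<in> U \<and> Ck_on k UNIV g \<and> (\<forall>y\<in>U. partial i f y = g y)"
        using U by (intro exI[of _ U] exI[of _ "partial i g"]) auto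
    qed
  qed
qed

lemma partial_const [simp]: "partial i (\<lambda>x. c) = (\<lambda>x. 0)"
  by (rule ext) (simp add: partial_def)

lemma Ck_on_const [simp]: "Ck_on k S (\<lambda>x. c)"
  by (induction k arbitrary: c) auto

text \<open>Evaluating the derivative at the unit vectors identifies the given components with the
  partial derivatives. Meant for functions whose gradient is known in closed form, such as
  coordinates, convolutions and reflections.\<close>

lemma Ck_on_if_partials:
  assumes "\<And>x. (f has_derivative (\<lambda>v. \<Sum>i\<in>UNIV. v $ i * F i x)) (at x)"
    and "\<And>i. Ck_on k UNIV (F i)"
  shows "Ck_on (Suc k) UNIV f" "partial i f = F i"
proof -
  show p: "partial i f = F i" for i
  proof
    fix x
    have "partial i f x = (\<Sum>j\<in>UNIV. axis i 1 $ j * F j x)"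
      using partial_eq[OF assms(1)] by simp
    also have "\<dots> = (\<Sum>j\<in>UNIV. if j = i then F j x else 0)"
      by (rule sum.cong) (auto simp: axis_def)
    finally show "partial i f x = F i x" by simp
  qed
  show "Ck_on (Suc k) UNIV f"
    using assms by (auto simp: p differentiable_def)
qed

lemma partial_add:
  assumes "f differentiable (at x)" "g differentiable (at x)"
  shows "partial i (\<lambda>x. f x + g x) x = partial i f x + partial i g x"
proof -
  obtain F G where "(f has_derivative F) (at x)" "(g has_derivative G) (at x)"
    using assms by (auto simp: differentiable_def)
  then show ?thesis
    using partial_eq[OF has_derivative_add[of f F "at x" g G]] by (simp add: partial_eq)
qed

lemma partial_mult:
  assumes "f differentiable (at x)" "g differentiable (at x)"
  shows "partial i (\<lambda>x. f x * g x) x = f x * partial i g x + partial i f x * g x"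
proof -
  obtain F G where "(f has_derivative F) (at x)" "(g has_derivative G) (at x)"
    using assms by (auto simp: differentiable_def)
  then show ?thesis
    using partial_eq[OF has_derivative_mult[of f F x UNIV g G]] by (simp add: partial_eq)
qed

lemma Ck_on_add:
  assumes "Ck_on k UNIV f" "Ck_on k UNIV g"
  shows "Ck_on k UNIV (\<lambda>x. f x + g x)"
  using assms
proof (induction k arbitrary: f g)
  case (Suc k)
  have "partial i (\<lambda>x. f x + g x) = (\<lambda>x. partial i f x + partial i g x)" for i
    using Suc.prems by (intro ext partial_add) auto
  then show ?case using Suc by (auto intro: differentiable_add)
qed (auto intro: continuous_intros)

lemma Ck_on_mult:
  assumes "Ck_on k UNIV f" "Ck_on k UNIV g"
  shows "Ck_on k UNIV (\<lambda>x. f x * g x)"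
  using assms
proof (induction k arbitrary: f g)
  case (Suc k)
  have "partial i (\<lambda>x. f x * g x) = (\<lambda>x. f x * partial i g x + partial i f x * g x)" for i
    using Suc.prems by (intro ext partial_mult) auto
  moreover have "Ck_on k UNIV (\<lambda>x. f x * partial i g x + partial i f x * g x)" for i
    using Suc.prems Ck_on_SucD[OF Suc.prems(1)] Ck_on_SucD[OF Suc.prems(2)]
    by (intro Ck_on_add Suc.IH) auto
  ultimately show ?case using Suc.prems by (auto intro: differentiable_mult)
qed (auto intro: continuous_intros)

lemma smooth_add: "smooth f \<Longrightarrow> smooth g \<Longrightarrow> smooth (\<lambda>x. f x + g x)"
  using Ck_on_add by blast

lemma smooth_mult: "smooth f \<Longrightarrow> smooth g \<Longrightarrow> smooth (\<lambda>x. f x * g x)"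
  using Ck_on_mult by blast

lemma smooth_cmult: "smooth f \<Longrightarrow> smooth (\<lambda>x. c * f x)"
  using smooth_mult[of "\<lambda>x. c" f] by simp

lemma smooth_diff: "smooth f \<Longrightarrow> smooth g \<Longrightarrow> smooth (\<lambda>x. f x - g x)"
  using smooth_add[of f "\<lambda>x. -1 * g x"] smooth_cmult[of g "-1"] by simp

lemma smooth_sum: "(\<And>i. i \<in> A \<Longrightarrow> smooth (f i)) \<Longrightarrow> smooth (\<lambda>x. \<Sum>i\<in>A. f i x)"
proof (induction A rule: infinite_finite_induct)
  case (insert a F)
  then show ?case using smooth_add[of "f a" "\<lambda>x. \<Sum>i\<in>F. f i x"] by auto
qed auto

lemma partial_cmult: "smooth f \<Longrightarrow> partial i (\<lambda>x. c * f x) = (\<lambda>x. c * partial i f x)"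
  using partial_mult[of "\<lambda>x. c" _ f i] by (auto simp: smooth_differentiable)

lemma partial_diff: "smooth f \<Longrightarrow> smooth g \<Longrightarrow> partial i (\<lambda>x. f x - g x) = (\<lambda>x. partial i f x - partial i g x)"
  using partial_add[of f _ "\<lambda>x. -1 * g x" i] partial_cmult[of g i "-1"] smooth_cmult[of g "-1"]
  by (auto simp: smooth_differentiable)

lemma partial_coord: "partial i (\<lambda>x::real^'n::finite. x $ j) = (\<lambda>x. if i = j then 1 else 0)"
proof
  fix x :: "real^'n"
  have "((\<lambda>x. x $ j) has_derivative (\<lambda>v. v $ j)) (at x)"
    by (rule bounded_linear_imp_has_derivative[OF bounded_linear_vec_nth])
  from partial_eq[OF this] show "partial i (\<lambda>x. x $ j) x = (if i = j then 1 else 0)"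
    by (auto simp: axis_def)
qed

lemma smooth_coord: "smooth (\<lambda>x::real^'n::finite. x $ j)"
proof
  fix k
  have "((\<lambda>x. x $ j) has_derivative (\<lambda>v. \<Sum>i\<in>UNIV. v $ i * (if i = j then 1 else 0))) (at x)" for x :: "real^'n"
    using bounded_linear_imp_has_derivative[OF bounded_linear_vec_nth[of j], of "at x"]
    by (simp add: if_distrib cong: if_cong)
  then have "Ck_on (Suc k) UNIV (\<lambda>x::real^'n. x $ j)"
    by (rule Ck_on_if_partials) auto
  then show "Ck_on k UNIV (\<lambda>x::real^'n. x $ j)" by (rule Ck_on_SucD)
qed

lemma has_derivative_compose_real:
  assumes "(g has_real_derivative d) (at (f x))" "(f has_derivative D) (at x)"
  shows "((\<lambda>x. g (f x)) has_derivative (\<lambda>v. d * D v)) (at x)"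
  using has_derivative_compose[OF assms(2), of g "(*) d"] assms(1)
  by (simp add: has_field_derivative_def)

lemma partial_compose:
  assumes "(g has_real_derivative d) (at (f x))" "f differentiable (at x)"
  shows "partial i (\<lambda>x. g (f x)) x = d * partial i f x"
proof -
  obtain F where F: "(f has_derivative F) (at x)"
    using assms by (auto simp: differentiable_def)
  show ?thesis
    using partial_eq[OF has_derivative_compose_real[of g d f x F]] assms(1) F by (simp add: partial_eq)
qed

text \<open>\<open>G\<close> lists all derivatives of the outer function, so that the induction on
  the order closes: a partial derivative of \<open>G j (f x)\<close> is
  \<open>G (Suc j) (f x)\<close> times one of \<open>f\<close>.\<close>

lemma smooth_compose:
  fixes G :: "nat \<Rightarrow> real \<Rightarrow> real"
  assumes G: "\<And>j t. (G j has_real_derivative G (Suc j) t) (at t)" and f: "smooth f"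
  shows "smooth (\<lambda>x. G j (f x))"
proof
  fix k
  show "Ck_on k UNIV (\<lambda>x. G j (f x))"
  proof (induction k arbitrary: j)
    case 0
    have "continuous_on UNIV (G j)"
      using G by (auto intro!: DERIV_isCont continuous_at_imp_continuous_on)
    then show ?case
      using continuous_on_compose2[of UNIV "G j" UNIV f] smooth_continuous[OF f] by auto
  next
    case (Suc k)
    have p: "partial i (\<lambda>x. G j (f x)) = (\<lambda>x. G (Suc j) (f x) * partial i f x)" for i
      using partial_compose[OF G smooth_differentiable[OF f]] by auto
    have "(\<lambda>x. G j (f x)) differentiable at x" for x
      using has_derivative_compose_real[OF G] smooth_differentiable[OF f] by (fastforce simp: differentiable_def)
    then show ?case
      using Suc f Ck_on_mult[of k "\<lambda>x. G (Suc j) (f x)"] by (auto simp: p smooth_partial)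
  qed
qed

text \<open>Schwarz's theorem: both mixed derivatives are limits of the same second difference quotient,
  by applying the mean value theorem twice in either order.\<close>

lemma has_real_derivative_line:
  assumes "f differentiable (at (x + t *\<^sub>R axis i 1))"
  shows "((\<lambda>t. f (x + t *\<^sub>R axis i 1)) has_real_derivative partial i f (x + t *\<^sub>R axis i 1)) (at t)"
proof -
  let ?y = "x + t *\<^sub>R axis i 1"
  let ?D = "frechet_derivative f (at ?y)"
  have D: "(f has_derivative ?D) (at ?y)" using assms frechet_derivative_works by blast
  have "((\<lambda>t. x + t *\<^sub>R axis i 1) has_derivative (\<lambda>s. s *\<^sub>R axis i 1)) (at t)"
    by (auto intro!: derivative_eq_intros)
  from has_derivative_compose[OF this D]
  show ?thesis
    using linear_scale[OF has_derivative_linear[OF D]]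
    by (auto simp: has_field_derivative_def partial_def mult.commute[of _ "?D _"] fun_eq_iff
        elim!: has_derivative_eq_rhs)
qed

lemma second_difference_mvt:
  fixes f :: "'n::finite fn"
  assumes f: "smooth f" and t: "0 < t"
  obtains y where "norm (y - x) \<le> 2 * t"
    "f (x + t *\<^sub>R axis i 1 + t *\<^sub>R axis j 1) - f (x + t *\<^sub>R axis i 1) - f (x + t *\<^sub>R axis j 1) + f x
       = t * t * partial j (partial i f) y"
proof -
  let ?i = "axis i 1 :: real^'n" and ?j = "axis j 1 :: real^'n"
  define g where "g s = f (x + t *\<^sub>R ?j + s *\<^sub>R ?i) - f (x + s *\<^sub>R ?i)" for s
  have dg: "(g has_real_derivative partial i f (x + t *\<^sub>R ?j + s *\<^sub>R ?i) - partial i f (x + s *\<^sub>R ?i)) (at s)" for s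
    unfolding g_def[abs_def] using f by (intro DERIV_diff has_real_derivative_line smooth_differentiable)
  obtain s where s: "0 < s" "s < t"
    "g t - g 0 = (t - 0) * (partial i f (x + t *\<^sub>R ?j + s *\<^sub>R ?i) - partial i f (x + s *\<^sub>R ?i))"
    using MVT2[OF t dg] by blast
  let ?x = "x + s *\<^sub>R ?i"
  have dp: "((\<lambda>r. partial i f (?x + r *\<^sub>R ?j)) has_real_derivative partial j (partial i f) (?x + r *\<^sub>R ?j)) (at r)" for r
    using f by (intro has_real_derivative_line smooth_differentiable smooth_partial)
  then obtain r where r: "0 < r" "r < t"
    "partial i f (?x + t *\<^sub>R ?j) - partial i f (?x + 0 *\<^sub>R ?j) = (t - 0) * partial j (partial i f) (?x + r *\<^sub>R ?j)"
    using MVT2[OF t dp] by blast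
  have "norm (?x + r *\<^sub>R ?j - x) \<le> norm (s *\<^sub>R ?i) + norm (r *\<^sub>R ?j)"
    using norm_triangle_ineq[of "s *\<^sub>R ?i" "r *\<^sub>R ?j"] by simp
  also have "\<dots> \<le> 2 * t" using s r by (simp add: norm_axis_1)
  finally show ?thesis
    using s(3) r(3) by (intro that) (auto simp: g_def algebra_simps)
qed

lemma partial_commute:
  fixes f :: "'n::finite fn"
  assumes f: "smooth f"
  shows "partial i (partial j f) = partial j (partial i f)"
proof
  fix x
  have *: "\<exists>y. norm (y - x) \<le> 2 * t \<and>
      f (x + t *\<^sub>R axis i 1 + t *\<^sub>R axis j 1) - f (x + t *\<^sub>R axis i 1) - f (x + t *\<^sub>R axis j 1) + f x
       = t * t * partial j (partial i f) y" if "0 < t" for t i j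
    using second_difference_mvt[OF f that] by metis
  define t :: "nat \<Rightarrow> real" where "t n = 1 / real (Suc n)" for n
  have t: "0 < t n" for n by (simp add: t_def)
  have t0: "t \<longlonglongrightarrow> 0" unfolding t_def using LIMSEQ_Suc[OF lim_const_over_n[of 1]] by simp
  obtain y where y: "\<And>n. norm (y n - x) \<le> 2 * t n"
    "\<And>n. f (x + t n *\<^sub>R axis i 1 + t n *\<^sub>R axis j 1) - f (x + t n *\<^sub>R axis i 1) - f (x + t n *\<^sub>R axis j 1) + f x
       = t n * t n * partial j (partial i f) (y n)"
    using *[where i=i and j=j, OF t] by metis
  obtain z where z: "\<And>n. norm (z n - x) \<le> 2 * t n"
    "\<And>n. f (x + t n *\<^sub>R axis j 1 + t n *\<^sub>R axis i 1) - f (x + t n *\<^sub>R axis j 1) - f (x + t n *\<^sub>R axis i 1) + f x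
       = t n * t n * partial i (partial j f) (z n)"
    using *[where i=j and j=i, OF t] by metis
  have lim: "(\<lambda>n. F (w n)) \<longlonglongrightarrow> F x" if "smooth F" "\<And>n. norm (w n - x) \<le> 2 * t n" for F :: "'n fn" and w
  proof -
    have "(\<lambda>n. w n - x) \<longlonglongrightarrow> 0"
      by (rule Lim_null_comparison[where g="\<lambda>n. 2 * t n"]) (use that(2) t0 in \<open>auto intro!: tendsto_eq_intros\<close>)
    then have "w \<longlonglongrightarrow> x" by (simp add: LIM_zero_cancel)
    moreover have "isCont F x" using smooth_continuous[OF that(1), of UNIV] by (simp add: continuous_on_eq_continuous_at)
    ultimately show ?thesis by (rule isCont_tendsto_compose[rotated])
  qed
  have eq: "partial j (partial i f) (y n) = partial i (partial j f) (z n)" for n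
  proof -
    have "t n * t n * partial j (partial i f) (y n) = t n * t n * partial i (partial j f) (z n)"
      using y(2)[of n] z(2)[of n] by (simp add: algebra_simps)
    then show ?thesis using t[of n] by simp
  qed
  have "(\<lambda>n. partial j (partial i f) (y n)) \<longlonglongrightarrow> partial j (partial i f) x"
    using lim[OF _ y(1)] smooth_partial f by blast
  moreover have "(\<lambda>n. partial j (partial i f) (y n)) \<longlonglongrightarrow> partial i (partial j f) x"
    unfolding eq using lim[OF _ z(1)] smooth_partial f by blast
  ultimately show "partial i (partial j f) x = partial j (partial i f) x"
    using LIMSEQ_unique by blast
qed

section \<open>Bump functions\<close>

text \<open>Products of a polynomial in \<open>1/t\<close> with \<open>exp (- (1/t))\<close>,
  extended by zero, form a class closed under differentiation; all derivatives of the flat function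
  \<open>exp (- (1/t))\<close> lie in it.\<close>

definition bump_poly :: "real poly \<Rightarrow> real \<Rightarrow> real" where
  "bump_poly p t = (if t > 0 then poly p (1/t) * exp (- (1/t)) else 0)"

lemma tendsto_poly_exp_0: "((\<lambda>s::real. poly q s * exp (- s)) \<longlongrightarrow> 0) at_top"
proof -
  have "((\<lambda>s. \<Sum>i\<le>degree q. coeff q i * (s ^ i / exp s)) \<longlongrightarrow> (\<Sum>i\<le>degree q. coeff q i * 0)) at_top"
    by (intro tendsto_sum tendsto_mult tendsto_const tendsto_power_div_exp_0)
  moreover have "poly q s * exp (- s) = (\<Sum>i\<le>degree q. coeff q i * (s ^ i / exp s))" for s
    by (simp add: poly_altdef exp_minus sum_distrib_right divide_inverse mult.assoc)
  ultimately show ?thesis by simp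
qed

text \<open>Put \<open>s = 1/t\<close>. As the derivative of \<open>s\<close> is
  \<open>- s\<^sup>2\<close>, that of \<open>poly p s * exp (- s)\<close> is
  \<open>s\<^sup>2 * (poly p s - poly (pderiv p) s) * exp (- s)\<close>, whence the new polynomial.
  At 0 the right difference quotient is \<open>s * poly p s * exp (- s)\<close> with
  \<open>s\<close> tending to infinity, and the left one is 0.\<close>

lemma bump_poly_deriv:
  "(bump_poly p has_real_derivative bump_poly ([:0, 0, 1:] * (p - pderiv p)) t) (at t)"
proof -
  consider "t > 0" | "t < 0" | "t = 0" by linarith
  then show ?thesis
  proof cases
    case 1
    have "((\<lambda>t. poly p (1/t) * exp (- (1/t))) has_real_derivative
        bump_poly ([:0, 0, 1:] * (p - pderiv p)) t) (at t)"
      using 1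
      by (auto intro!: derivative_eq_intros DERIV_chain2[OF poly_DERIV]
          simp: bump_poly_def field_simps power2_eq_square)
    then show ?thesis
      by (rule has_field_derivative_transform_within_open[where S="{0<..}"]) (use 1 in \<open>auto simp: bump_poly_def\<close>)
  next
    case 2
    have "((\<lambda>t. 0) has_real_derivative bump_poly ([:0, 0, 1:] * (p - pderiv p)) t) (at t)"
      using 2 by (auto simp: bump_poly_def)
    then show ?thesis
      by (rule has_field_derivative_transform_within_open[where S="{..<0}"]) (use 2 in \<open>auto simp: bump_poly_def\<close>)
  next
    case 3
    have "((\<lambda>h. poly ([:0, 1:] * p) (inverse h) * exp (- inverse h)) \<longlongrightarrow> 0) (at_right 0)"
      using filterlim_compose[OF tendsto_poly_exp_0 filterlim_inverse_at_top_right] .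
    then have R: "((\<lambda>h. bump_poly p h / h) \<longlongrightarrow> 0) (at_right 0)"
      by (rule Lim_transform_eventually)
         (auto simp: eventually_at_filter bump_poly_def field_simps)
    have L: "((\<lambda>h. bump_poly p h / h) \<longlongrightarrow> 0) (at_left 0)"
      by (rule Lim_transform_eventually[OF tendsto_const])
         (auto simp: eventually_at_filter bump_poly_def)
    have "((\<lambda>h. bump_poly p h / h) \<longlongrightarrow> 0) (at 0)"
      using L R by (simp add: filterlim_split_at)
    then show ?thesis using 3 by (simp add: DERIV_def bump_poly_def)
  qed
qed

primrec bump_seq :: "nat \<Rightarrow> real poly" where
  "bump_seq 0 = 1"
| "bump_seq (Suc j) = [:0, 0, 1:] * (bump_seq j - pderiv (bump_seq j))"

text \<open>The j-th derivative of \<open>exp (-1/t)\<close>, extended by 0 to \<open>t \<le> 0\<close>.\<close>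

definition bump :: "nat \<Rightarrow> real \<Rightarrow> real" where
  "bump j = bump_poly (bump_seq j)"

lemma bump_deriv: "(bump j has_real_derivative bump (Suc j) t) (at t)"
  using bump_poly_deriv[of "bump_seq j" t] by (simp add: bump_def)

lemma bump_nonpos [simp]: "t \<le> 0 \<Longrightarrow> bump j t = 0"
  by (simp add: bump_def bump_poly_def)

lemma bump_0: "t > 0 \<Longrightarrow> bump 0 t = exp (- (1/t))"
  by (simp add: bump_def bump_poly_def)

lemma bump_1: "t > 0 \<Longrightarrow> bump (Suc 0) t = exp (- (1/t)) / t\<^sup>2"
  by (simp add: bump_def bump_poly_def power2_eq_square)

lemma bump_0_pos_iff: "bump 0 t > 0 \<longleftrightarrow> t > 0"
  by (cases "t > 0") (auto simp: bump_0)

lemma bump_0_nonneg: "bump 0 t \<ge> 0"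
  by (cases "t > 0") (auto simp: bump_0)

text \<open>\<open>bump 0\<close> is increasing. The mollifiers are built from its derivative and
  take their sign from here.\<close>

lemma bump_1_nonneg: "bump (Suc 0) t \<ge> 0"
  by (cases "t > 0") (auto simp: bump_1)

lemma isCont_bump: "isCont (bump j) t"
  using bump_deriv by (rule DERIV_isCont)

text \<open>Arguments of the form \<open>1 - r\<^sup>2 * (norm (z - c))\<^sup>2\<close> never exceed
  1; negative ones give 0, and the remaining interval is compact.\<close>

lemma bump_bounded: "\<exists>M\<ge>0. \<forall>t\<le>1. \<bar>bump j t\<bar> \<le> M"
proof -
  have "compact (bump j ` {0..1})"
    by (intro compact_continuous_image) (auto intro: continuous_at_imp_continuous_on isCont_bump)
  then obtain M where M: "\<And>t. t \<in> {0..1} \<Longrightarrow> \<bar>bump j t\<bar> \<le> M"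
    using compact_imp_bounded bounded_iff by (metis imageI real_norm_def)
  have "\<bar>bump j t\<bar> \<le> max M 0" if "t \<le> 1" for t
    using M[of t] that by (cases "t \<ge> 0") auto
  then show ?thesis by (intro exI[of _ "max M 0"]) auto
qed

lemma norm2_vec: "(norm (x::real^'n))\<^sup>2 = (\<Sum>i\<in>UNIV. (x $ i)\<^sup>2)"
  unfolding power2_norm_eq_inner inner_vec_def by (simp add: power2_eq_square)

lemma smooth_norm2: "smooth (\<lambda>x::real^'n::finite. (norm (x - c))\<^sup>2)"
proof -
  have "smooth (\<lambda>x::real^'n. \<Sum>i\<in>UNIV. (x $ i - c $ i) * (x $ i - c $ i))"
    by (intro smooth_sum smooth_mult smooth_diff smooth_coord) auto
  then show ?thesis unfolding norm2_vec by (simp add: power2_eq_square)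
qed

lemma partial_norm2: "partial i (\<lambda>x::real^'n::finite. (norm (x - c))\<^sup>2) = (\<lambda>x. 2 * (x $ i - c $ i))"
proof
  fix x :: "real^'n"
  have "((\<lambda>x. (norm (x - c))\<^sup>2) has_derivative (\<lambda>v. 2 * ((x - c) \<bullet> v))) (at x)"
    unfolding power2_norm_eq_inner
    by (auto intro!: derivative_eq_intros simp: inner_commute)
  from partial_eq[OF this]
  show "partial i (\<lambda>x. (norm (x - c))\<^sup>2) x = 2 * (x $ i - c $ i)"
    by (simp add: inner_axis)
qed

lemma smooth_bump: "smooth f \<Longrightarrow> smooth (\<lambda>x. bump j (f x))"
  using smooth_compose[of bump f j] bump_deriv by blast

lemma smooth_exp: "smooth f \<Longrightarrow> smooth (\<lambda>x. exp (f x))"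
  using smooth_compose[of "\<lambda>_. exp" f 0] by (simp add: DERIV_exp)

section \<open>Test functions\<close>

lemma test_functions_smooth: "\<phi> \<in> test_functions S \<Longrightarrow> smooth \<phi>"
  by (simp add: test_functions_def)

lemma test_functionsI:
  assumes "smooth \<phi>" "compact K" "K \<subseteq> S" "\<And>x. x \<notin> K \<Longrightarrow> \<phi> x = 0"
  shows "\<phi> \<in> test_functions S"
proof -
  have sub: "closure {x. \<phi> x \<noteq> 0} \<subseteq> K"
    using assms by (intro closure_minimal compact_imp_closed) auto
  then have "compact (closure {x. \<phi> x \<noteq> 0})"
    using compact_Int_closed[OF assms(2), of "closure {x. \<phi> x \<noteq> 0}"] by (simp add: inf.absorb2)
  then show ?thesis using sub assms by (auto simp: test_functions_def compactly_inside_def)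
qed

lemma test_functionsE:
  assumes "\<phi> \<in> test_functions S"
  obtains K where "compact K" "K \<subseteq> S" "\<forall>x. x \<notin> K \<longrightarrow> \<phi> x = 0"
proof (rule that[of "closure {x. \<phi> x \<noteq> 0}"])
  show "\<forall>x. x \<notin> closure {x. \<phi> x \<noteq> 0} \<longrightarrow> \<phi> x = 0"
    using closure_subset[of "{x. \<phi> x \<noteq> 0}"] by blast
qed (use assms in \<open>auto simp: test_functions_def compactly_inside_def\<close>)

lemma test_functions_mono: "\<phi> \<in> test_functions S \<Longrightarrow> S \<subseteq> T \<Longrightarrow> \<phi> \<in> test_functions T"
  by (auto simp: test_functions_def compactly_inside_def)

lemma test_functions_zero: "(\<lambda>x. 0) \<in> test_functions S"
  by (rule test_functionsI[of _ "{}"]) auto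

lemma test_functions_add:
  assumes "\<phi> \<in> test_functions S" "\<psi> \<in> test_functions S"
  shows "(\<lambda>x. \<phi> x + \<psi> x) \<in> test_functions S"
proof -
  obtain K where "compact K" "K \<subseteq> S" "\<forall>x. x \<notin> K \<longrightarrow> \<phi> x = 0" using test_functionsE[OF assms(1)] by blast
  moreover obtain L where "compact L" "L \<subseteq> S" "\<forall>x. x \<notin> L \<longrightarrow> \<psi> x = 0" using test_functionsE[OF assms(2)] by blast
  ultimately show ?thesis
    using smooth_add[OF test_functions_smooth[OF assms(1)] test_functions_smooth[OF assms(2)]]
    by (intro test_functionsI[of _ "K \<union> L"]) auto
qed

lemma test_functions_mult:
  assumes "\<phi> \<in> test_functions S" "smooth \<psi>"
  shows "(\<lambda>x. \<psi> x * \<phi> x) \<in> test_functions S"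
proof -
  obtain K where "compact K" "K \<subseteq> S" "\<forall>x. x \<notin> K \<longrightarrow> \<phi> x = 0" using test_functionsE[OF assms(1)] by blast
  then show ?thesis
    using smooth_mult[OF assms(2) test_functions_smooth[OF assms(1)]] by (intro test_functionsI[of _ K]) auto
qed

lemma test_functions_cmult: "\<phi> \<in> test_functions S \<Longrightarrow> (\<lambda>x. c * \<phi> x) \<in> test_functions S"
  using test_functions_mult[of \<phi> S "\<lambda>x. c"] by simp

lemma partial_eq_0_outside:
  assumes "closed K" "\<And>x. x \<notin> K \<Longrightarrow> \<phi> x = 0" "x \<notin> K"
  shows "partial i \<phi> x = 0"
  using partial_cong_open[of "- K" x \<phi> "\<lambda>x. 0" i] assms by (simp add: open_Compl)

lemma test_functions_partial:
  assumes "\<phi> \<in> test_functions S"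
  shows "partial i \<phi> \<in> test_functions S"
proof -
  obtain K where K: "compact K" "K \<subseteq> S" "\<forall>x. x \<notin> K \<longrightarrow> \<phi> x = 0" using test_functionsE[OF assms] by blast
  show ?thesis
    using partial_eq_0_outside[OF compact_imp_closed[OF K(1)] K(3)[rule_format]]
      smooth_partial[OF test_functions_smooth[OF assms]]
    by (intro test_functionsI[OF _ K(1,2)]) auto
qed

lemma test_functions_bounded:
  assumes "\<phi> \<in> test_functions S"
  obtains M where "M \<ge> 0" "\<And>x. \<bar>\<phi> x\<bar> \<le> M"
proof -
  obtain K where K: "compact K" "K \<subseteq> S" "\<forall>x. x \<notin> K \<longrightarrow> \<phi> x = 0" using test_functionsE[OF assms] by blast
  have "compact (\<phi> ` K)"
    using K by (intro compact_continuous_image smooth_continuous test_functions_smooth[OF assms])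
  then obtain M where M: "\<And>x. x \<in> K \<Longrightarrow> \<bar>\<phi> x\<bar> \<le> M"
    using compact_imp_bounded bounded_iff by (metis imageI real_norm_def)
  show ?thesis
  proof
    show "\<bar>\<phi> x\<bar> \<le> max M 0" for x using M[of x] K(3)[rule_format, of x] by (cases "x \<in> K") auto
  qed simp
qed

lemma test_functions_lipschitz:
  fixes \<phi> :: "'n::finite fn"
  assumes "\<phi> \<in> test_functions S"
  obtains M where "M \<ge> 0" "\<And>x y. \<bar>\<phi> x - \<phi> y\<bar> \<le> M * norm (x - y)"
proof -
  have "\<exists>M\<ge>0. \<forall>x. \<bar>partial i \<phi> x\<bar> \<le> M" for i
    using test_functions_bounded[OF test_functions_partial[OF assms]] by metis
  then obtain M where M: "\<And>i. M i \<ge> 0" "\<And>i x. \<bar>partial i \<phi> x\<bar> \<le> M i" by metis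
  have "norm (\<phi> x - \<phi> y) \<le> (\<Sum>i\<in>UNIV. M i) * norm (x - y)" for x y
  proof (rule differentiable_bound[of UNIV])
    show "(\<phi> has_derivative (\<lambda>v. \<Sum>i\<in>UNIV. v $ i * partial i \<phi> z)) (at z within UNIV)" for z
      using has_derivative_partial smooth_differentiable test_functions_smooth[OF assms] by blast
    show "onorm (\<lambda>v. \<Sum>i\<in>UNIV. v $ i * partial i \<phi> z) \<le> (\<Sum>i\<in>UNIV. M i)" for z
    proof (rule onorm_bound)
      show "0 \<le> (\<Sum>i\<in>UNIV. M i)" using M(1) by (simp add: sum_nonneg)
      fix v :: "real^'n"
      have "norm (\<Sum>i\<in>UNIV. v $ i * partial i \<phi> z) \<le> (\<Sum>i\<in>UNIV. norm (v $ i * partial i \<phi> z))"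
        by (rule norm_sum)
      also have "\<dots> \<le> (\<Sum>i\<in>UNIV. M i * norm v)"
      proof (rule sum_mono)
        fix i
        have "\<bar>partial i \<phi> z\<bar> * \<bar>v $ i\<bar> \<le> M i * norm v"
          using M component_le_norm_cart[of v i] by (intro mult_mono) auto
        then show "norm (v $ i * partial i \<phi> z) \<le> M i * norm v" by (simp add: abs_mult mult.commute)
      qed
      finally show "norm (\<Sum>i\<in>UNIV. v $ i * partial i \<phi> z) \<le> (\<Sum>i\<in>UNIV. M i) * norm v"
        by (simp add: sum_distrib_right)
    qed
  qed auto
  then show ?thesis using M(1) by (intro that[of "\<Sum>i\<in>UNIV. M i"]) (auto simp: sum_nonneg)
qed

text \<open>Compact support makes the gradient Lipschitz, so the remainder is quadratic uniformly in
  the base point. This uniformity allows the expansion to be integrated in the base point.\<close>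

lemma test_functions_taylor:
  fixes \<phi> :: "'n::finite fn"
  assumes "\<phi> \<in> test_functions S"
  obtains M where "M \<ge> 0" "\<And>x v. \<bar>\<phi> (x + v) - \<phi> x - (\<Sum>i\<in>UNIV. v $ i * partial i \<phi> x)\<bar> \<le> M * (norm v)\<^sup>2"
proof -
  have "\<exists>M\<ge>0. \<forall>x y. \<bar>partial i \<phi> x - partial i \<phi> y\<bar> \<le> M * norm (x - y)" for i
    using test_functions_lipschitz[OF test_functions_partial[OF assms]] by metis
  then obtain M where M: "\<And>i. M i \<ge> 0" "\<And>i x y. \<bar>partial i \<phi> x - partial i \<phi> y\<bar> \<le> M i * norm (x - y)"
    by metis
  let ?D = "\<lambda>z v. \<Sum>i\<in>UNIV. v $ i * partial i \<phi> z"
  have "norm (\<phi> (x + v) - \<phi> x - ?D x v) \<le> (\<Sum>i\<in>UNIV. M i) * (norm v)\<^sup>2" for x v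
  proof -
    have "norm (\<phi> (x + v) - \<phi> x - ?D x (x + v - x)) \<le> norm (x + v - x) * ((\<Sum>i\<in>UNIV. M i) * norm v)"
    proof (rule differentiable_bound_linearization[where S="cball x (norm v)" and f'="?D"])
      show "(\<phi> has_derivative ?D z) (at z within cball x (norm v))" for z
        using has_derivative_partial smooth_differentiable test_functions_smooth[OF assms] has_derivative_at_withinI by blast
      show "x + t *\<^sub>R (x + v - x) \<in> cball x (norm v)" if "t \<in> {0..1}" for t
        using that by (auto simp: dist_norm mult_left_le_one_le)
      show "onorm (?D z - ?D x) \<le> (\<Sum>i\<in>UNIV. M i) * norm v" if z: "z \<in> cball x (norm v)" for z
        unfolding fun_diff_def
      proof (rule onorm_bound)
        show "0 \<le> (\<Sum>i\<in>UNIV. M i) * norm v" using M(1) by (simp add: sum_nonneg)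
        fix w :: "real^'n"
        have "norm (?D z w - ?D x w) = norm (\<Sum>i\<in>UNIV. w $ i * (partial i \<phi> z - partial i \<phi> x))"
          by (simp add: sum_subtractf algebra_simps)
        also have "\<dots> \<le> (\<Sum>i\<in>UNIV. norm (w $ i * (partial i \<phi> z - partial i \<phi> x)))"
          by (rule norm_sum)
        also have "\<dots> \<le> (\<Sum>i\<in>UNIV. norm w * (M i * norm v))"
        proof (rule sum_mono)
          fix i
          have "\<bar>partial i \<phi> z - partial i \<phi> x\<bar> \<le> M i * norm (z - x)" using M(2) .
          also have "\<dots> \<le> M i * norm v"
            using z M(1) by (intro mult_left_mono) (auto simp: dist_norm norm_minus_commute)
          finally show "norm (w $ i * (partial i \<phi> z - partial i \<phi> x)) \<le> norm w * (M i * norm v)"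
            using component_le_norm_cart[of w i] unfolding real_norm_def abs_mult by (intro mult_mono) auto
        qed
        finally show "norm (?D z w - ?D x w) \<le> (\<Sum>i\<in>UNIV. M i) * norm v * norm w"
          by (simp add: sum_distrib_right sum_distrib_left mult_ac)
      qed
    qed auto
    then show ?thesis by (simp add: power2_eq_square mult_ac)
  qed
  then show ?thesis using M(1) by (intro that[of "\<Sum>i\<in>UNIV. M i"]) (auto simp: sum_nonneg)
qed

text \<open>The m-th function is \<open>1 - exp (- m s)\<close>, where s is a sum of bumps on the first m balls of a
  countable cover of U.\<close>

lemma indicator_open_limit:
  fixes U :: "(real^'n::finite) set"
  assumes "open U"
  obtains \<phi> where "\<And>m. \<phi> m \<in> test_functions U" "\<And>m x. 0 \<le> \<phi> m x \<and> \<phi> m x \<le> 1"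
    "\<And>x. (\<lambda>m::nat. \<phi> m x) \<longlonglongrightarrow> indicator U x"
proof (cases "U = {}")
  case True
  show ?thesis by (rule that[of "\<lambda>_ _. 0"]) (auto simp: True test_functions_zero)
next
  case False
  define \<B> where "\<B> = {ball c r |c r. cball c r \<subseteq> U \<and> r > 0}"
  have "\<Union>\<B> = U"
  proof
    show "U \<subseteq> \<Union>\<B>"
    proof
      fix x assume "x \<in> U"
      then obtain r where "r > 0" "cball x r \<subseteq> U" using assms open_contains_cball by blast
      then show "x \<in> \<Union>\<B>" by (auto simp: \<B>_def intro!: exI[of _ "ball x r"])
    qed
  qed (use ball_subset_cball in \<open>auto simp: \<B>_def\<close>)
  moreover have "\<And>S. S \<in> \<B> \<Longrightarrow> open S" by (auto simp: \<B>_def)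
  ultimately obtain \<C> where \<C>: "\<C> \<subseteq> \<B>" "countable \<C>" "\<Union>\<C> = U" using Lindelof[of \<B>] by metis
  then have "\<C> \<noteq> {}" using False by auto
  then obtain B :: "nat \<Rightarrow> (real^'n) set" where B: "range B = \<C>"
    using range_from_nat_into[of \<C>] \<C>(2) by metis
  then have "\<exists>c r. B k = ball c r \<and> cball c r \<subseteq> U \<and> r > 0" for k
  proof -
    have "B k \<in> \<B>" using B \<C>(1) by blast
    then show ?thesis by (auto simp: \<B>_def)
  qed
  then obtain c and r :: "nat \<Rightarrow> real" where cr: "\<And>k. B k = ball (c k) (r k)" "\<And>k. cball (c k) (r k) \<subseteq> U" "\<And>k. r k > 0" by metis
  define b where "b k x = bump 0 ((r k)\<^sup>2 - (norm (x - c k))\<^sup>2)" for k x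
  define s where "s m x = (\<Sum>k<m. b k x)" for m x
  define \<phi> where "\<phi> m x = 1 - exp (- real m * s m x)" for m x
  have b_pos: "b k x > 0 \<longleftrightarrow> x \<in> B k" for k x
  proof -
    have "(norm (x - c k))\<^sup>2 < (r k)\<^sup>2 \<longleftrightarrow> norm (x - c k) < r k"
      using cr(3)[of k] power2_less_imp_less[of "norm (x - c k)" "r k"]
        power_strict_mono[of "norm (x - c k)" "r k" 2] by auto
    then show ?thesis
      by (simp add: b_def bump_0_pos_iff cr(1) dist_norm norm_minus_commute)
  qed
  have b_nn: "b k x \<ge> 0" for k x by (simp add: b_def bump_0_nonneg)
  have s_nn: "s m x \<ge> 0" for m x by (simp add: s_def sum_nonneg b_nn)
  show ?thesis
  proof
    fix m
    show "\<phi> m \<in> test_functions U"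
    proof (rule test_functionsI[of _ "\<Union>k<m. cball (c k) (r k)"])
      show "smooth (\<phi> m)"
        unfolding \<phi>_def[abs_def] s_def b_def
        by (intro smooth_diff smooth_exp smooth_cmult smooth_sum smooth_bump smooth_norm2) auto
      show "\<phi> m x = 0" if "x \<notin> (\<Union>k<m. cball (c k) (r k))" for x
      proof -
        have "b k x = 0" if "k < m" for k
          using \<open>x \<notin> _\<close> that b_pos[of k x] b_nn[of k x] cr(1)[of k] by force
        then show ?thesis by (simp add: \<phi>_def s_def)
      qed
    qed (use cr in auto)
  next
    show "0 \<le> \<phi> m x \<and> \<phi> m x \<le> 1" for m x using s_nn by (simp add: \<phi>_def)
  next
    fix x
    show "(\<lambda>m. \<phi> m x) \<longlonglongrightarrow> indicator U x"
    proof (cases "x \<in> U")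
      case True
      then obtain k where k: "x \<in> B k" using \<C>(3) B by auto
      \<comment> \<open>The factor \<open>m\<close> in the exponent forces decay as soon as one ball
        containing \<open>x\<close> is among the first \<open>m\<close>.\<close>
      have "eventually (\<lambda>m. norm (exp (- real m * s m x)) \<le> exp (- real m * b k x)) sequentially"
        using eventually_gt_at_top[of k]
      proof eventually_elim
        case (elim m)
        have "b k x \<le> s m x" unfolding s_def using elim b_nn by (intro member_le_sum) auto
        then show ?case by (simp add: mult_left_mono)
      qed
      moreover have "(\<lambda>m. exp (- real m * b k x)) \<longlonglongrightarrow> 0"
      proof -
        have "(\<lambda>m. (exp (- b k x)) ^ m) \<longlonglongrightarrow> 0"
          using b_pos[of k x] k by (intro LIMSEQ_power_zero) auto
        then show ?thesis by (simp add: exp_of_nat_mult[symmetric])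
      qed
      ultimately have "(\<lambda>m. exp (- real m * s m x)) \<longlonglongrightarrow> 0" by (rule Lim_null_comparison)
      then have "(\<lambda>m. 1 - exp (- real m * s m x)) \<longlonglongrightarrow> 1 - 0" by (intro tendsto_intros)
      then show ?thesis using True by (simp add: \<phi>_def)
    next
      case False
      then have "b k x = 0" for k using b_pos[of k x] b_nn[of k x] cr(1)[of k] cr(2)[of k] by force
      then show ?thesis using False by (simp add: \<phi>_def s_def)
    qed
  qed
qed

section \<open>The fundamental lemma of the calculus of variations\<close>

lemma borel_imp_measurable_lebesgue_on: "f \<in> borel_measurable borel \<Longrightarrow> f \<in> borel_measurable (lebesgue_on S)"
  by (simp add: measurable_completion measurable_restrict_space1)

lemma integrable_mult_bounded:
  fixes f g :: "'a \<Rightarrow> real"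
  assumes f: "integrable M f" and g: "g \<in> borel_measurable M" "\<And>x. \<bar>g x\<bar> \<le> C"
  shows "integrable M (\<lambda>x. f x * g x)"
proof (rule Bochner_Integration.integrable_bound)
  show "integrable M (\<lambda>x. C * f x)" using f by simp
  show "(\<lambda>x. f x * g x) \<in> borel_measurable M"
    using borel_measurable_integrable[OF f] g(1) by (rule borel_measurable_times)
  show "AE x in M. norm (f x * g x) \<le> norm (C * f x)"
  proof (rule AE_I2)
    fix x
    have "\<bar>f x\<bar> * \<bar>g x\<bar> \<le> \<bar>f x\<bar> * \<bar>C\<bar>"
      by (rule mult_left_mono[OF order_trans[OF g(2) abs_ge_self] abs_ge_zero])
    then show "norm (f x * g x) \<le> norm (C * f x)" by (simp add: abs_mult mult.commute)
  qed
qed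

lemma test_functions_integrable_mult:
  assumes "integrable (lebesgue_on S) g" "\<phi> \<in> test_functions T"
  shows "integrable (lebesgue_on S) (\<lambda>x. g x * \<phi> x)"
proof -
  obtain M where M: "\<And>x. \<bar>\<phi> x\<bar> \<le> M" using test_functions_bounded[OF assms(2)] by blast
  show ?thesis
    by (rule integrable_mult_bounded[OF assms(1) borel_imp_measurable_lebesgue_on M])
       (rule smooth_borel[OF test_functions_smooth[OF assms(2)]])
qed

text \<open>Approximating indicators by test functions shows that \<open>g\<close> has integral 0
  over every open subset of \<open>S\<close>, hence, by subtraction from \<open>S\<close>, over
  every closed one. The set where \<open>g\<close> is positive is exhausted from inside by closed
  sets up to measure \<open>e\<close>; on these \<open>g\<close> is positive with integral 0, so
  they are null.\<close>

lemma fundamental_lemma_nonpos: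
  fixes S :: "(real^'n::finite) set"
  assumes S: "open S" and g: "integrable (lebesgue_on S) g"
    and 0: "\<And>\<phi>. \<phi> \<in> test_functions S \<Longrightarrow> (LINT x|lebesgue_on S. g x * \<phi> x) = 0"
  shows "AE x in lebesgue_on S. g x \<le> 0"
proof -
  let ?M = "lebesgue_on S"
  have [measurable]: "S \<in> sets lebesgue" using S by auto
  have [measurable]: "g \<in> borel_measurable ?M" using g by auto
  have indm [measurable]: "(\<lambda>x. indicator U x :: real) \<in> borel_measurable ?M" if "U \<in> sets borel" for U
    using that by (intro borel_imp_measurable_lebesgue_on) auto
  have int: "integrable ?M (\<lambda>x. g x * indicator U x)" if "U \<in> sets borel" for U
  proof (rule Bochner_Integration.integrable_bound[OF g])
    show "(\<lambda>x. g x * indicator U x) \<in> borel_measurable ?M" using indm[OF that] by measurable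
  qed (auto simp: indicator_def)
  have op: "(LINT x|?M. g x * indicator U x) = 0" if U: "open U" "U \<subseteq> S" for U
  proof -
    obtain \<phi> where \<phi>: "\<And>m. \<phi> m \<in> test_functions U" "\<And>m x. 0 \<le> \<phi> m x \<and> \<phi> m x \<le> 1"
      "\<And>x. (\<lambda>m::nat. \<phi> m x) \<longlonglongrightarrow> indicator U x"
      using indicator_open_limit[OF U(1)] by metis
    have "(\<lambda>m. LINT x|?M. g x * \<phi> m x) \<longlonglongrightarrow> (LINT x|?M. g x * indicator U x)"
    proof (rule integral_dominated_convergence)
      show "integrable ?M (\<lambda>x. \<bar>g x\<bar>)" using g by simp
      show "(\<lambda>x. g x * indicator U x) \<in> borel_measurable ?M" using int[of U] U by auto
      show "(\<lambda>x. g x * \<phi> m x) \<in> borel_measurable ?M" for m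
        using test_functions_integrable_mult[OF g \<phi>(1)] by auto
      show "AE x in ?M. (\<lambda>m. g x * \<phi> m x) \<longlonglongrightarrow> g x * indicator U x"
        using \<phi>(3) by (intro AE_I2 tendsto_intros)
      show "AE x in ?M. norm (g x * \<phi> m x) \<le> \<bar>g x\<bar>" for m
        using \<phi>(2)[of m] by (intro AE_I2) (auto simp: abs_mult intro: mult_left_le)
    qed
    moreover have "(LINT x|?M. g x * \<phi> m x) = 0" for m
      using 0 test_functions_mono[OF \<phi>(1) U(2)] by blast
    ultimately show ?thesis using LIMSEQ_unique[OF tendsto_const] by fastforce
  qed
  have cl: "(LINT x|?M. g x * indicator T x) = 0" if T: "closed T" "T \<subseteq> S" for T
  proof -
    have "(LINT x|?M. g x * indicator T x) = (LINT x|?M. g x * indicator S x - g x * indicator (S - T) x)"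
      using T by (intro Bochner_Integration.integral_cong) (auto simp: indicator_def)
    also have "\<dots> = (LINT x|?M. g x * indicator S x) - (LINT x|?M. g x * indicator (S - T) x)"
      using S T by (intro Bochner_Integration.integral_diff int) auto
    also have "\<dots> = 0" using op[of S] op[of "S - T"] S T by (auto simp: open_Diff)
    finally show ?thesis .
  qed
  define P where "P = {x \<in> S. g x > 0}"
  have P: "P \<in> sets lebesgue"
  proof -
    have "{x \<in> space ?M. g x > 0} \<in> sets ?M" by measurable
    then show ?thesis by (simp add: P_def sets_restrict_space_iff)
  qed
  have "emeasure lebesgue P \<le> 0 + ennreal e" if e: "e > 0" for e
  proof -
    obtain T where T: "closed T" "T \<subseteq> P" "P - T \<in> lmeasurable" "emeasure lebesgue (P - T) < ennreal e"
      using sets_lebesgue_inner_closed[OF P e] .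
    have TS: "T \<subseteq> S" using T by (auto simp: P_def)
    have "AE x in ?M. g x * indicator T x = 0"
    proof (subst integral_nonneg_eq_0_iff_AE[symmetric])
      show "integrable ?M (\<lambda>x. g x * indicator T x)" using int T by auto
      show "AE x in ?M. 0 \<le> g x * indicator T x"
        by (rule AE_I2) (use T(2) in \<open>auto simp: indicator_def P_def\<close>)
      show "(LINT x|?M. g x * indicator T x) = 0" using cl T TS by auto
    qed
    then have "AE x in lebesgue. x \<in> S \<longrightarrow> g x * indicator T x = 0"
      by (simp add: AE_restrict_space_iff)
    then have "AE x in lebesgue. x \<notin> T"
    proof eventually_elim
      case (elim x)
      then show ?case using T(2) by (auto simp: P_def indicator_def)
    qed
    then have "emeasure lebesgue T = 0"
      using T by (subst (asm) AE_iff_measurable[of T]) auto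
    moreover have "emeasure lebesgue P \<le> emeasure lebesgue T + emeasure lebesgue (P - T)"
      using emeasure_subadditive[of T lebesgue "P - T"] T P by (auto simp: Un_absorb1)
    ultimately show ?thesis using T(4) by auto
  qed
  then have "emeasure lebesgue P \<le> 0" using ennreal_le_epsilon[of 0 "emeasure lebesgue P"] by blast
  then have "AE x in lebesgue. x \<notin> P" using P by (subst AE_iff_measurable[of P]) auto
  then have "AE x in lebesgue. x \<in> S \<longrightarrow> g x \<le> 0"
    by eventually_elim (auto simp: P_def)
  then show ?thesis by (simp add: AE_restrict_space_iff)
qed

lemma fundamental_lemma:
  fixes S :: "(real^'n::finite) set"
  assumes "open S" "integrable (lebesgue_on S) g"
    and 0: "\<And>\<phi>. \<phi> \<in> test_functions S \<Longrightarrow> (LINT x|lebesgue_on S. g x * \<phi> x) = 0"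
  shows "AE x in lebesgue_on S. g x = 0"
proof -
  have "AE x in lebesgue_on S. g x \<le> 0"
    by (rule fundamental_lemma_nonpos) (use assms in auto)
  moreover have "AE x in lebesgue_on S. - g x \<le> 0"
    by (rule fundamental_lemma_nonpos) (use assms in auto)
  ultimately show ?thesis by eventually_elim auto
qed

section \<open>Integration by parts\<close>

text \<open>The function spaces live on \<open>lebesgue_on S\<close>, whereas translations,
  reflections and Fubini are applied on \<open>lborel\<close>. Borel functions vanishing off
  \<open>S\<close> can be moved between the two.\<close>

lemma integral_lebesgue_on_eq_lborel:
  fixes f :: "'n::finite fn"
  assumes "f \<in> borel_measurable borel" "S \<in> sets lebesgue" "\<And>x. x \<notin> S \<Longrightarrow> f x = 0"
  shows "(LINT x|lebesgue_on S. f x) = (LINT x|lborel. f x)"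
    and "integrable (lebesgue_on S) f \<longleftrightarrow> integrable lborel f"
proof -
  have *: "(\<lambda>x. indicator S x * f x) = f" using assms(3) by (auto simp: indicator_def fun_eq_iff)
  show "(LINT x|lebesgue_on S. f x) = (LINT x|lborel. f x)"
    using assms by (simp add: integral_restrict_space * integral_completion)
  show "integrable (lebesgue_on S) f \<longleftrightarrow> integrable lborel f"
    using assms by (simp add: integrable_restrict_space * integrable_completion)
qed

lemma test_functions_lborel_integrable:
  assumes "\<phi> \<in> test_functions S"
  shows "integrable lborel \<phi>"
proof -
  obtain K where K: "compact K" "K \<subseteq> S" "\<forall>x. x \<notin> K \<longrightarrow> \<phi> x = 0" using test_functionsE[OF assms] by blast
  have "integrable lborel (\<lambda>x. indicator K x *\<^sub>R \<phi> x)"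
    using K(1) smooth_continuous[OF test_functions_smooth[OF assms]] by (rule borel_integrable_compact)
  moreover have "(\<lambda>x. indicator K x *\<^sub>R \<phi> x) = \<phi>" using K(3) by (auto simp: indicator_def fun_eq_iff)
  ultimately show ?thesis by simp
qed

lemma integral_lborel_translate:
  fixes f :: "'n::finite fn"
  assumes "f \<in> borel_measurable borel"
  shows "(LINT x|lborel. f (v + x)) = (LINT x|lborel. f x)"
    and "integrable lborel (\<lambda>x. f (v + x)) \<longleftrightarrow> integrable lborel f"
proof -
  have "(LINT x|lborel. f x) = (LINT x|distr lborel borel ((+) v). f x)" by (simp add: lborel_distr_plus)
  also have "\<dots> = (LINT x|lborel. f (v + x))" using assms by (subst integral_distr) auto
  finally show "(LINT x|lborel. f (v + x)) = (LINT x|lborel. f x)" by simp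
  have "integrable (distr lborel borel ((+) v)) f \<longleftrightarrow> integrable lborel (\<lambda>x. f (v + x))"
    using assms by (subst integrable_distr_eq) auto
  then show "integrable lborel (\<lambda>x. f (v + x)) \<longleftrightarrow> integrable lborel f" by (simp add: lborel_distr_plus)
qed

text \<open>The integral of \<open>\<phi> (x + t e\<^sub>i)\<close> does not depend on t; compare with the Taylor expansion as t
  tends to 0.\<close>

lemma integral_partial_lborel:
  fixes \<phi> :: "'n::finite fn"
  assumes \<phi>: "\<phi> \<in> test_functions S"
  shows "(LINT x|lborel. partial i \<phi> x) = 0"
proof -
  obtain K where K: "compact K" "K \<subseteq> S" "\<forall>x. x \<notin> K \<longrightarrow> \<phi> x = 0" using test_functionsE[OF \<phi>] by blast
  obtain R where R: "\<And>x. x \<in> K \<Longrightarrow> norm x \<le> R"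
    using compact_imp_bounded[OF K(1)] by (auto simp: bounded_iff)
  obtain M where M: "M \<ge> 0" "\<And>x v. \<bar>\<phi> (x + v) - \<phi> x - (\<Sum>i\<in>UNIV. v $ i * partial i \<phi> x)\<bar> \<le> M * (norm v)\<^sup>2"
    using test_functions_taylor[OF \<phi>] by blast
  \<comment> \<open>The extra 1 accommodates shifts of length \<open>t \<le> 1\<close>: outside this
    ball \<open>\<phi>\<close>, its translate and its derivative all vanish.\<close>
  let ?B = "cball 0 (R + 1) :: (real^'n) set"
  let ?I = "LINT x|lborel. partial i \<phi> x"
  let ?m = "measure lborel ?B"
  have bor: "\<phi> \<in> borel_measurable borel" using smooth_borel test_functions_smooth[OF \<phi>] by blast
  have bound: "\<bar>?I\<bar> \<le> t * (M * ?m)" if t: "0 < t" "t \<le> 1" for t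
  proof -
    let ?f = "\<lambda>x. \<phi> (t *\<^sub>R axis i 1 + x) - \<phi> x - t * partial i \<phi> x"
    have i1: "integrable lborel (\<lambda>x. \<phi> (t *\<^sub>R axis i 1 + x))"
      using integral_lborel_translate(2)[OF bor] test_functions_lborel_integrable[OF \<phi>] by blast
    have i3: "integrable lborel (\<lambda>x. t * partial i \<phi> x)"
      using test_functions_lborel_integrable[OF test_functions_partial[OF \<phi>]] by simp
    have iB: "integrable lborel (\<lambda>x. M * t\<^sup>2 * indicator ?B x)"
      by (intro integrable_mult_right integrable_real_indicator) (use emeasure_lborel_cball_finite in \<open>auto simp: top.not_eq_extremum\<close>)
    have eq: "(LINT x|lborel. ?f x) = - t * ?I"
      using i1 i3 test_functions_lborel_integrable[OF \<phi>] integral_lborel_translate(1)[OF bor]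
      by simp
    have "\<bar>LINT x|lborel. ?f x\<bar> \<le> (LINT x|lborel. M * t\<^sup>2 * indicator ?B x)"
    proof (rule integral_abs_bound_integral)
      show "integrable lborel ?f" using i1 i3 test_functions_lborel_integrable[OF \<phi>] by auto
      fix x
      show "\<bar>?f x\<bar> \<le> M * t\<^sup>2 * indicator ?B x"
      proof (cases "x \<in> ?B")
        case True
        have "(\<Sum>j\<in>UNIV. (t *\<^sub>R axis i 1 :: real^'n) $ j * partial j \<phi> x) = t * partial i \<phi> x"
          by (simp add: axis_def if_distrib[of "\<lambda>a. _ * a"] if_distrib[of "\<lambda>a. a * _"] cong: if_cong)
        then show ?thesis using M(2)[of x "t *\<^sub>R axis i 1"] True t by (simp add: add.commute)
      next
        case False
        have "norm x \<le> norm (t *\<^sub>R axis i 1 + x) + norm (t *\<^sub>R axis i 1 :: real^'n)"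
          by (metis add_diff_cancel_left' norm_triangle_ineq4 add.commute)
        then have "x \<notin> K" "t *\<^sub>R axis i 1 + x \<notin> K"
          using False R[of x] R[of "t *\<^sub>R axis i 1 + x"] t by auto
        moreover then have "partial i \<phi> x = 0"
          using partial_eq_0_outside[OF compact_imp_closed[OF K(1)], of \<phi> x i] K(3) by blast
        ultimately show ?thesis using K(3) False by simp
      qed
    qed (rule iB)
    also have "\<dots> = M * t\<^sup>2 * ?m" by simp
    finally have "t * \<bar>?I\<bar> \<le> t * (t * (M * ?m))"
      using t unfolding eq by (simp add: abs_mult power2_eq_square mult_ac)
    then show ?thesis using t by simp
  qed
  have "((\<lambda>t. t * (M * ?m)) \<longlongrightarrow> 0 * (M * ?m)) (at_right 0)" by (intro tendsto_intros)
  moreover have "\<forall>\<^sub>F t in at_right 0. \<bar>?I\<bar> \<le> t * (M * ?m)"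
    using eventually_at_right_less[of 0] eventually_at_right[of 0 "1::real"] bound
    by (auto simp: eventually_at_right[of 0 "1::real"] intro!: exI[of _ 1])
  ultimately have "\<bar>?I\<bar> \<le> 0 * (M * ?m)"
    by (intro tendsto_lowerbound) auto
  then show ?thesis by simp
qed

lemma test_functions_L2:
  assumes "\<phi> \<in> test_functions T" "S \<in> lmeasurable"
  shows "\<phi> \<in> L2 S"
proof -
  have m: "\<phi> \<in> borel_measurable (lebesgue_on S)"
    by (intro borel_imp_measurable_lebesgue_on smooth_borel test_functions_smooth[OF assms(1)])
  obtain M where M: "\<And>x. \<bar>\<phi> x\<bar> \<le> M" using test_functions_bounded[OF assms(1)] by blast
  interpret finite_measure "lebesgue_on S" using assms(2) by (rule finite_measure_lebesgue_on)
  have "integrable (lebesgue_on S) (\<lambda>x. (\<phi> x)\<^sup>2)"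
  proof (rule integrable_const_bound[of _ "M\<^sup>2"])
    show "AE x in lebesgue_on S. norm ((\<phi> x)\<^sup>2) \<le> M\<^sup>2"
    proof (rule AE_I2)
      fix x
      have "\<bar>\<phi> x\<bar> \<le> \<bar>M\<bar>" using M[of x] by linarith
      then show "norm ((\<phi> x)\<^sup>2) \<le> M\<^sup>2" by (simp add: abs_le_square_iff)
    qed
  qed (use m in measurable)
  then show ?thesis using m by (simp add: L2_def)
qed

lemma test_functions_0_outside: "\<phi> \<in> test_functions S \<Longrightarrow> x \<notin> S \<Longrightarrow> \<phi> x = 0"
  using test_functionsE[of \<phi> S] by (metis subsetD)

text \<open>The product of the two functions is again a test function, so the integral of its
  derivative is 0.\<close>

lemma integral_by_parts:
  fixes \<phi> \<psi> :: "'n::finite fn"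
  assumes "\<phi> \<in> test_functions S" "\<psi> \<in> test_functions S" "S \<in> lmeasurable"
  shows "l2ip S (partial i \<phi>) \<psi> = - l2ip S \<phi> (partial i \<psi>)"
proof -
  have s: "smooth \<phi>" "smooth \<psi>" using assms test_functions_smooth by blast+
  have t: "(\<lambda>x. \<phi> x * \<psi> x) \<in> test_functions S" using test_functions_mult[OF assms(2) s(1)] .
  have "0 = (LINT x|lborel. partial i (\<lambda>x. \<phi> x * \<psi> x) x)"
    using integral_partial_lborel[OF t] by simp
  also have "\<dots> = (LINT x|lebesgue_on S. partial i (\<lambda>x. \<phi> x * \<psi> x) x)"
    using assms(3) test_functions_0_outside[OF test_functions_partial[OF t]]
      smooth_borel[OF smooth_partial[OF test_functions_smooth[OF t]]]
    by (subst integral_lebesgue_on_eq_lborel) auto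
  also have "\<dots> = (LINT x|lebesgue_on S. \<phi> x * partial i \<psi> x + partial i \<phi> x * \<psi> x)"
    by (simp only: partial_mult[OF smooth_differentiable[OF s(1)] smooth_differentiable[OF s(2)]])
  also have "\<dots> = l2ip S \<phi> (partial i \<psi>) + l2ip S (partial i \<phi>) \<psi>"
    unfolding l2ip_def
    using test_functions_L2[OF assms(1,3)] test_functions_L2[OF test_functions_partial[OF assms(1)] assms(3)]
      test_functions_L2[OF assms(2,3)] test_functions_L2[OF test_functions_partial[OF assms(2)] assms(3)]
    by (intro Bochner_Integration.integral_add L2_mult_integrable)
  finally show ?thesis by simp
qed

section \<open>Weak derivatives\<close>

lemma weak_partial_iff:
  "weak_partial S i v g \<longleftrightarrow> v \<in> L2 S \<and> g \<in> L2 S \<and>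
     (\<forall>\<phi>\<in>test_functions S. l2ip S v (partial i \<phi>) = - l2ip S g \<phi>)"
  by (simp add: weak_partial_def l2ip_def)

lemma weak_partial_L2: "weak_partial S i v g \<Longrightarrow> v \<in> L2 S" "weak_partial S i v g \<Longrightarrow> g \<in> L2 S"
  by (auto simp: weak_partial_def)

lemma weak_partial_cmult: "weak_partial S i v g \<Longrightarrow> weak_partial S i (\<lambda>x. c * v x) (\<lambda>x. c * g x)"
  by (auto simp: weak_partial_iff L2_cmult l2ip_cmult)

lemma l2norm_mono:
  assumes "f \<in> L2 S" "g \<in> L2 S" "S \<in> sets lebesgue" "\<And>x. x \<in> S \<Longrightarrow> \<bar>f x\<bar> \<le> \<bar>g x\<bar>"
  shows "l2norm S f \<le> l2norm S g"
  unfolding l2norm_def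
  by (intro real_sqrt_le_mono integral_mono L2D assms(1,2))
     (use assms(3,4) in \<open>auto simp: abs_le_square_iff\<close>)

definition lap :: "'n::finite fn \<Rightarrow> 'n fn" where
  "lap f x = (\<Sum>i\<in>UNIV. partial i (partial i f) x)"

lemma lap_test: "\<phi> \<in> test_functions S \<Longrightarrow> lap \<phi> \<in> test_functions S"
proof -
  have "finite A \<Longrightarrow> (\<And>i. i \<in> A \<Longrightarrow> f i \<in> test_functions S) \<Longrightarrow> (\<lambda>x. \<Sum>i\<in>A. f i x) \<in> test_functions S"
    for A :: "'a set" and f
    by (induction A rule: finite_induct) (auto simp: test_functions_zero test_functions_add)
  then show "\<phi> \<in> test_functions S \<Longrightarrow> lap \<phi> \<in> test_functions S"
    unfolding lap_def[abs_def] by (simp add: test_functions_partial)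
qed

lemma lap_add: "smooth f \<Longrightarrow> smooth g \<Longrightarrow> lap (\<lambda>x. f x + g x) = (\<lambda>x. lap f x + lap g x)"
proof -
  assume s: "smooth f" "smooth g"
  have p1: "partial i (\<lambda>x. f x + g x) = (\<lambda>x. partial i f x + partial i g x)" for i
    by (intro ext partial_add smooth_differentiable s)
  have p2: "partial i (\<lambda>x. partial i f x + partial i g x) = (\<lambda>x. partial i (partial i f) x + partial i (partial i g) x)" for i
    by (intro ext partial_add smooth_differentiable smooth_partial s)
  show ?thesis unfolding lap_def[abs_def] p1 p2 by (simp add: sum.distrib)
qed

lemma lap_cmult: "smooth f \<Longrightarrow> lap (\<lambda>x. c * f x) = (\<lambda>x. c * lap f x)"
  unfolding lap_def[abs_def] by (simp add: partial_cmult smooth_partial sum_distrib_left)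

lemma h2norm_nonneg [simp]: "0 \<le> h2norm S v"
  by (simp add: h2norm_def sum_nonneg)

lemma l2norm_hessian_le: "l2norm S (wpartial S j (wpartial S i v)) \<le> h2norm S v"
proof -
  have "(l2norm S (wpartial S j (wpartial S i v)))\<^sup>2 \<le> (\<Sum>j\<in>UNIV. (l2norm S (wpartial S j (wpartial S i v)))\<^sup>2)"
    by (rule member_le_sum) auto
  also have "\<dots> \<le> (\<Sum>i\<in>UNIV. \<Sum>j\<in>UNIV. (l2norm S (wpartial S j (wpartial S i v)))\<^sup>2)"
    by (rule member_le_sum[of i UNIV "\<lambda>i. \<Sum>j\<in>UNIV. (l2norm S (wpartial S j (wpartial S i v)))\<^sup>2"])
       (auto simp: sum_nonneg)
  also have "\<dots> \<le> (l2norm S v)\<^sup>2 + (\<Sum>i\<in>UNIV. (l2norm S (wpartial S i v))\<^sup>2) + \<dots>"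
    by (simp add: sum_nonneg)
  finally show ?thesis unfolding h2norm_def by (rule real_le_rsqrt)
qed

section \<open>Weak derivatives and second order Sobolev functions on a bounded open set\<close>

context
  fixes S :: "(real^'n::finite) set"
  assumes S: "open S" "bounded S"
begin

lemma bounded_open_lmeasurable: "S \<in> lmeasurable"
  using S by (simp add: lmeasurable_open)

text \<open>The difference of the two candidates annihilates all test functions. \<open>v\<close>
  and \<open>v'\<close> may differ on a null set because \<open>wpartial\<close> returns some
  representative, and iterating it requires that the next derivative be insensitive to that
  choice.\<close>

lemma weak_partial_unique:
  assumes "weak_partial S i v g" "weak_partial S i v' g'" "AE x in lebesgue_on S. v x = v' x"
  shows "AE x in lebesgue_on S. g x = g' x"
proof -
  note L = weak_partial_L2[OF assms(1)] weak_partial_L2[OF assms(2)]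
  have "AE x in lebesgue_on S. g x - g' x = 0"
  proof (rule fundamental_lemma[OF S(1)])
    show "integrable (lebesgue_on S) (\<lambda>x. g x - g' x)"
      using L2_integrable[OF L2_diff[OF L(2,4)] bounded_open_lmeasurable] .
    fix \<phi> assume \<phi>: "\<phi> \<in> test_functions S"
    then have \<phi>L: "\<phi> \<in> L2 S" "partial i \<phi> \<in> L2 S"
      using test_functions_L2 test_functions_partial bounded_open_lmeasurable by blast+
    have "(LINT x|lebesgue_on S. (g x - g' x) * \<phi> x) = l2ip S g \<phi> - l2ip S g' \<phi>"
      using l2ip_diff[OF L(2,4) \<phi>L(1)] by (simp add: l2ip_def)
    also have "\<dots> = l2ip S v' (partial i \<phi>) - l2ip S v (partial i \<phi>)"
      using assms(1,2) \<phi> by (simp add: weak_partial_iff)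
    also have "\<dots> = 0" using l2ip_cong_AE[OF L(1,3) \<phi>L(2) assms(3)] by simp
    finally show "(LINT x|lebesgue_on S. (g x - g' x) * \<phi> x) = 0" .
  qed
  then show ?thesis by simp
qed

lemma weak_partial_add:
  assumes "weak_partial S i v g" "weak_partial S i w h"
  shows "weak_partial S i (\<lambda>x. v x + w x) (\<lambda>x. g x + h x)"
  unfolding weak_partial_iff
proof (intro conjI ballI)
  note L = weak_partial_L2[OF assms(1)] weak_partial_L2[OF assms(2)]
  show "(\<lambda>x. v x + w x) \<in> L2 S" "(\<lambda>x. g x + h x) \<in> L2 S" using L L2_add by blast+
  fix \<phi> assume \<phi>: "\<phi> \<in> test_functions S"
  then have \<phi>L: "\<phi> \<in> L2 S" "partial i \<phi> \<in> L2 S"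
    using test_functions_L2 test_functions_partial bounded_open_lmeasurable by blast+
  show "l2ip S (\<lambda>x. v x + w x) (partial i \<phi>) = - l2ip S (\<lambda>x. g x + h x) \<phi>"
    using l2ip_add[OF L(1,3) \<phi>L(2)] l2ip_add[OF L(2,4) \<phi>L(1)] assms \<phi> by (simp add: weak_partial_iff)
qed

lemma weak_partial_wpartial: "weak_partial S i v g \<Longrightarrow> weak_partial S i v (wpartial S i v)"
  unfolding wpartial_def by (rule someI[of "weak_partial S i v"])

lemma wpartial_AE:
  assumes "weak_partial S i v g"
  shows "AE x in lebesgue_on S. wpartial S i v x = g x"
  using weak_partial_unique[OF weak_partial_wpartial[OF assms] assms] by simp

lemma weak_partial_cong:
  assumes "weak_partial S i v g" "v' \<in> L2 S" "AE x in lebesgue_on S. v x = v' x"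
  shows "weak_partial S i v' g"
  unfolding weak_partial_iff
proof (intro conjI ballI)
  fix \<phi> assume \<phi>: "\<phi> \<in> test_functions S"
  then have \<phi>L: "partial i \<phi> \<in> L2 S"
    using test_functions_L2 test_functions_partial bounded_open_lmeasurable by blast
  show "l2ip S v' (partial i \<phi>) = - l2ip S g \<phi>"
    using l2ip_cong_AE[OF weak_partial_L2(1)[OF assms(1)] assms(2) \<phi>L assms(3)] assms(1) \<phi>
    by (simp add: weak_partial_iff)
qed (use assms weak_partial_L2 in auto)

text \<open>\<open>H2\<close> only provides some first derivative \<open>g\<close> with weak
  derivatives of its own. Since \<open>g\<close> agrees almost everywhere with
  \<open>wpartial S i v\<close>, this passes to the iterated choices that occur in
  \<open>h2norm\<close> and \<open>wlaplacian\<close>.\<close>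

lemma H2_weak_partial:
  assumes "v \<in> H2 S"
  shows "weak_partial S i v (wpartial S i v)"
    and "weak_partial S j (wpartial S i v) (wpartial S j (wpartial S i v))"
proof -
  obtain g h where g: "weak_partial S i v g" and h: "weak_partial S j g h"
    using assms unfolding H2_def by blast
  show 1: "weak_partial S i v (wpartial S i v)" using weak_partial_wpartial[OF g] .
  have "AE x in lebesgue_on S. g x = wpartial S i v x"
    using weak_partial_unique[OF g 1] by simp
  then show "weak_partial S j (wpartial S i v) (wpartial S j (wpartial S i v))"
    using weak_partial_wpartial[OF weak_partial_cong[OF h weak_partial_L2(2)[OF 1]]] by blast
qed

text \<open>Triangle inequality over the diagonal second derivatives. The factor
  \<open>CARD('n)\<close> reappears in the later constants as a norm bound for
  \<open>opB\<close>.\<close>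

lemma wlaplacian_bound:
  assumes "v \<in> H2 S"
  shows "wlaplacian S v \<in> L2 S" "l2norm S (wlaplacian S v) \<le> real CARD('n) * h2norm S v"
proof -
  have L: "wpartial S i (wpartial S i v) \<in> L2 S" for i
    using weak_partial_L2(2)[OF H2_weak_partial(2)[OF assms]] .
  show "wlaplacian S v \<in> L2 S" unfolding wlaplacian_def by (intro L2_sum L)
  have "l2norm S (wlaplacian S v) \<le> (\<Sum>i\<in>UNIV. l2norm S (wpartial S i (wpartial S i v)))"
    unfolding wlaplacian_def by (intro l2norm_sum_le L)
  also have "\<dots> \<le> (\<Sum>i\<in>(UNIV::'n set). h2norm S v)" by (intro sum_mono l2norm_hessian_le)
  finally show "l2norm S (wlaplacian S v) \<le> real CARD('n) * h2norm S v" by simp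
qed

lemma opB_l2ip: "opB S z v = - l2ip S z (wlaplacian S v)"
  by (simp add: opB_def l2ip_def)

lemma opB_bound:
  assumes "z \<in> L2 S" "v \<in> H2 S"
  shows "\<bar>opB S z v\<bar> \<le> real CARD('n) * l2norm S z * h2norm S v"
proof -
  have "\<bar>opB S z v\<bar> \<le> l2norm S z * l2norm S (wlaplacian S v)"
    using l2ip_le[OF assms(1) wlaplacian_bound(1)[OF assms(2)]] by (simp add: opB_l2ip)
  also have "\<dots> \<le> l2norm S z * (real CARD('n) * h2norm S v)"
    by (intro mult_left_mono wlaplacian_bound(2) assms) auto
  finally show ?thesis by (simp add: mult_ac)
qed

lemma opB_diff:
  assumes "z \<in> L2 S" "z' \<in> L2 S" "v \<in> H2 S"
  shows "opB S (\<lambda>x. z x - z' x) v = opB S z v - opB S z' v"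
  using l2ip_diff[OF assms(1,2) wlaplacian_bound(1)[OF assms(3)]] by (simp add: opB_l2ip)

section \<open>Test functions as elements of H20\<close>

lemma test_weak_partial:
  assumes "\<phi> \<in> test_functions S"
  shows "weak_partial S i \<phi> (partial i \<phi>)"
  unfolding weak_partial_iff
proof (intro conjI ballI)
  show "\<phi> \<in> L2 S" "partial i \<phi> \<in> L2 S"
    using test_functions_L2[OF _ bounded_open_lmeasurable] assms test_functions_partial by blast+
  fix \<psi> assume "\<psi> \<in> test_functions S"
  from integral_by_parts[OF assms this bounded_open_lmeasurable]
  show "l2ip S \<phi> (partial i \<psi>) = - l2ip S (partial i \<phi>) \<psi>" by simp
qed

lemma test_wpartial_AE:
  assumes "\<phi> \<in> test_functions S"
  shows "AE x in lebesgue_on S. wpartial S i \<phi> x = partial i \<phi> x"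
    and "AE x in lebesgue_on S. wpartial S j (wpartial S i \<phi>) x = partial j (partial i \<phi>) x"
proof -
  note w = test_weak_partial[OF assms, of i]
  show 1: "AE x in lebesgue_on S. wpartial S i \<phi> x = partial i \<phi> x"
    using wpartial_AE[OF w] .
  have "weak_partial S j (wpartial S i \<phi>) (partial j (partial i \<phi>))"
    by (rule weak_partial_cong[OF test_weak_partial[OF test_functions_partial[OF assms]]])
       (use 1 weak_partial_L2(2)[OF weak_partial_wpartial[OF w]] in \<open>auto simp: eq_commute\<close>)
  then show "AE x in lebesgue_on S. wpartial S j (wpartial S i \<phi>) x = partial j (partial i \<phi>) x"
    by (rule wpartial_AE)
qed

lemma test_H2:
  assumes "\<phi> \<in> test_functions S"
  shows "\<phi> \<in> H2 S"
proof -
  have "weak_partial S i \<phi> (partial i \<phi>)" for i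
    using test_weak_partial[OF assms] .
  moreover have "weak_partial S j (partial i \<phi>) (partial j (partial i \<phi>))" for i j
    using test_weak_partial[OF test_functions_partial[OF assms]] .
  ultimately show ?thesis unfolding H2_def using weak_partial_L2(1) by blast
qed

lemma test_h2norm:
  assumes "\<phi> \<in> test_functions S"
  shows "h2norm S \<phi> = sqrt ((l2norm S \<phi>)\<^sup>2 + (\<Sum>i\<in>UNIV. (l2norm S (partial i \<phi>))\<^sup>2)
      + (\<Sum>i\<in>UNIV. \<Sum>j\<in>UNIV. (l2norm S (partial j (partial i \<phi>)))\<^sup>2))"
proof -
  note H = H2_weak_partial[OF test_H2[OF assms]]
  have "l2norm S (wpartial S i \<phi>) = l2norm S (partial i \<phi>)" for i
    using l2norm_cong_AE[OF weak_partial_L2(2)[OF H(1)] weak_partial_L2(2)[OF test_weak_partial[OF assms]]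
        test_wpartial_AE(1)[OF assms]] .
  moreover have "l2norm S (wpartial S j (wpartial S i \<phi>)) = l2norm S (partial j (partial i \<phi>))" for i j
    using l2norm_cong_AE[OF weak_partial_L2(2)[OF H(2)]
        weak_partial_L2(2)[OF test_weak_partial[OF test_functions_partial[OF assms]]]
        test_wpartial_AE(2)[OF assms]] .
  ultimately show ?thesis by (simp add: h2norm_def)
qed

lemma h2norm_zero: "h2norm S (\<lambda>x. 0) = 0"
  using test_h2norm[OF test_functions_zero] by simp

lemma test_H20: "\<phi> \<in> test_functions S \<Longrightarrow> \<phi> \<in> H20 S"
  unfolding H20_def using h2norm_zero by (auto simp: test_H2 intro!: bexI[of _ \<phi>])

text \<open>On test functions \<open>wlaplacian\<close> and \<open>lap\<close> agree almost
  everywhere, so that bounds on \<open>opB\<close> become bounds on L2 products with classical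
  Laplacians.\<close>

lemma opB_test:
  assumes "\<phi> \<in> test_functions S" "z \<in> L2 S"
  shows "opB S z \<phi> = - l2ip S z (lap \<phi>)"
proof -
  have "AE x in lebesgue_on S. \<forall>i. wpartial S i (wpartial S i \<phi>) x = partial i (partial i \<phi>) x"
    using test_wpartial_AE(2)[OF assms(1)] by (simp add: AE_all_countable)
  then have "AE x in lebesgue_on S. wlaplacian S \<phi> x = lap \<phi> x"
    by eventually_elim (simp add: wlaplacian_def lap_def)
  from l2ip_cong_AE[OF wlaplacian_bound(1)[OF test_H2[OF assms(1)]]
      test_functions_L2[OF lap_test[OF assms(1)] bounded_open_lmeasurable] assms(2) this]
  show ?thesis by (simp add: opB_l2ip l2ip_commute[of S z])
qed

lemma H20_H2: "v \<in> H20 S \<Longrightarrow> v \<in> H2 S"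
  by (simp add: H20_def)

lemma H2_cmult:
  assumes "v \<in> H2 S"
  shows "(\<lambda>x. c * v x) \<in> H2 S"
proof -
  note w = weak_partial_cmult[OF H2_weak_partial(1)[OF assms], where c=c]
    and w2 = weak_partial_cmult[OF H2_weak_partial(2)[OF assms], where c=c]
  show ?thesis unfolding H2_def using weak_partial_L2(1)[OF w] w w2 by blast
qed

lemma H2_add:
  assumes "v \<in> H2 S" "w \<in> H2 S"
  shows "(\<lambda>x. v x + w x) \<in> H2 S"
proof -
  have "weak_partial S i (\<lambda>x. v x + w x) (\<lambda>x. wpartial S i v x + wpartial S i w x)" for i
    using weak_partial_add[OF H2_weak_partial(1)[OF assms(1)] H2_weak_partial(1)[OF assms(2)]] .
  moreover have "weak_partial S j (\<lambda>x. wpartial S i v x + wpartial S i w x)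
      (\<lambda>x. wpartial S j (wpartial S i v) x + wpartial S j (wpartial S i w) x)" for i j
    using weak_partial_add[OF H2_weak_partial(2)[OF assms(1)] H2_weak_partial(2)[OF assms(2)]] .
  ultimately show ?thesis unfolding H2_def using weak_partial_L2(1) by blast
qed

lemma h2norm_minus:
  assumes "v \<in> H2 S"
  shows "h2norm S (\<lambda>x. - v x) = h2norm S v"
proof -
  have m: "(\<lambda>x. - v x) \<in> H2 S" using H2_cmult[OF assms, of "-1"] by simp
  note Hv = H2_weak_partial[OF assms] and Hm = H2_weak_partial[OF m]
  have 1: "AE x in lebesgue_on S. wpartial S i (\<lambda>x. - v x) x = -1 * wpartial S i v x" for i
    using wpartial_AE[OF weak_partial_cmult[OF Hv(1), where c="-1"]] by simp
  have a: "l2norm S (wpartial S i (\<lambda>x. - v x)) = l2norm S (wpartial S i v)" for i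
    using l2norm_cong_AE[OF weak_partial_L2(2)[OF Hm(1)] L2_cmult[OF weak_partial_L2(2)[OF Hv(1)]] 1]
      l2norm_minus[of S "wpartial S i v"] by simp
  have 2: "AE x in lebesgue_on S. -1 * wpartial S j (wpartial S i v) x = wpartial S j (wpartial S i (\<lambda>x. - v x)) x" for i j
    by (rule weak_partial_unique[OF weak_partial_cmult[OF Hv(2), where c="-1"] Hm(2)])
       (use 1 in \<open>auto simp: eq_commute\<close>)
  have b: "l2norm S (wpartial S j (wpartial S i (\<lambda>x. - v x))) = l2norm S (wpartial S j (wpartial S i v))" for i j
    using l2norm_cong_AE[OF L2_cmult[OF weak_partial_L2(2)[OF Hv(2)]] weak_partial_L2(2)[OF Hm(2)] 2]
      l2norm_minus[of S "wpartial S j (wpartial S i v)"] by simp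
  show ?thesis by (simp add: h2norm_def a b l2norm_minus)
qed

text \<open>Closure under negation allows a functional on the sum space to be split at
  \<open>v - E v\<close> by additivity. Negating the approximating test functions keeps their
  distance, by \<open>h2norm_minus\<close>.\<close>

lemma H20_minus:
  assumes "v \<in> H20 S"
  shows "(\<lambda>x. - v x) \<in> H20 S"
  unfolding H20_def
proof (intro CollectI conjI allI impI)
  show "(\<lambda>x. - v x) \<in> H2 S" using H2_cmult[OF H20_H2[OF assms], of "-1"] by simp
  fix e :: real assume "e > 0"
  then obtain \<phi> where \<phi>: "\<phi> \<in> test_functions S" "h2norm S (\<lambda>x. v x - \<phi> x) < e"
    using assms by (auto simp: H20_def)
  have "(\<lambda>x. v x - \<phi> x) \<in> H2 S"
    using H2_add[OF H20_H2[OF assms] H2_cmult[OF test_H2[OF \<phi>(1)], of "-1"]] by simp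
  from h2norm_minus[OF this]
  have "h2norm S (\<lambda>x. - v x - - \<phi> x) = h2norm S (\<lambda>x. v x - \<phi> x)" by simp
  then show "\<exists>\<phi>\<in>test_functions S. h2norm S (\<lambda>x. - v x - \<phi> x) < e"
    using \<phi> test_functions_cmult[OF \<phi>(1), of "-1"] by (intro bexI[of _ "\<lambda>x. - \<phi> x"]) auto
qed

text \<open>Integrate \<open>\<phi>\<^sup>2 = \<phi>\<^sup>2 \<partial>\<^sub>i x\<^sub>i\<close> by parts.\<close>

lemma poincare:
  assumes \<phi>: "\<phi> \<in> test_functions S" and R: "\<And>x. x \<in> S \<Longrightarrow> norm x \<le> R" "R \<ge> 0"
  shows "l2norm S \<phi> \<le> 2 * R * l2norm S (partial i \<phi>)"
proof -
  note L = test_functions_L2[OF _ bounded_open_lmeasurable]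
  have s: "smooth \<phi>" using test_functions_smooth \<phi> by blast
  define \<psi> where "\<psi> x = x $ i * \<phi> x" for x
  have \<psi>: "\<psi> \<in> test_functions S" unfolding \<psi>_def[abs_def] by (rule test_functions_mult[OF \<phi> smooth_coord])
  have p: "partial i \<phi> \<in> test_functions S" by (rule test_functions_partial[OF \<phi>])
  have xp: "(\<lambda>x. x $ i * partial i \<phi> x) \<in> test_functions S" by (rule test_functions_mult[OF p smooth_coord])
  have "partial i \<psi> x = x $ i * partial i \<phi> x + \<phi> x" for x
    using partial_mult[OF smooth_differentiable[OF smooth_coord] smooth_differentiable[OF s], where i=i and x=x]
    by (simp add: \<psi>_def[abs_def] partial_coord)
  then have d: "partial i \<psi> = (\<lambda>x. x $ i * partial i \<phi> x + \<phi> x)" by blast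
  have "l2ip S (partial i \<phi>) \<psi> = - l2ip S \<phi> (partial i \<psi>)"
    by (rule integral_by_parts[OF \<phi> \<psi> bounded_open_lmeasurable])
  also have "l2ip S \<phi> (partial i \<psi>) = l2ip S (\<lambda>x. x $ i * partial i \<phi> x) \<phi> + l2ip S \<phi> \<phi>"
    unfolding d l2ip_commute[of S \<phi> "\<lambda>x. _ x + _ x"] by (rule l2ip_add[OF L[OF xp] L[OF \<phi>] L[OF \<phi>]])
  also have "l2ip S (\<lambda>x. x $ i * partial i \<phi> x) \<phi> = l2ip S (partial i \<phi>) \<psi>"
    by (simp add: l2ip_def \<psi>_def mult_ac)
  \<comment> \<open>The product with \<open>\<psi>\<close> occurs on both sides of the integration
    by parts; collecting it gives the factor 2.\<close>
  finally have "(l2norm S \<phi>)\<^sup>2 = - 2 * l2ip S (partial i \<phi>) \<psi>" by (simp add: l2norm_power2)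
  also have "\<dots> \<le> 2 * (l2norm S (partial i \<phi>) * l2norm S \<psi>)"
    using l2ip_le[OF L[OF p] L[OF \<psi>]] by linarith
  also have "\<dots> \<le> 2 * (l2norm S (partial i \<phi>) * (R * l2norm S \<phi>))"
  proof -
    have "l2norm S \<psi> \<le> l2norm S (\<lambda>x. R * \<phi> x)"
    proof (rule l2norm_mono[OF L[OF \<psi>] L2_cmult[OF L[OF \<phi>]]])
      show "\<bar>\<psi> x\<bar> \<le> \<bar>R * \<phi> x\<bar>" if "x \<in> S" for x
        using R(1)[OF that] R(2) component_le_norm_cart[of x i]
        by (auto simp: \<psi>_def abs_mult intro!: mult_right_mono)
    qed (use bounded_open_lmeasurable in auto)
    then show ?thesis using R(2) by (intro mult_left_mono) (auto simp: l2norm_cmult)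
  qed
  finally have "l2norm S \<phi> * l2norm S \<phi> \<le> (2 * R * l2norm S (partial i \<phi>)) * l2norm S \<phi>"
    by (simp add: power2_eq_square mult_ac)
  then show ?thesis
    using R(2) l2norm_nonneg[of S \<phi>] mult_right_le_imp_le[of "l2norm S \<phi>" "l2norm S \<phi>"]
    by (cases "l2norm S \<phi> = 0") auto
qed

text \<open>Integrating by parts turns the left-hand side into
  \<open>- l2ip S (lap \<phi>) \<phi>\<close>, to which Cauchy-Schwarz applies.\<close>

lemma test_gradient:
  assumes \<phi>: "\<phi> \<in> test_functions S"
  shows "(\<Sum>i\<in>UNIV. (l2norm S (partial i \<phi>))\<^sup>2) \<le> l2norm S \<phi> * l2norm S (lap \<phi>)"
proof -
  note L = test_functions_L2[OF _ bounded_open_lmeasurable]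
  have "(l2norm S (partial i \<phi>))\<^sup>2 = - l2ip S (partial i (partial i \<phi>)) \<phi>" for i
    unfolding l2norm_power2 l2ip_commute[of S "partial i (partial i \<phi>)"]
    by (rule integral_by_parts[OF \<phi> test_functions_partial[OF \<phi>] bounded_open_lmeasurable])
  then have "(\<Sum>i\<in>UNIV. (l2norm S (partial i \<phi>))\<^sup>2) = - (\<Sum>i\<in>UNIV. l2ip S (partial i (partial i \<phi>)) \<phi>)"
    by (simp add: sum_negf)
  also have "\<dots> = - l2ip S (lap \<phi>) \<phi>"
    unfolding lap_def[abs_def]
    by (subst l2ip_sum) (auto intro!: L[OF \<phi>] L[OF test_functions_partial[OF test_functions_partial[OF \<phi>]]])
  also have "\<dots> \<le> l2norm S \<phi> * l2norm S (lap \<phi>)"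
    using l2ip_le[OF L[OF lap_test[OF \<phi>]] L[OF \<phi>]] by (simp add: mult.commute)
  finally show ?thesis .
qed

text \<open>Integrating by parts twice and exchanging the order of derivatives turns each squared
  mixed derivative into the product of the pure second derivatives in directions \<open>i\<close>
  and \<open>j\<close>; the double sum then factors. Compact support removes all boundary terms,
  whence equality.\<close>

lemma test_hessian:
  assumes \<phi>: "\<phi> \<in> test_functions S"
  shows "(\<Sum>i\<in>UNIV. \<Sum>j\<in>UNIV. (l2norm S (partial j (partial i \<phi>)))\<^sup>2) = (l2norm S (lap \<phi>))\<^sup>2"
proof -
  note L = test_functions_L2[OF _ bounded_open_lmeasurable]
  note s = test_functions_smooth[OF \<phi>]
  note p = test_functions_partial[OF \<phi>] and pp = test_functions_partial[OF test_functions_partial[OF \<phi>]]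
  have eq: "(l2norm S (partial j (partial i \<phi>)))\<^sup>2 = l2ip S (partial i (partial i \<phi>)) (partial j (partial j \<phi>))" for i j
  proof -
    have "(l2norm S (partial j (partial i \<phi>)))\<^sup>2 = - l2ip S (partial i \<phi>) (partial j (partial j (partial i \<phi>)))"
      unfolding l2norm_power2 by (rule integral_by_parts[OF p pp bounded_open_lmeasurable])
    also have "partial j (partial j (partial i \<phi>)) = partial i (partial j (partial j \<phi>))"
      using partial_commute[OF s, of j i] partial_commute[OF smooth_partial[OF s], of j i j] by simp
    also have "- l2ip S (partial i \<phi>) (partial i (partial j (partial j \<phi>))) = l2ip S (partial i (partial i \<phi>)) (partial j (partial j \<phi>))"
      using integral_by_parts[OF p pp bounded_open_lmeasurable] by simp
    finally show ?thesis .
  qed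
  have lap: "(\<Sum>j\<in>UNIV. l2ip S (partial j (partial j \<phi>)) g) = l2ip S (lap \<phi>) g" if "g \<in> L2 S" for g
    unfolding lap_def[abs_def] by (rule l2ip_sum[symmetric]) (rule L[OF pp], rule that)
  have "(\<Sum>j\<in>UNIV. l2ip S (partial i (partial i \<phi>)) (partial j (partial j \<phi>)))
      = l2ip S (partial i (partial i \<phi>)) (lap \<phi>)" for i
  proof -
    have "(\<Sum>j\<in>UNIV. l2ip S (partial i (partial i \<phi>)) (partial j (partial j \<phi>)))
        = (\<Sum>j\<in>UNIV. l2ip S (partial j (partial j \<phi>)) (partial i (partial i \<phi>)))"
      by (rule sum.cong[OF refl l2ip_commute])
    also have "\<dots> = l2ip S (lap \<phi>) (partial i (partial i \<phi>))" by (rule lap[OF L[OF pp]])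
    finally show ?thesis by (rule trans[OF _ l2ip_commute])
  qed
  then show ?thesis
    unfolding eq by (simp add: lap[OF L[OF lap_test[OF \<phi>]]] l2norm_power2)
qed

text \<open>Poincare followed by the gradient bound estimates the square of
  \<open>l2norm S \<phi>\<close> by
  \<open>4 * R\<^sup>2 * l2norm S \<phi> * l2norm S (lap \<phi>)\<close>. Cancelling one factor
  controls \<open>\<phi>\<close>, and with it the gradient.\<close>

lemma test_h2norm_bound:
  obtains C where "C \<ge> 0" "\<And>\<phi>. \<phi> \<in> test_functions S \<Longrightarrow> h2norm S \<phi> \<le> C * l2norm S (lap \<phi>)"
proof -
  obtain R0 where R0: "\<And>x. x \<in> S \<Longrightarrow> norm x \<le> R0" using S(2) by (auto simp: bounded_iff)
  define R where "R = max R0 0"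
  have R: "\<And>x. x \<in> S \<Longrightarrow> norm x \<le> R" "R \<ge> 0" using R0 by (auto simp: R_def le_max_iff_disj)
  \<comment> \<open>The added 1 ensures that \<open>C * ?l\<close> dominates the Hessian term
    \<open>?l\<close> as well.\<close>
  define C where "C = 4 * R\<^sup>2 + 1"
  have C: "C \<ge> 1" by (simp add: C_def)
  have "h2norm S \<phi> \<le> 2 * C * l2norm S (lap \<phi>)" if \<phi>: "\<phi> \<in> test_functions S" for \<phi>
  proof -
    let ?a = "l2norm S \<phi>" and ?l = "l2norm S (lap \<phi>)"
    let ?g = "\<Sum>i\<in>UNIV. (l2norm S (partial i \<phi>))\<^sup>2"
    fix i :: 'n
    have "?a\<^sup>2 \<le> (2 * R * l2norm S (partial i \<phi>))\<^sup>2"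
      by (intro power_mono poincare[OF \<phi> R]) auto
    also have "\<dots> = 4 * R\<^sup>2 * (l2norm S (partial i \<phi>))\<^sup>2" by (simp add: power_mult_distrib)
    also have "\<dots> \<le> 4 * R\<^sup>2 * (?a * ?l)"
    proof (rule mult_left_mono)
      have "(l2norm S (partial i \<phi>))\<^sup>2 \<le> ?g" by (rule member_le_sum) auto
      then show "(l2norm S (partial i \<phi>))\<^sup>2 \<le> ?a * ?l" using test_gradient[OF \<phi>] by linarith
    qed simp
    finally have "?a * ?a \<le> (4 * R\<^sup>2 * ?l) * ?a" by (simp add: power2_eq_square mult_ac)
    then have "?a \<le> 4 * R\<^sup>2 * ?l"
      using l2norm_nonneg[of S \<phi>] mult_right_le_imp_le[of ?a ?a] by (cases "?a = 0") auto
    also have "\<dots> \<le> C * ?l" by (intro mult_right_mono) (auto simp: C_def)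
    finally have a: "?a \<le> C * ?l" .
    have l: "?l \<le> C * ?l" using mult_right_mono[OF C l2norm_nonneg[of S "lap \<phi>"]] by simp
    have "?g \<le> ?a * ?l" using test_gradient[OF \<phi>] .
    also have "\<dots> \<le> (C * ?l) * (C * ?l)"
      using C a l by (intro mult_mono) auto
    finally have g: "?g \<le> (C * ?l)\<^sup>2" by (simp add: power2_eq_square)
    have h: "?l\<^sup>2 \<le> (C * ?l)\<^sup>2" using l by (intro power_mono) auto
    have "?a\<^sup>2 \<le> (C * ?l)\<^sup>2" using a by (intro power_mono) auto
    \<comment> \<open>Three terms, each at most \<open>(C * ?l)\<^sup>2\<close>, are bounded by four
      such squares.\<close>
    have "?a\<^sup>2 + ?g + ?l\<^sup>2 \<le> (2 * C * ?l)\<^sup>2"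
    proof -
      have "(2 * C * ?l)\<^sup>2 = 4 * (C * ?l)\<^sup>2" by (simp add: power_mult_distrib)
      moreover have "0 \<le> (C * ?l)\<^sup>2" by simp
      ultimately show ?thesis using \<open>?a\<^sup>2 \<le> (C * ?l)\<^sup>2\<close> g h by linarith
    qed
    then show ?thesis
      unfolding test_h2norm[OF \<phi>] test_hessian[OF \<phi>]
      using C by (intro real_le_lsqrt) (auto simp: sum_nonneg)
  qed
  then show ?thesis using C by (intro that[of "2 * C"]) auto
qed

end

section \<open>Weyl's lemma\<close>

definition conv :: "'n::finite fn \<Rightarrow> 'n fn \<Rightarrow> 'n fn" where
  "conv h K x = (LINT y|lborel. h y * K (x - y))"

lemma conv_integrable:
  assumes "integrable lborel h" "K \<in> test_functions UNIV"
  shows "integrable lborel (\<lambda>y. h y * K (x - y))"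
proof -
  obtain M where M: "\<And>x. \<bar>K x\<bar> \<le> M" using test_functions_bounded[OF assms(2)] by blast
  have [measurable]: "K \<in> borel_measurable borel" using smooth_borel[OF test_functions_smooth[OF assms(2)]] .
  show ?thesis by (rule integrable_mult_bounded[OF assms(1) _ M]) measurable
qed

lemma has_derivative_quadratic:
  fixes f :: "'a::real_normed_vector \<Rightarrow> real"
  assumes "bounded_linear D" "\<And>v. \<bar>f (x + v) - f x - D v\<bar> \<le> M * (norm v)\<^sup>2"
  shows "(f has_derivative D) (at x)"
  unfolding has_derivative_at
proof (intro conjI assms(1))
  have "((\<lambda>v. M * norm v) \<longlongrightarrow> M * norm (0::'a)) (at (0::'a))"
    by (intro tendsto_intros)
  then have lim: "((\<lambda>v. M * norm v) \<longlongrightarrow> 0) (at (0::'a))" by (simp only: norm_zero mult_zero_right)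
  have ev: "\<forall>\<^sub>F v in at 0. norm (norm (f (x + v) - f x - D v) / norm v) \<le> M * norm v"
    using assms(2) by (auto simp: eventually_at_filter divide_le_eq power2_eq_square mult_ac)
  show "(\<lambda>v. norm (f (x + v) - f x - D v) / norm v) \<midarrow>0\<rightarrow> 0"
    by (rule Lim_null_comparison[OF ev lim])
qed

text \<open>The Taylor remainder of \<open>K\<close> is uniform in the base point and can therefore
  be integrated against \<open>h\<close>: the error is at most \<open>M * (norm v)\<^sup>2\<close>
  times the L1 norm of \<open>h\<close>.\<close>

lemma conv_has_derivative:
  fixes h K :: "'n::finite fn"
  assumes h: "integrable lborel h" and K: "K \<in> test_functions UNIV"
  shows "(conv h K has_derivative (\<lambda>v. \<Sum>i\<in>UNIV. v $ i * conv h (partial i K) x)) (at x)"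
proof -
  obtain M where M: "M \<ge> 0" "\<And>x v. \<bar>K (x + v) - K x - (\<Sum>i\<in>UNIV. v $ i * partial i K x)\<bar> \<le> M * (norm v)\<^sup>2"
    using test_functions_taylor[OF K] by blast
  show ?thesis
  proof (rule has_derivative_quadratic)
    show "bounded_linear (\<lambda>v. \<Sum>i\<in>UNIV. v $ i * conv h (partial i K) x)"
      by (intro bounded_linear_sum bounded_linear_mult_const bounded_linear_vec_nth)
    fix v :: "real^'n"
    let ?f = "\<lambda>y. h y * K (x + v - y) - h y * K (x - y) - (\<Sum>i\<in>UNIV. v $ i * (h y * partial i K (x - y)))"
    have i1: "integrable lborel (\<lambda>y. h y * K (z - y))" for z by (rule conv_integrable[OF h K])
    have i2: "integrable lborel (\<lambda>y. v $ i * (h y * partial i K (x - y)))" for i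
      using conv_integrable[OF h test_functions_partial[OF K]] by simp
    have "conv h K (x + v) - conv h K x - (\<Sum>i\<in>UNIV. v $ i * conv h (partial i K) x) = (LINT y|lborel. ?f y)"
      using i1 i2 by (simp add: conv_def)
    also have "\<bar>\<dots>\<bar> \<le> (LINT y|lborel. (M * (norm v)\<^sup>2) * \<bar>h y\<bar>)"
    proof (rule integral_abs_bound_integral)
      show "integrable lborel ?f"
        by (intro Bochner_Integration.integrable_diff Bochner_Integration.integrable_sum i1 i2)
      show "integrable lborel (\<lambda>y. (M * (norm v)\<^sup>2) * \<bar>h y\<bar>)" using h by simp
      fix y
      have "?f y = h y * (K (x - y + v) - K (x - y) - (\<Sum>i\<in>UNIV. v $ i * partial i K (x - y)))"
        by (simp add: right_diff_distrib sum_distrib_left algebra_simps)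
      then have "\<bar>?f y\<bar> = \<bar>h y\<bar> * \<bar>K (x - y + v) - K (x - y) - (\<Sum>i\<in>UNIV. v $ i * partial i K (x - y))\<bar>"
        by (simp only: abs_mult)
      also have "\<dots> \<le> \<bar>h y\<bar> * (M * (norm v)\<^sup>2)" by (intro mult_left_mono M(2)) auto
      finally show "\<bar>?f y\<bar> \<le> (M * (norm v)\<^sup>2) * \<bar>h y\<bar>" by (simp add: mult.commute)
    qed
    finally show "\<bar>conv h K (x + v) - conv h K x - (\<Sum>i\<in>UNIV. v $ i * conv h (partial i K) x)\<bar>
        \<le> (M * (LINT y|lborel. \<bar>h y\<bar>)) * (norm v)\<^sup>2"
      by (simp add: mult_ac)
  qed
qed

lemma conv_smooth:
  assumes h: "integrable lborel h" and K: "K \<in> test_functions UNIV"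
  shows "smooth (conv h K)"
proof
  fix k
  show "Ck_on k UNIV (conv h K)"
    using K
  proof (induction k arbitrary: K)
    case 0
    have "isCont (conv h K) x" for x
      using conv_has_derivative[OF h 0] by (rule has_derivative_continuous)
    then show ?case by (simp add: continuous_at_imp_continuous_on)
  next
    case (Suc k)
    show ?case
      using Ck_on_if_partials(1)[OF conv_has_derivative[OF h Suc.prems]] Suc.IH test_functions_partial[OF Suc.prems]
      by blast
  qed
qed

lemma partial_conv:
  assumes h: "integrable lborel h" and K: "K \<in> test_functions UNIV"
  shows "partial i (conv h K) = conv h (partial i K)"
  using Ck_on_if_partials(2)[OF conv_has_derivative[OF h K], where k=0]
    conv_smooth[OF h test_functions_partial[OF K]] by blast

lemma lap_conv:
  assumes h: "integrable lborel h" and K: "K \<in> test_functions UNIV"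
  shows "lap (conv h K) = conv h (lap K)"
proof
  fix x
  have "lap (conv h K) x = (\<Sum>i\<in>UNIV. conv h (partial i (partial i K)) x)"
    by (simp add: lap_def partial_conv h K test_functions_partial)
  also have "\<dots> = (LINT y|lborel. (\<Sum>i\<in>UNIV. h y * partial i (partial i K) (x - y)))"
    unfolding conv_def
    by (rule Bochner_Integration.integral_sum[symmetric])
       (rule conv_integrable[OF h test_functions_partial[OF test_functions_partial[OF K]]])
  finally show "lap (conv h K) x = conv h (lap K) x"
    by (simp add: conv_def lap_def sum_distrib_left)
qed

lemma smooth_reflect:
  assumes "smooth (K :: 'n::finite fn)"
  shows "smooth (\<lambda>y. K (x - y))" "partial i (\<lambda>y. K (x - y)) = (\<lambda>y. - partial i K (x - y))"
proof -
  have D: "((\<lambda>y. K (x - y)) has_derivative (\<lambda>v. \<Sum>i\<in>UNIV. v $ i * (- partial i K (x - y)))) (at y)"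
    if "smooth K" for K :: "'n fn" and y
  proof -
    have "((\<lambda>y. x - y) has_derivative (\<lambda>v. - v)) (at y)" by (auto intro!: derivative_eq_intros)
    from has_derivative_compose[OF this has_derivative_partial[OF smooth_differentiable[OF that]]]
    show ?thesis by simp
  qed
  \<comment> \<open>The scalar \<open>c\<close> absorbs the sign picked up with each derivative,
    which keeps the induction hypothesis applicable.\<close>
  have C: "Ck_on k UNIV (\<lambda>y. c * K (x - y))" if "smooth K" for k c and K :: "'n fn"
    using that
  proof (induction k arbitrary: c K)
    case 0
    have "isCont (\<lambda>y. K (x - y)) y" for y
      using D[OF 0] by (rule has_derivative_continuous)
    then show ?case by (auto intro!: continuous_at_imp_continuous_on continuous_intros)
  next
    case (Suc k)
    have "((\<lambda>y. c * K (x - y)) has_derivative (\<lambda>v. \<Sum>i\<in>UNIV. v $ i * ((- c) * partial i K (x - y)))) (at y)" for y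
      using has_derivative_mult_right[OF D[OF Suc.prems], of c y]
      by (simp add: sum_distrib_left mult_ac sum_negf)
    then show ?case
      by (rule Ck_on_if_partials(1)) (rule Suc.IH[OF smooth_partial[OF Suc.prems]])
  qed
  show "smooth (\<lambda>y. K (x - y))" using C[OF assms, of _ 1] by simp
  show "partial i (\<lambda>y. K (x - y)) = (\<lambda>y. - partial i K (x - y))"
    using Ck_on_if_partials(2)[OF D[OF assms], where k=0 and i=i] C[OF smooth_partial[OF assms], of 0 "-1"]
    by simp
qed

lemma lap_reflect:
  assumes "smooth (K :: 'n::finite fn)"
  shows "lap (\<lambda>y. K (x - y)) = (\<lambda>y. lap K (x - y))"
proof -
  have "partial i (\<lambda>y. - partial i K (x - y)) = (\<lambda>y. partial i (partial i K) (x - y))" for i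
    using partial_cmult[OF smooth_reflect(1)[OF smooth_partial[OF assms]], where c="-1" and i=i]
      smooth_reflect(2)[OF smooth_partial[OF assms], where i=i and x=x] by simp
  then show ?thesis by (simp add: lap_def[abs_def] smooth_reflect(2)[OF assms])
qed

section \<open>Mollifiers of varying radius\<close>

lemma integral_parameter_derivative:
  fixes f f' :: "real \<Rightarrow> 'a \<Rightarrow> real"
  assumes r0: "a < r0" "r0 < b"
    and d: "\<And>r y. a < r \<Longrightarrow> r < b \<Longrightarrow> ((\<lambda>r. f r y) has_real_derivative f' r y) (at r)"
    and bd: "\<And>r y. a < r \<Longrightarrow> r < b \<Longrightarrow> \<bar>f' r y\<bar> \<le> g y"
    and int: "\<And>r. a < r \<Longrightarrow> r < b \<Longrightarrow> integrable M (f r)" and g: "integrable M g"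
    and meas: "f' r0 \<in> borel_measurable M"
  shows "((\<lambda>r. LINT y|M. f r y) has_real_derivative (LINT y|M. f' r0 y)) (at r0)"
proof -
  have "((\<lambda>r. LINT y|M. f r y) has_real_derivative (LINT y|M. f' r0 y)) (at r0 within {a<..<b})"
    unfolding has_field_derivative_iff tendsto_at_iff_sequentially comp_def
  proof (intro allI impI)
    fix X :: "nat \<Rightarrow> real"
    assume "\<forall>i. X i \<in> {a<..<b} - {r0}" and lim: "X \<longlonglongrightarrow> r0"
    then have X: "a < X i" "X i < b" "X i \<noteq> r0" for i by auto
    have "(LINT y|M. (f (X i) y - f r0 y) / (X i - r0)) = ((LINT y|M. f (X i) y) - (LINT y|M. f r0 y)) / (X i - r0)" for i
      using int[OF X(1,2)] int[OF r0] by simp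
    moreover have "(\<lambda>i. LINT y|M. (f (X i) y - f r0 y) / (X i - r0)) \<longlonglongrightarrow> (LINT y|M. f' r0 y)"
    proof (rule integral_dominated_convergence[OF meas _ g])
      show "(\<lambda>y. (f (X i) y - f r0 y) / (X i - r0)) \<in> borel_measurable M" for i
        using borel_measurable_integrable[OF int[OF X(1,2)]] borel_measurable_integrable[OF int[OF r0]]
        by measurable
      show "AE y in M. (\<lambda>i. (f (X i) y - f r0 y) / (X i - r0)) \<longlonglongrightarrow> f' r0 y"
      proof (rule AE_I2)
        fix y
        have "((\<lambda>r. f r y) has_real_derivative f' r0 y) (at r0)" using d r0 by blast
        then show "(\<lambda>i. (f (X i) y - f r0 y) / (X i - r0)) \<longlonglongrightarrow> f' r0 y"
          using X(3) lim unfolding has_field_derivative_iff tendsto_at_iff_sequentially comp_def by auto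
      qed
      show "AE y in M. norm ((f (X i) y - f r0 y) / (X i - r0)) \<le> g y" for i
      proof (rule AE_I2)
        fix y
        \<comment> \<open>The mean value inequality on the interval bounds every difference quotient
          by \<open>g y\<close>, which thereby serves as the dominating function.\<close>
        have "norm (f (X i) y - f r0 y) \<le> g y * norm (X i - r0)"
          by (rule field_differentiable_bound[of "{a<..<b}" "\<lambda>r. f r y" "\<lambda>r. f' r y"])
             (use X r0 d bd in \<open>auto intro: has_field_derivative_at_within\<close>)
        then show "norm ((f (X i) y - f r0 y) / (X i - r0)) \<le> g y"
          using X(3)[of i] by (simp add: divide_le_eq)
      qed
    qed
    ultimately show "(\<lambda>i. ((LINT y|M. f (X i) y) - (LINT y|M. f r0 y)) / (X i - r0)) \<longlonglongrightarrow> (LINT y|M. f' r0 y)"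
      by (simp only:)
  qed
  moreover have "at r0 within {a<..<b} = at r0" using r0 by (intro at_within_open) auto
  ultimately show ?thesis by (simp only:)
qed

text \<open>With \<open>r = 1/\<epsilon>\<close> this is a mollifier of radius \<open>\<epsilon>\<close>.  It is chosen such that its
  r-derivative is a multiple of the Laplacian of \<open>cutoff 0 r\<close>, so that mollifications of weakly
  harmonic functions do not depend on the radius.\<close>

definition cutoff :: "nat \<Rightarrow> real \<Rightarrow> real^'n::finite \<Rightarrow> 'n fn" where
  "cutoff j r c z = bump j (1 - r\<^sup>2 * (norm (z - c))\<^sup>2)"

definition moll :: "real \<Rightarrow> 'n::finite fn" where
  "moll r z = r ^ CARD('n) * cutoff 1 r 0 z"

lemma smooth_cutoff: "smooth (cutoff j r c)"
  unfolding cutoff_def[abs_def]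
  by (rule smooth_bump, rule smooth_diff) (auto intro: smooth_cmult[OF smooth_norm2, rule_format])

lemma cutoff_outside:
  assumes "r > 0" "z \<notin> cball c (1/r)"
  shows "cutoff j r c z = 0"
proof -
  have "1 < r * norm (z - c)"
    using assms by (simp add: dist_norm norm_minus_commute field_simps)
  then have "1 < (r * norm (z - c))\<^sup>2" by (simp add: one_less_power)
  then show ?thesis by (simp add: cutoff_def power_mult_distrib)
qed

lemma cutoff_test:
  assumes "r > 0" "cball c (1/r) \<subseteq> S"
  shows "cutoff j r c \<in> test_functions S"
  by (rule test_functionsI[OF smooth_cutoff compact_cball assms(2)]) (rule cutoff_outside[OF assms(1)])

lemma moll_test: "r > 0 \<Longrightarrow> moll r \<in> test_functions UNIV"
  unfolding moll_def[abs_def] by (intro test_functions_cmult cutoff_test) auto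

lemma partial_cutoff:
  fixes c :: "real^'n::finite"
  shows "partial i (cutoff j r c) = (\<lambda>z. - (2 * r\<^sup>2) * ((z $ i - c $ i) * cutoff (Suc j) r c z))"
proof
  fix z :: "real^'n"
  have s: "smooth (\<lambda>z. r\<^sup>2 * (norm (z - c))\<^sup>2)" by (rule smooth_cmult[OF smooth_norm2])
  then have s1: "smooth (\<lambda>z. 1 - r\<^sup>2 * (norm (z - c))\<^sup>2)" by (intro smooth_diff) auto
  have "partial i (\<lambda>z. 1 - r\<^sup>2 * (norm (z - c))\<^sup>2) = (\<lambda>z. - (r\<^sup>2 * (2 * (z $ i - c $ i))))"
    using partial_diff[of "\<lambda>_. 1" "\<lambda>z. r\<^sup>2 * (norm (z - c))\<^sup>2" i] s
      partial_cmult[OF smooth_norm2, of i "r\<^sup>2" c] by (simp add: partial_norm2)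
  then show "partial i (cutoff j r c) z = - (2 * r\<^sup>2) * ((z $ i - c $ i) * cutoff (Suc j) r c z)"
    unfolding cutoff_def[abs_def]
    using partial_compose[OF bump_deriv smooth_differentiable[OF s1], where i=i and x=z] by simp
qed

text \<open>Radial chain rule: a profile \<open>F\<close> evaluated at
  \<open>1 - r\<^sup>2 * (norm (z - c))\<^sup>2\<close> has the second-derivative term with factor
  \<open>4 * r^4 * (norm (z - c))\<^sup>2\<close> and the first-derivative term with factor
  \<open>- 2 * CARD('n) * r\<^sup>2\<close>.\<close>

lemma lap_cutoff:
  fixes c :: "real^'n::finite"
  shows "lap (cutoff 0 r c) z = 4 * r^4 * (norm (z - c))\<^sup>2 * cutoff 2 r c z - 2 * real CARD('n) * r\<^sup>2 * cutoff 1 r c z"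
proof -
  have s: "smooth (\<lambda>z. z $ i - c $ i)" for i by (rule smooth_diff[OF smooth_coord]) simp
  have ps: "partial i (\<lambda>z. z $ i - c $ i) = (\<lambda>z. 1)" for i
    using partial_diff[OF smooth_coord, of "\<lambda>_. c $ i" i i] by (simp add: partial_coord)
  have "partial i (partial i (cutoff 0 r c)) z
      = 4 * r^4 * (z $ i - c $ i)\<^sup>2 * cutoff 2 r c z - 2 * r\<^sup>2 * cutoff 1 r c z" for i
  proof -
    have "partial i (\<lambda>z. (z $ i - c $ i) * cutoff 1 r c z) z
        = (z $ i - c $ i) * partial i (cutoff 1 r c) z + cutoff 1 r c z"
      using partial_mult[OF smooth_differentiable[OF s] smooth_differentiable[OF smooth_cutoff], where x=z and i=i]
      by (simp add: ps)
    moreover have "partial i (partial i (cutoff 0 r c)) = (\<lambda>z. - (2 * r\<^sup>2) * partial i (\<lambda>z. (z $ i - c $ i) * cutoff 1 r c z) z)"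
      unfolding partial_cutoff[of i 0] One_nat_def by (rule partial_cmult[OF smooth_mult[OF s smooth_cutoff]])
    moreover have "partial i (cutoff 1 r c) z = - (2 * r\<^sup>2) * ((z $ i - c $ i) * cutoff 2 r c z)"
      by (simp only: partial_cutoff Suc_1)
    ultimately have "partial i (partial i (cutoff 0 r c)) z
        = - (2 * r\<^sup>2) * ((z $ i - c $ i) * (- (2 * r\<^sup>2) * ((z $ i - c $ i) * cutoff 2 r c z)) + cutoff 1 r c z)"
      by (simp only:)
    then show ?thesis
      by (simp add: power2_eq_square power4_eq_xxxx algebra_simps)
  qed
  then have "lap (cutoff 0 r c) z = (\<Sum>i\<in>UNIV. 4 * r^4 * (z $ i - c $ i)\<^sup>2 * cutoff 2 r c z - 2 * r\<^sup>2 * cutoff 1 r c z)"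
    by (simp add: lap_def)
  also have "\<dots> = 4 * r^4 * (\<Sum>i\<in>UNIV. (z $ i - c $ i)\<^sup>2) * cutoff 2 r c z - real CARD('n) * (2 * r\<^sup>2 * cutoff 1 r c z)"
    by (simp add: sum_subtractf sum_distrib_left sum_distrib_right)
  finally show ?thesis by (simp add: norm2_vec)
qed

text \<open>Differentiating in \<open>r\<close> produces the same two terms, in
  \<open>bump 1\<close> and \<open>bump 2\<close>, as the Laplacian of the cutoff. The profile
  \<open>bump 1\<close> and the power \<open>r ^ CARD('n)\<close> in the mollifier are what makes
  both coefficients differ by the same factor \<open>- (r ^ CARD('n) / (2 * r^3))\<close>.\<close>

lemma moll_deriv:
  fixes x y :: "real^'n::finite"
  assumes r: "r > 0"
  shows "((\<lambda>r. moll r (x - y)) has_real_derivative (- (r ^ CARD('n) / (2 * r^3))) * lap (cutoff 0 r x) y) (at r)"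
proof -
  let ?n = "CARD('n)" and ?q = "(norm (y - x))\<^sup>2"
  have m: "moll r (x - y) = r ^ ?n * bump 1 (1 - r\<^sup>2 * ?q)" for r
    by (simp add: moll_def cutoff_def norm_minus_commute)
  have d1: "((\<lambda>r. bump 1 (1 - r\<^sup>2 * ?q)) has_real_derivative bump 2 (1 - r\<^sup>2 * ?q) * (- (2 * r * ?q))) (at r)"
  proof -
    have "((\<lambda>r. 1 - r\<^sup>2 * ?q) has_real_derivative - (2 * r * ?q)) (at r)"
      by (auto intro!: derivative_eq_intros)
    from DERIV_chain2[OF bump_deriv[of 1] this] show ?thesis by (simp only: Suc_1)
  qed
  have "((\<lambda>r. r ^ ?n * bump 1 (1 - r\<^sup>2 * ?q)) has_real_derivative
      real ?n * r ^ (?n - 1) * bump 1 (1 - r\<^sup>2 * ?q) + bump 2 (1 - r\<^sup>2 * ?q) * (- (2 * r * ?q)) * r ^ ?n) (at r)"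
    by (rule DERIV_cong[OF DERIV_mult[OF DERIV_pow d1]]) simp
  moreover have "real ?n * r ^ (?n - 1) * bump 1 (1 - r\<^sup>2 * ?q) + bump 2 (1 - r\<^sup>2 * ?q) * (- (2 * r * ?q)) * r ^ ?n
      = (- (r ^ ?n / (2 * r^3))) * lap (cutoff 0 r x) y"
  proof -
    have "r ^ ?n = r * r ^ (?n - 1)" by (metis power_minus_mult zero_less_card_finite mult.commute)
    then show ?thesis
      unfolding lap_cutoff cutoff_def using r
      by (simp add: field_simps power2_eq_square power3_eq_cube power4_eq_xxxx)
  qed
  ultimately show ?thesis by (simp add: m)
qed

text \<open>\<open>r\<^sup>2 * (norm (z - c))\<^sup>2\<close> reaches 1 only where the cutoff
  vanishes, so this factor is harmless and the Laplacian has size \<open>r\<^sup>2\<close> uniformly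
  in the centre. This supplies the domination for differentiating in \<open>r\<close>.\<close>

lemma lap_cutoff_bounded:
  obtains M where "M \<ge> 0"
    "\<And>r c z. r > 0 \<Longrightarrow> \<bar>lap (cutoff 0 r c) (z::real^'n::finite)\<bar> \<le> M * r\<^sup>2"
proof -
  obtain M1 where M1: "M1 \<ge> 0" "\<forall>t\<le>1. \<bar>bump 1 t\<bar> \<le> M1" using bump_bounded by blast
  obtain M2 where M2: "M2 \<ge> 0" "\<forall>t\<le>1. \<bar>bump 2 t\<bar> \<le> M2" using bump_bounded by blast
  have "\<bar>lap (cutoff 0 r c) z\<bar> \<le> (4 * M2 + 2 * real CARD('n) * M1) * r\<^sup>2" if "r > 0" for r and c z :: "real^'n"
  proof -
    let ?p = "r\<^sup>2 * (norm (z - c))\<^sup>2"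
    have 1: "\<bar>cutoff 1 r c z\<bar> \<le> M1" unfolding cutoff_def by (rule M1(2)[rule_format]) simp
    have 2: "?p * \<bar>cutoff 2 r c z\<bar> \<le> M2"
    proof (cases "?p < 1")
      case True
      have "?p * \<bar>cutoff 2 r c z\<bar> \<le> 1 * M2"
        using True M2 by (intro mult_mono) (auto simp: cutoff_def)
      then show ?thesis by simp
    qed (use M2 in \<open>simp add: cutoff_def\<close>)
    have "lap (cutoff 0 r c) z = 4 * r\<^sup>2 * (?p * cutoff 2 r c z) - 2 * real CARD('n) * r\<^sup>2 * cutoff 1 r c z"
      by (simp add: lap_cutoff power4_eq_xxxx power2_eq_square)
    also have "\<bar>\<dots>\<bar> \<le> \<bar>4 * r\<^sup>2 * (?p * cutoff 2 r c z)\<bar> + \<bar>2 * real CARD('n) * r\<^sup>2 * cutoff 1 r c z\<bar>"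
      by (rule abs_triangle_ineq4)
    also have "\<dots> = 4 * r\<^sup>2 * (?p * \<bar>cutoff 2 r c z\<bar>) + 2 * real CARD('n) * r\<^sup>2 * \<bar>cutoff 1 r c z\<bar>"
      by (simp add: abs_mult)
    also have "\<dots> \<le> 4 * r\<^sup>2 * M2 + 2 * real CARD('n) * r\<^sup>2 * M1"
      using 1 2 by (intro add_mono mult_left_mono) auto
    finally show ?thesis by (simp add: algebra_simps)
  qed
  then show ?thesis using M1(1) M2(1) by (intro that[of "4 * M2 + 2 * real CARD('n) * M1"]) auto
qed

lemma conv_moll_derivative:
  fixes h :: "'n::finite fn"
  assumes h: "integrable lborel h" and r: "r > 0"
  shows "((\<lambda>r. conv h (moll r) x) has_real_derivative
     - (r ^ CARD('n) / (2 * r^3)) * (LINT y|lborel. h y * lap (cutoff 0 r x) y)) (at r)"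
proof -
  obtain M where M: "M \<ge> 0" "\<And>r c z. r > 0 \<Longrightarrow> \<bar>lap (cutoff 0 r c) (z::real^'n)\<bar> \<le> M * r\<^sup>2"
    using lap_cutoff_bounded by blast
  let ?k = "\<lambda>r. - (r ^ CARD('n) / (2 * r^3)) :: real"
  \<comment> \<open>For \<open>r/2 < s < 2*r\<close> the numerators are largest at
    \<open>2*r\<close> and the denominator is smallest at \<open>r/2\<close>.\<close>
  let ?B = "(2*r) ^ CARD('n) / (2 * (r/2)^3) * (M * (2*r)\<^sup>2)"
  have "((\<lambda>r. LINT y|lborel. h y * moll r (x - y)) has_real_derivative
     (LINT y|lborel. h y * (?k r * lap (cutoff 0 r x) y))) (at r)"
  proof (rule integral_parameter_derivative[where a="r/2" and b="2*r" and g="\<lambda>y. \<bar>h y\<bar> * ?B"])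
    show "integrable lborel (\<lambda>y. h y * moll s (x - y))" if "r/2 < s" for s
      using r that by (intro conv_integrable[OF h] moll_test) auto
    show "integrable lborel (\<lambda>y. \<bar>h y\<bar> * ?B)" using h by simp
    have "lap (cutoff 0 r x) \<in> borel_measurable borel"
      using smooth_borel[OF test_functions_smooth[OF lap_test[OF cutoff_test[OF r subset_UNIV]]]] .
    then show "(\<lambda>y. h y * (?k r * lap (cutoff 0 r x) y)) \<in> borel_measurable lborel"
      using h by measurable
    fix s y assume s: "r/2 < s" "s < 2*r"
    then have s0: "s > 0" using r by simp
    show "((\<lambda>r. h y * moll r (x - y)) has_real_derivative h y * (?k s * lap (cutoff 0 s x) y)) (at s)"
      using DERIV_cmult[OF moll_deriv[OF s0]] .
    have "\<bar>?k s * lap (cutoff 0 s x) y\<bar> \<le> s ^ CARD('n) / (2 * s^3) * (M * s\<^sup>2)"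
      using M(2)[OF s0, of x y] s0 by (simp add: abs_mult mult_left_mono divide_right_mono)
    also have "\<dots> \<le> ?B"
      using s s0 r M(1) by (intro mult_mono frac_le power_mono) auto
    finally show "\<bar>h y * (?k s * lap (cutoff 0 s x) y)\<bar> \<le> \<bar>h y\<bar> * ?B"
      unfolding abs_mult[of "h y"] by (rule mult_left_mono) simp
  qed (use r in auto)
  then show ?thesis by (simp add: conv_def mult.left_commute[of "h _"])
qed

text \<open>A mollified mean value property: the derivative in the radius parameter vanishes on
  \<open>{r0..}\<close>. Larger parameters mean smaller supports, so \<open>r0\<close> stands for
  the largest radius considered.\<close>

lemma conv_moll_const:
  fixes h :: "'n::finite fn"
  assumes h: "integrable lborel h" and "0 < r0" "r0 \<le> r"
    and 0: "\<And>r. r \<ge> r0 \<Longrightarrow> (LINT y|lborel. h y * lap (cutoff 0 r x) y) = 0"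
  shows "conv h (moll r) x = conv h (moll r0) x"
proof -
  have "\<exists>c. \<forall>r\<in>{r0..}. conv h (moll r) x = c"
  proof (rule has_field_derivative_zero_constant)
    fix r assume r: "r \<in> {r0..}"
    show "((\<lambda>r. conv h (moll r) x) has_real_derivative 0) (at r within {r0..})"
      using conv_moll_derivative[OF h, of r x] 0[of r] r assms(2)
      by (auto intro: has_field_derivative_at_within)
  qed simp
  then show ?thesis using assms(3) by (metis atLeast_iff order_refl)
qed

section \<open>Mass and weak convergence of the mollifiers\<close>

lemma moll_nonneg: "r > 0 \<Longrightarrow> moll r z \<ge> 0"
  by (simp add: moll_def cutoff_def bump_1_nonneg)

lemma moll_integrable: "r > 0 \<Longrightarrow> integrable lborel (moll r)"
  using test_functions_lborel_integrable[OF moll_test] .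

text \<open>The mollifier is left unnormalized; its mass is divided out once, when the harmonic
  representative is defined. The type argument supplies the dimension.\<close>

definition moll_mass :: "'n::finite itself \<Rightarrow> real" where
  "moll_mass _ = (LINT z|lborel. (moll 1 (z :: real^'n)))"

lemma lborel_integral_reflect:
  fixes f :: "'n::finite fn"
  assumes "f \<in> borel_measurable borel"
  shows "(LINT y|lborel. f (x - y)) = (LINT y|lborel. f y)"
    and "integrable lborel (\<lambda>y. f (x - y)) \<longleftrightarrow> integrable lborel f"
proof -
  have d: "distr lborel borel (\<lambda>y. x + (-1) *\<^sub>R y) = (lborel :: (real^'n) measure)"
    using lborel_affine[of "-1" x] by (simp add: density_1)
  have "(LINT y|lborel. f y) = (LINT y|distr lborel borel (\<lambda>y. x + (-1) *\<^sub>R y). f y)" by (simp only: d)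
  also have "\<dots> = (LINT y|lborel. f (x + (-1) *\<^sub>R y))" using assms by (subst integral_distr) auto
  finally show "(LINT y|lborel. f (x - y)) = (LINT y|lborel. f y)" by simp
  have "integrable (distr lborel borel (\<lambda>y. x + (-1) *\<^sub>R y)) f \<longleftrightarrow> integrable lborel (\<lambda>y. f (x + (-1) *\<^sub>R y))"
    using assms by (subst integrable_distr_eq) auto
  then show "integrable lborel (\<lambda>y. f (x - y)) \<longleftrightarrow> integrable lborel f" unfolding d by simp
qed

text \<open>On the support of \<^term>\<open>moll r\<close>, \<open>r \<ge> 1\<close>, the indicator function of the unit ball is
  indistinguishable from the (non-integrable) harmonic function 1.\<close>

lemma moll_integral:
  assumes r: "r \<ge> 1"
  shows "(LINT z|lborel. moll r (z :: real^'n::finite)) = moll_mass TYPE('n)"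
proof -
  let ?h = "indicator (cball 0 1) :: real^'n \<Rightarrow> real"
  have h: "integrable lborel ?h"
    using emeasure_lborel_cball_finite[of "0::real^'n" 1] by (intro integrable_real_indicator) auto
  have sub: "cball (0::real^'n) (1/s) \<subseteq> cball 0 1" if "s \<ge> 1" for s
    using that by (intro subset_cball) simp
  have eq: "conv ?h (moll s) 0 = (LINT z|lborel. moll s (z :: real^'n))" if s: "s \<ge> 1" for s
  proof -
    have "?h y * moll s (0 - y) = moll s (0 - y)" for y
    proof (cases "y \<in> cball 0 1")
      case False
      then have "0 - y \<notin> cball 0 (1/s)" using sub[OF s] by auto
      from cutoff_outside[OF _ this] s show ?thesis by (simp add: moll_def)
    qed simp
    then have "conv ?h (moll s) 0 = (LINT y|lborel. moll s (0 - y :: real^'n))" by (simp only: conv_def)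
    also have "\<dots> = (LINT z|lborel. moll s (z :: real^'n))"
      using s by (intro lborel_integral_reflect smooth_borel test_functions_smooth[OF moll_test]) auto
    finally show ?thesis .
  qed
  have "conv ?h (moll r) 0 = conv ?h (moll 1) 0"
  proof (rule conv_moll_const[OF h _ r])
    fix s :: real assume s: "s \<ge> 1"
    have t: "cutoff 0 s 0 \<in> test_functions (cball (0::real^'n) 1)"
      using s sub[OF s] by (intro cutoff_test) auto
    have "?h y * lap (cutoff 0 s 0) y = lap (cutoff 0 s 0) y" for y
      using test_functions_0_outside[OF lap_test[OF t], of y] by (auto simp: indicator_def)
    then have "(LINT y|lborel. ?h y * lap (cutoff 0 s 0) y) = (LINT y|lborel. lap (cutoff 0 s 0) (y::real^'n))" by (simp only:)
    also have "\<dots> = (\<Sum>i\<in>UNIV. (LINT y|lborel. partial i (partial i (cutoff 0 s 0)) (y::real^'n)))"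
      unfolding lap_def
      by (intro Bochner_Integration.integral_sum test_functions_lborel_integrable[OF test_functions_partial[OF test_functions_partial[OF t]]])
    also have "\<dots> = 0" by (simp add: integral_partial_lborel[OF test_functions_partial[OF t]])
    finally show "(LINT y|lborel. ?h y * lap (cutoff 0 s 0) y) = 0" .
  qed simp
  then show ?thesis using eq[OF r] eq[of 1] by (simp add: moll_mass_def)
qed

text \<open>A nonnegative function with integral 0 vanishes almost everywhere, but
  \<open>moll 1\<close> is strictly positive on the open unit ball, which is not negligible.\<close>

lemma moll_mass_pos: "moll_mass TYPE('n::finite) > 0"
proof -
  have i: "integrable lborel (moll 1 :: real^'n \<Rightarrow> real)" by (rule moll_integrable) simp
  have "moll_mass TYPE('n) \<ge> 0"
    unfolding moll_mass_def by (rule integral_nonneg_AE) (simp add: moll_nonneg)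
  moreover have "moll_mass TYPE('n) \<noteq> 0"
  proof
    assume "moll_mass TYPE('n) = 0"
    then have "AE z in lborel. moll 1 (z::real^'n) = 0"
      using integral_nonneg_eq_0_iff_AE[OF i] by (simp add: moll_mass_def moll_nonneg)
    then have "AE z in lborel. z \<notin> ball (0::real^'n) 1"
    proof eventually_elim
      case (elim z)
      show ?case
      proof
        assume "z \<in> ball 0 1"
        then have "(norm z)\<^sup>2 < 1" by (simp add: abs_square_less_1)
        then have "bump (Suc 0) (1 - (norm z)\<^sup>2) > 0" by (simp add: bump_1)
        then show False using elim by (simp add: moll_def cutoff_def)
      qed
    qed
    then have "AE z in lebesgue. z \<notin> ball (0::real^'n) 1" by (rule AE_completion)
    then have "negligible (ball (0::real^'n) 1)"
      by (simp add: negligible_iff_null_sets AE_iff_null_sets)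
    then show False using open_not_negligible[of "ball (0::real^'n) 1"] by simp
  qed
  ultimately show ?thesis by simp
qed

text \<open>Mollifications tested against a test function: Fubini moves the mollifier to the test
  function, where convergence is uniform.\<close>

lemma conv_moll_weak:
  fixes h :: "'n::finite fn"
  assumes h: "integrable lborel h" and \<phi>: "\<phi> \<in> test_functions UNIV"
  obtains L where "L \<ge> 0"
    "\<And>r. r \<ge> 1 \<Longrightarrow> \<bar>(LINT x|lborel. conv h (moll r) x * \<phi> x) - moll_mass TYPE('n) * (LINT y|lborel. h y * \<phi> y)\<bar> \<le> L / r"
proof -
  obtain L where L: "L \<ge> 0" "\<And>x y. \<bar>\<phi> x - \<phi> y\<bar> \<le> L * norm (x - y)" using test_functions_lipschitz[OF \<phi>] by blast
  obtain M where M: "M \<ge> 0" "\<And>x. \<bar>\<phi> x\<bar> \<le> M" using test_functions_bounded[OF \<phi>] by blast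
  let ?c = "moll_mass TYPE('n)"
  have [measurable]: "\<phi> \<in> borel_measurable borel" using smooth_borel[OF test_functions_smooth[OF \<phi>]] .
  have \<phi>i: "integrable lborel \<phi>" by (rule test_functions_lborel_integrable[OF \<phi>])
  have [measurable]: "h \<in> borel_measurable borel" using borel_measurable_integrable[OF h] by simp
  have "\<bar>(LINT x|lborel. conv h (moll r) x * \<phi> x) - ?c * (LINT y|lborel. h y * \<phi> y)\<bar>
      \<le> (L * ?c * (LINT y|lborel. \<bar>h y\<bar>)) / r" if r: "r \<ge> 1" for r
  proof -
    let ?k = "moll r :: real^'n \<Rightarrow> real"
    have r0: "r > 0" using r by simp
    have k: "?k \<in> test_functions UNIV" using moll_test[OF r0] .
    obtain N where N: "N \<ge> 0" "\<And>x. \<bar>?k x\<bar> \<le> N" using test_functions_bounded[OF k] by blast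
    have [measurable]: "?k \<in> borel_measurable borel" using smooth_borel[OF test_functions_smooth[OF k]] .
    have hk: "integrable lborel (\<lambda>y. h y * ?k (x - y))" for x by (rule conv_integrable[OF h k])
    define F where "F x y = h y * ?k (x - y) * \<phi> x" for x y
    have Fm: "(\<lambda>(x, y). F x y) \<in> borel_measurable (lborel \<Otimes>\<^sub>M lborel)"
      unfolding F_def by measurable
    have Fi: "integrable lborel (\<lambda>y. F x y)" for x unfolding F_def using hk[of x] by simp
    \<comment> \<open>Bounding the mollifier by \<open>N\<close> leaves the L1 norm of
      \<open>h\<close> times \<open>N * \<bar>\<phi> x\<bar>\<close> for the inner integral, which
      is integrable in \<open>x\<close>.\<close>
    have FF: "integrable (lborel \<Otimes>\<^sub>M lborel) (\<lambda>(x, y). F x y)"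
    proof (rule lborel_pair.Fubini_integrable[OF Fm])
      show "AE x in lborel. integrable lborel (\<lambda>y. case (x, y) of (x, y) \<Rightarrow> F x y)" using Fi by simp
      show "integrable lborel (\<lambda>x. LINT y|lborel. norm (case (x, y) of (x, y) \<Rightarrow> F x y))"
      proof (rule Bochner_Integration.integrable_bound)
        show "integrable lborel (\<lambda>x. (N * (LINT y|lborel. \<bar>h y\<bar>)) * \<phi> x)" using \<phi>i by simp
        show "(\<lambda>x. LINT y|lborel. norm (case (x, y) of (x, y) \<Rightarrow> F x y)) \<in> borel_measurable lborel"
          using Fm by measurable
        show "AE x in lborel. norm (LINT y|lborel. norm (case (x, y) of (x, y) \<Rightarrow> F x y)) \<le> norm ((N * (LINT y|lborel. \<bar>h y\<bar>)) * \<phi> x)"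
        proof (rule AE_I2)
          fix x
          have "(LINT y|lborel. \<bar>F x y\<bar>) \<le> (LINT y|lborel. \<bar>h y\<bar> * (N * \<bar>\<phi> x\<bar>))"
          proof (rule integral_mono)
            show "integrable lborel (\<lambda>y. \<bar>F x y\<bar>)" using Fi by simp
            show "integrable lborel (\<lambda>y. \<bar>h y\<bar> * (N * \<bar>\<phi> x\<bar>))" using h by simp
            show "\<bar>F x y\<bar> \<le> \<bar>h y\<bar> * (N * \<bar>\<phi> x\<bar>)" for y
              unfolding F_def abs_mult mult.assoc using N by (intro mult_left_mono mult_right_mono) auto
          qed
          then show "norm (LINT y|lborel. norm (case (x, y) of (x, y) \<Rightarrow> F x y)) \<le> norm ((N * (LINT y|lborel. \<bar>h y\<bar>)) * \<phi> x)"
            using N(1) by (simp add: abs_mult mult_ac)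
        qed
      qed
    qed
    have "(LINT x|lborel. conv h ?k x * \<phi> x) = (LINT x|lborel. (LINT y|lborel. F x y))"
      by (simp add: conv_def F_def)
    also have "\<dots> = (LINT y|lborel. (LINT x|lborel. F x y))"
      using lborel_pair.Fubini_integral[of F] FF by simp
    also have "\<dots> = (LINT y|lborel. h y * (LINT x|lborel. ?k (x - y) * \<phi> x))"
      by (simp add: F_def mult.assoc)
    finally have eq: "(LINT x|lborel. conv h ?k x * \<phi> x) = \<dots>" .
    have ki: "integrable lborel (\<lambda>x. ?k (x - y))" for y
      using integral_lborel_translate(2)[of ?k "-y"] moll_integrable[OF r0] by simp
    have kint: "(LINT x|lborel. ?k (x - y)) = ?c" for y
      using integral_lborel_translate(1)[of ?k "-y"] moll_integral[OF r] by simp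
    have k\<phi>: "integrable lborel (\<lambda>x. ?k (x - y) * \<phi> x)" for y
      by (rule integrable_mult_bounded[OF ki _ M(2)]) simp
    \<comment> \<open>\<open>?k\<close> has mass \<open>?c\<close> and support radius
      \<open>1/r\<close>, across which \<open>\<phi>\<close> varies by at most
      \<open>L / r\<close>.\<close>
    have close: "\<bar>(LINT x|lborel. ?k (x - y) * \<phi> x) - ?c * \<phi> y\<bar> \<le> L / r * ?c" for y
    proof -
      have "(LINT x|lborel. ?k (x - y) * \<phi> x) - ?c * \<phi> y = (LINT x|lborel. ?k (x - y) * \<phi> x - ?k (x - y) * \<phi> y)"
        using k\<phi> ki by (simp add: kint)
      also have "\<bar>\<dots>\<bar> \<le> (LINT x|lborel. ?k (x - y) * (L / r))"
      proof (rule integral_abs_bound_integral)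
        show "integrable lborel (\<lambda>x. ?k (x - y) * \<phi> x - ?k (x - y) * \<phi> y)" using k\<phi> ki by simp
        show "integrable lborel (\<lambda>x. ?k (x - y) * (L / r))" using ki by simp
        fix x
        show "\<bar>?k (x - y) * \<phi> x - ?k (x - y) * \<phi> y\<bar> \<le> ?k (x - y) * (L / r)"
        proof (cases "x - y \<in> cball 0 (1/r)")
          case True
          have "\<bar>\<phi> x - \<phi> y\<bar> \<le> L * norm (x - y)" by (rule L(2))
          also have "\<dots> \<le> L * (1/r)" using True L(1) by (intro mult_left_mono) auto
          finally have "?k (x - y) * \<bar>\<phi> x - \<phi> y\<bar> \<le> ?k (x - y) * (L / r)"
            using moll_nonneg[OF r0] by (intro mult_left_mono) auto
          then show ?thesis
            using moll_nonneg[OF r0, of "x - y"] by (simp add: right_diff_distrib[symmetric] abs_mult)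
        next
          case False
          then show ?thesis using cutoff_outside[OF r0 False] by (simp add: moll_def)
        qed
      qed
      also have "\<dots> = L / r * ?c" using kint[of y] by simp
      finally show ?thesis .
    qed
    have m1: "(\<lambda>y. LINT x|lborel. ?k (x - y) * \<phi> x) \<in> borel_measurable borel" by measurable
    have h1: "integrable lborel (\<lambda>y. h y * \<phi> y)"
      by (rule integrable_mult_bounded[OF h _ M(2)]) simp
    have h3: "integrable lborel (\<lambda>y. h y * ((LINT x|lborel. ?k (x - y) * \<phi> x) - ?c * \<phi> y))"
      using m1 by (intro integrable_mult_bounded[OF h _ close]) simp
    have "(LINT x|lborel. conv h ?k x * \<phi> x) - ?c * (LINT y|lborel. h y * \<phi> y)
        = (LINT y|lborel. h y * ((LINT x|lborel. ?k (x - y) * \<phi> x) - ?c * \<phi> y))"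
    proof -
      have "(LINT y|lborel. h y * (LINT x|lborel. ?k (x - y) * \<phi> x))
          = (LINT y|lborel. h y * ((LINT x|lborel. ?k (x - y) * \<phi> x) - ?c * \<phi> y) + ?c * (h y * \<phi> y))"
        by (simp add: algebra_simps)
      also have "\<dots> = (LINT y|lborel. h y * ((LINT x|lborel. ?k (x - y) * \<phi> x) - ?c * \<phi> y)) + ?c * (LINT y|lborel. h y * \<phi> y)"
        using h3 h1 by simp
      finally show ?thesis using eq by simp
    qed
    also have "\<bar>\<dots>\<bar> \<le> (LINT y|lborel. \<bar>h y\<bar> * (L / r * ?c))"
    proof (rule integral_abs_bound_integral[OF h3])
      show "integrable lborel (\<lambda>y. \<bar>h y\<bar> * (L / r * ?c))" using h by simp
      show "\<bar>h y * ((LINT x|lborel. ?k (x - y) * \<phi> x) - ?c * \<phi> y)\<bar> \<le> \<bar>h y\<bar> * (L / r * ?c)" for y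
        unfolding abs_mult[of "h y"] using close[of y] by (intro mult_left_mono) auto
    qed
    also have "\<dots> = (L * ?c * (LINT y|lborel. \<bar>h y\<bar>)) / r" by (simp add: mult_ac)
    finally show ?thesis .
  qed
  moreover have "L * ?c * (LINT y|lborel. \<bar>h y\<bar>) \<ge> 0"
    using L(1) moll_mass_pos[where 'n='n] by simp
  ultimately show ?thesis by (intro that)
qed

text \<open>\<open>h\<close> is only Lebesgue measurable and unspecified outside \<open>S\<close>,
  whereas convolution and Fubini are stated for Borel functions on the whole space. A Borel
  modification, multiplied by the indicator of \<open>S\<close>, is fit for both.\<close>

lemma L2_borel_representative:
  fixes h :: "'n::finite fn"
  assumes S: "open S" "bounded S" and h: "h \<in> L2 S"
  obtains h0 where "integrable lborel h0" "\<And>x. x \<notin> S \<Longrightarrow> h0 x = 0" "AE x in lebesgue_on S. h0 x = h x"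
proof -
  have Sm: "S \<in> sets lebesgue" using S by auto
  have "(\<lambda>x. if x \<in> S then h x else 0) \<in> borel_measurable lebesgue"
    using L2D(1)[OF h] Sm by (simp add: borel_measurable_if)
  then obtain g where g: "g \<in> borel_measurable lborel" "AE x in lborel. (if x \<in> S then h x else 0) = g x"
    using completion_ex_borel_measurable_real[of _ lborel] by blast
  define h0 where "h0 x = indicator S x * g x" for x
  have bor: "h0 \<in> borel_measurable borel" unfolding h0_def using g(1) S(1)
    by (intro borel_measurable_times borel_measurable_indicator) auto
  have "AE x in lebesgue. (if x \<in> S then h x else 0) = g x" using AE_completion[OF g(2)] .
  then have "AE x in lebesgue. x \<in> S \<longrightarrow> h0 x = h x" by eventually_elim (auto simp: h0_def)
  then have ae: "AE x in lebesgue_on S. h0 x = h x" using Sm by (simp add: AE_restrict_space_iff)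
  have "integrable (lebesgue_on S) h0"
    using integrable_cong_AE[OF _ _ ae] L2_integrable[OF h bounded_open_lmeasurable[OF S]] L2D(1)[OF h]
      borel_imp_measurable_lebesgue_on[OF bor] by blast
  moreover have 0: "\<And>x. x \<notin> S \<Longrightarrow> h0 x = 0" by (simp add: h0_def)
  ultimately have "integrable lborel h0" using integral_lebesgue_on_eq_lborel(2)[OF bor Sm] by blast
  then show ?thesis using that 0 ae by blast
qed

text \<open>Both statements test weak harmonicity with functions supported in
  \<open>cball x (1/r)\<close>: the first with the cutoffs of all smaller radii, the second with the
  mollifier \<open>moll r (x - y)\<close> itself as a function of \<open>y\<close>.\<close>

lemma harmonic_from_mollification:
  fixes h :: "'n::finite fn"
  assumes h: "integrable lborel h"
    and 0: "\<And>\<phi>. \<phi> \<in> test_functions S \<Longrightarrow> (LINT y|lborel. h y * lap \<phi> y) = 0"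
    and r: "r \<ge> 1" "cball x (1/r) \<subseteq> S"
  shows "\<And>s. s \<ge> r \<Longrightarrow> conv h (moll s) x = conv h (moll r) x" and "lap (conv h (moll r)) x = 0"
proof -
  have r0: "r > 0" using r by simp
  show "conv h (moll s) x = conv h (moll r) x" if "s \<ge> r" for s
  proof (rule conv_moll_const[OF h r0 that])
    fix t assume "t \<ge> r"
    then have "cball x (1/t) \<subseteq> S" using r r0 by (intro order_trans[OF subset_cball r(2)]) (auto intro: frac_le)
    then show "(LINT y|lborel. h y * lap (cutoff 0 t x) y) = 0"
      using \<open>t \<ge> r\<close> r0 by (intro 0 cutoff_test) auto
  qed
  have eq: "(\<lambda>y. moll r (x - y)) = (\<lambda>y. r ^ CARD('n) * cutoff 1 r x y)"
    by (auto simp: moll_def cutoff_def norm_minus_commute)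
  have "(\<lambda>y. moll r (x - y)) \<in> test_functions S"
    unfolding eq by (intro test_functions_cmult cutoff_test r0 r(2))
  then have "(LINT y|lborel. h y * lap (moll r) (x - y)) = 0"
    using 0 lap_reflect[OF test_functions_smooth[OF moll_test[OF r0]], of x] by metis
  then show "lap (conv h (moll r)) x = 0"
    by (simp add: lap_conv[OF h moll_test[OF r0]] conv_def)
qed

text \<open>At each point all sufficiently fine mollifications coincide. Their common value is
  smooth and harmonic, being locally one fixed convolution, and equals \<open>h\<close> almost
  everywhere because the mollifications also converge weakly to \<open>h\<close>, up to the
  mass.\<close>

lemma weyl:
  fixes h :: "'n::finite fn"
  assumes S: "open S" "bounded S" and h: "h \<in> L2 S"
    and weak: "\<And>\<phi>. \<phi> \<in> test_functions S \<Longrightarrow> l2ip S h (lap \<phi>) = 0"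
  obtains w where "harmonic_on S w" "w \<in> L2 S" "AE x in lebesgue_on S. w x = h x"
proof -
  have Sm: "S \<in> sets lebesgue" using S by auto
  obtain h0 where h0: "integrable lborel h0" "\<And>x. x \<notin> S \<Longrightarrow> h0 x = 0" "AE x in lebesgue_on S. h0 x = h x"
    using L2_borel_representative[OF S h] by blast
  have bor: "h0 \<in> borel_measurable borel" using borel_measurable_integrable[OF h0(1)] by simp
  have weak0: "(LINT y|lborel. h0 y * lap \<phi> y) = 0" if \<phi>: "\<phi> \<in> test_functions S" for \<phi>
  proof -
    have lb: "lap \<phi> \<in> borel_measurable borel" using smooth_borel[OF test_functions_smooth[OF lap_test[OF \<phi>]]] .
    have "(LINT y|lborel. h0 y * lap \<phi> y) = (LINT y|lebesgue_on S. h0 y * lap \<phi> y)"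
      using h0(2) bor lb Sm by (intro integral_lebesgue_on_eq_lborel(1)[symmetric]) auto
    also have "\<dots> = (LINT y|lebesgue_on S. h y * lap \<phi> y)"
    proof (rule integral_cong_AE)
      show "AE y in lebesgue_on S. h0 y * lap \<phi> y = h y * lap \<phi> y" using h0(3) by eventually_elim simp
    qed (use bor lb L2D(1)[OF h] borel_imp_measurable_lebesgue_on in \<open>auto intro!: borel_measurable_times\<close>)
    also have "\<dots> = 0" using weak[OF \<phi>] by (simp add: l2ip_def)
    finally show ?thesis .
  qed
  let ?c = "moll_mass TYPE('n)"
  have c: "?c > 0" by (rule moll_mass_pos)
  \<comment> \<open>The doubled radius leaves room for a closed ball of radius \<open>1/r\<close>
    around every point of \<open>ball x (1/r)\<close>, so that a single \<open>r\<close> serves a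
    whole neighbourhood.\<close>
  have radius: "\<exists>r\<ge>1. cball x (2/r) \<subseteq> S" if x: "x \<in> S" for x
  proof -
    obtain e where e: "e > 0" "cball x e \<subseteq> S" using S(1) x unfolding open_contains_cball by blast
    define R where "R = max 1 (2/e)"
    have R: "R \<ge> 1" "2/e \<le> R" by (auto simp: R_def)
    then have "2 \<le> R * e" using e(1) by (simp add: pos_divide_le_eq)
    then have "2/R \<le> e" using R(1) by (simp add: pos_divide_le_eq mult.commute)
    then have "cball x (2/R) \<subseteq> S" using e(2) subset_cball[of "2/R" e x] by blast
    then show ?thesis using R(1) by blast
  qed
  define rr where "rr x = (SOME r. r \<ge> 1 \<and> cball x (1/r) \<subseteq> S)" for x
  define w where "w x = conv h0 (moll (rr x)) x / ?c" for x
  \<comment> \<open>Every admissible \<open>r\<close> yields the same value as the chosen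
    \<open>rr x\<close>: both agree with the mollification at the larger of the two
    parameters.\<close>
  have w: "w x = conv h0 (moll r) x / ?c" if r: "r \<ge> 1" "cball x (1/r) \<subseteq> S" for r x
  proof -
    have rr: "rr x \<ge> 1 \<and> cball x (1 / rr x) \<subseteq> S"
      unfolding rr_def using r by (intro someI[of "\<lambda>r. r \<ge> 1 \<and> cball x (1/r) \<subseteq> S" r]) auto
    then have "conv h0 (moll (rr x)) x = conv h0 (moll r) x"
      using harmonic_from_mollification(1)[OF h0(1) weak0, where r="rr x" and x=x and s="max (rr x) r"]
        harmonic_from_mollification(1)[OF h0(1) weak0, where r=r and x=x and s="max (rr x) r"] r by auto
    then show ?thesis by (simp add: w_def)
  qed
  have local: "\<exists>r\<ge>1. \<forall>y\<in>ball x (1/r). cball y (1/r) \<subseteq> S" if x: "x \<in> S" for x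
  proof -
    obtain r where r: "r \<ge> 1" "cball x (2/r) \<subseteq> S" using radius[OF x] by blast
    have "cball y (1/r) \<subseteq> S" if "y \<in> ball x (1/r)" for y
    proof
      fix z assume "z \<in> cball y (1/r)"
      then have "dist x z \<le> 1/r + 1/r"
        using that dist_triangle[of x z y] by auto
      then show "z \<in> S" using r by auto
    qed
    then show ?thesis using r(1) by blast
  qed
  have smooth: "smooth (\<lambda>x. (1 / ?c) * conv h0 (moll r) x)" if "r \<ge> 1" for r
    using conv_smooth[OF h0(1) moll_test, of r] that by (intro smooth_cmult) auto
  have Ck: "Ck_on k S w" for k
  proof (rule Ck_on_local)
    fix x assume "x \<in> S"
    then obtain r where r: "r \<ge> 1" "\<forall>y\<in>ball x (1/r). cball y (1/r) \<subseteq> S" using local by blast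
    then have "\<forall>y\<in>ball x (1/r). w y = (1 / ?c) * conv h0 (moll r) y" using w[OF r(1)] by simp
    moreover have "x \<in> ball x (1/r)" using r(1) by simp
    ultimately show "\<exists>U g. open U \<and> x \<in> U \<and> Ck_on k UNIV g \<and> (\<forall>y\<in>U. w y = g y)"
      using smooth[OF r(1)] open_ball by blast
  qed
  have harm: "harmonic_on S w"
    unfolding harmonic_on_def
  proof (intro conjI ballI Ck)
    fix x assume "x \<in> S"
    then obtain r where r: "r \<ge> 1" "\<forall>y\<in>ball x (1/r). cball y (1/r) \<subseteq> S" using local by blast
    let ?g = "\<lambda>x. (1 / ?c) * conv h0 (moll r) x"
    have xU: "x \<in> ball x (1/r)" using r(1) by simp
    have e: "w y = ?g y" if "y \<in> ball x (1/r)" for y using w[OF r(1)] r(2) that by simp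
    have p: "partial i w y = partial i ?g y" if "y \<in> ball x (1/r)" for y i
      by (rule partial_cong_open[OF open_ball that]) (rule e)
    have "partial i (partial i w) x = partial i (partial i ?g) x" for i
      by (rule partial_cong_open[OF open_ball xU]) (rule p)
    then have "(\<Sum>i\<in>UNIV. partial i (partial i w) x) = lap ?g x" by (simp add: lap_def)
    also have "\<dots> = (1 / ?c) * lap (conv h0 (moll r)) x"
      using lap_cmult[OF conv_smooth[OF h0(1) moll_test], of r "1 / ?c"] r(1) by simp
    also have "\<dots> = 0"
      using harmonic_from_mollification(2)[OF h0(1) weak0 r(1)] r(2) xU by simp
    finally show "(\<Sum>i\<in>UNIV. partial i (partial i w) x) = 0" .
  qed
  have ball_ae: "AE x in lebesgue_on (ball a (1/r)). w x = h0 x"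
    if r: "r \<ge> 1" "\<forall>y\<in>ball a (1/r). cball y (1/r) \<subseteq> S" for a r
  proof -
    let ?U = "ball a (1/r)"
    let ?g = "\<lambda>x. conv h0 (moll r) x"
    have g: "continuous_on UNIV ?g"
      using smooth_continuous[OF conv_smooth[OF h0(1) moll_test]] r(1) by simp
    have gb: "?g \<in> borel_measurable borel" using g by (rule borel_measurable_continuous_onI)
    have ig: "integrable (lebesgue_on ?U) ?g"
    proof -
      have "integrable lborel (\<lambda>x. indicator (cball a (1/r)) x *\<^sub>R ?g x)"
        by (rule borel_integrable_compact[OF compact_cball continuous_on_subset[OF g subset_UNIV]])
      then have "integrable (lebesgue_on (cball a (1/r))) ?g"
        using gb by (simp add: integrable_restrict_space integrable_completion)
      then have "integrable lebesgue (\<lambda>x. indicator (cball a (1/r)) x *\<^sub>R ?g x)"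
        by (simp add: integrable_restrict_space)
      then have "set_integrable lebesgue ?U ?g"
        using set_integrable_subset[of lebesgue "cball a (1/r)" ?g ?U] by (simp add: set_integrable_def)
      then show ?thesis by (simp add: set_integrable_def integrable_restrict_space)
    qed
    have ih: "integrable (lebesgue_on ?U) h0"
    proof -
      have "integrable lebesgue h0" using h0(1) bor by (simp add: integrable_completion)
      then have "set_integrable lebesgue UNIV h0" by (simp add: set_integrable_def)
      then have "set_integrable lebesgue ?U h0" by (rule set_integrable_subset) auto
      then show ?thesis by (simp add: set_integrable_def integrable_restrict_space)
    qed
    have "AE x in lebesgue_on ?U. ?g x - ?c * h0 x = 0"
    proof (rule fundamental_lemma[OF open_ball])
      show "integrable (lebesgue_on ?U) (\<lambda>x. ?g x - ?c * h0 x)" using ig ih by simp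
      fix \<phi> assume \<phi>: "\<phi> \<in> test_functions ?U"
      then have \<phi>U: "\<phi> \<in> test_functions UNIV" by (rule test_functions_mono) simp
      have \<phi>b: "\<phi> \<in> borel_measurable borel" using smooth_borel[OF test_functions_smooth[OF \<phi>]] .
      obtain L where L: "L \<ge> 0" "\<And>s. s \<ge> 1 \<Longrightarrow> \<bar>(LINT x|lborel. conv h0 (moll s) x * \<phi> x) - ?c * (LINT y|lborel. h0 y * \<phi> y)\<bar> \<le> L / s"
        using conv_moll_weak[OF h0(1) \<phi>U] by blast
      let ?I = "(LINT x|lborel. ?g x * \<phi> x) - ?c * (LINT y|lborel. h0 y * \<phi> y)"
      \<comment> \<open>On the support of \<open>\<phi>\<close> the convolution does not depend on
        \<open>s\<close>. Hence the fixed number \<open>?I\<close> is at most \<open>L / s\<close>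
        for all large \<open>s\<close> and has to vanish.\<close>
      have "\<bar>?I\<bar> \<le> L / s" if s: "s \<ge> r" for s
      proof -
        have "conv h0 (moll s) x * \<phi> x = ?g x * \<phi> x" for x
        proof (cases "x \<in> ?U")
          case True
          then show ?thesis using harmonic_from_mollification(1)[OF h0(1) weak0 r(1) _ s] r(2) by simp
        next
          case False
          then show ?thesis using test_functions_0_outside[OF \<phi>] by simp
        qed
        then have eq: "(LINT x|lborel. conv h0 (moll s) x * \<phi> x) = (LINT x|lborel. ?g x * \<phi> x)" by (simp only:)
        have "1 \<le> s" using s r(1) by simp
        from L(2)[OF this] show ?thesis unfolding eq .
      qed
      then have "\<forall>\<^sub>F s in at_top. \<bar>?I\<bar> \<le> L / s" by (auto simp: eventually_at_top_linorder)
      moreover have "((\<lambda>s. L / s) \<longlongrightarrow> 0) at_top"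
        by (rule tendsto_divide_0[OF tendsto_const]) (simp add: filterlim_at_top_imp_at_infinity filterlim_ident)
      ultimately have "\<bar>?I\<bar> \<le> 0" by (intro tendsto_lowerbound) auto
      then have I: "(LINT x|lborel. ?g x * \<phi> x) = ?c * (LINT y|lborel. h0 y * \<phi> y)" by simp
      have "(LINT x|lebesgue_on ?U. (?g x - ?c * h0 x) * \<phi> x)
          = (LINT x|lebesgue_on ?U. ?g x * \<phi> x - ?c * (h0 x * \<phi> x))"
        by (simp add: algebra_simps)
      also have "\<dots> = (LINT x|lebesgue_on ?U. ?g x * \<phi> x) - ?c * (LINT x|lebesgue_on ?U. h0 x * \<phi> x)"
        using test_functions_integrable_mult[OF ig \<phi>] test_functions_integrable_mult[OF ih \<phi>] by simp
      also have "(LINT x|lebesgue_on ?U. ?g x * \<phi> x) = (LINT x|lborel. ?g x * \<phi> x)"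
        using gb \<phi>b test_functions_0_outside[OF \<phi>] by (intro integral_lebesgue_on_eq_lborel(1)) auto
      also have "(LINT x|lebesgue_on ?U. h0 x * \<phi> x) = (LINT x|lborel. h0 x * \<phi> x)"
        using bor \<phi>b test_functions_0_outside[OF \<phi>] by (intro integral_lebesgue_on_eq_lborel(1)) auto
      finally show "(LINT x|lebesgue_on ?U. (?g x - ?c * h0 x) * \<phi> x) = 0" using I by simp
    qed
    moreover have "AE x in lebesgue_on ?U. x \<in> ?U" by (rule AE_I2) simp
    ultimately show ?thesis
    proof eventually_elim
      case (elim x)
      then show ?case using w[OF r(1) r(2)[rule_format, OF elim(2)]] c by simp
    qed
  qed
  \<comment> \<open>Equality is known ball by ball; since negligibility is a local property, the
    uncountably many exceptional sets combine into a null set.\<close>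
  have "negligible {x \<in> S. w x \<noteq> h0 x}"
  proof (subst locally_negligible_alt, intro ballI)
    let ?N = "{x \<in> S. w x \<noteq> h0 x}"
    fix a assume a: "a \<in> ?N"
    then obtain r where r: "r \<ge> 1" "\<forall>y\<in>ball a (1/r). cball y (1/r) \<subseteq> S" using local by blast
    let ?U = "ball a (1/r)"
    have "AE x in lebesgue. x \<in> ?U \<longrightarrow> w x = h0 x"
      using ball_ae[OF r] by (simp add: AE_restrict_space_iff)
    then have "negligible {x. \<not> (x \<in> ?U \<longrightarrow> w x = h0 x)}"
      by (simp add: negligible_iff_null_sets AE_iff_null_sets completion.AE_iff_null_sets)
    then have "negligible (?N \<inter> ?U)" by (rule negligible_subset) auto
    moreover have "openin (top_of_set ?N) (?N \<inter> ?U)" by (simp add: openin_open_Int)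
    ultimately show "\<exists>U. openin (top_of_set ?N) U \<and> a \<in> U \<and> negligible U"
      using a r(1) by (intro exI[of _ "?N \<inter> ?U"]) auto
  qed
  then have "AE x in lebesgue. x \<notin> {x \<in> S. w x \<noteq> h0 x}"
    by (intro AE_not_in) (simp add: negligible_iff_null_sets)
  then have "AE x in lebesgue_on S. w x = h0 x"
    using Sm by (simp add: AE_restrict_space_iff)
  then have ae: "AE x in lebesgue_on S. w x = h x" using h0(3) by eventually_elim simp
  have wm: "w \<in> borel_measurable (lebesgue_on S)"
    using Ck[of 0] Sm by (simp add: continuous_imp_measurable_on_sets_lebesgue)
  have "AE x in lebesgue_on S. (w x)\<^sup>2 = (h x)\<^sup>2" using ae by eventually_elim simp
  then have "integrable (lebesgue_on S) (\<lambda>x. (w x)\<^sup>2)"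
    using integrable_cong_AE[of "\<lambda>x. (w x)\<^sup>2" "lebesgue_on S" "\<lambda>x. (h x)\<^sup>2"] wm L2D[OF h] by simp
  then have "w \<in> L2 S" using wm by (simp add: L2_def)
  then show ?thesis using that harm ae by blast
qed

section \<open>Splitting off the harmonic part\<close>

text \<open>Orthogonal projection onto the closure of the Laplacians of test functions.\<close>

lemma lap_projection:
  fixes w :: "'n::finite fn"
  assumes S: "open S" "bounded S" and w: "w \<in> L2 S"
  obtains r where "r \<in> L2 S" "\<And>\<phi>. \<phi> \<in> test_functions S \<Longrightarrow> l2ip S (\<lambda>x. w x - r x) (lap \<phi>) = 0"
    "\<And>K. 0 \<le> K \<Longrightarrow> (\<And>\<phi>. \<phi> \<in> test_functions S \<Longrightarrow> \<bar>l2ip S w (lap \<phi>)\<bar> \<le> K * l2norm S (lap \<phi>)) \<Longrightarrow> l2norm S r \<le> K"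
proof -
  note Sl = bounded_open_lmeasurable[OF S]
  let ?T = "test_functions S"
  have lapL: "lap \<phi> \<in> L2 S" if "\<phi> \<in> ?T" for \<phi> using test_functions_L2[OF lap_test[OF that] Sl] .
  define d where "d \<phi> = (l2norm S (\<lambda>x. w x - lap \<phi> x))\<^sup>2" for \<phi>
  define m where "m = (INF \<phi>\<in>?T. d \<phi>)"
  have bdd: "bdd_below (d ` ?T)" by (rule bdd_belowI[of _ 0]) (auto simp: d_def)
  have m: "m \<le> d \<phi>" if "\<phi> \<in> ?T" for \<phi> unfolding m_def by (rule cINF_lower[OF bdd that])
  have ne: "?T \<noteq> {}" using test_functions_zero by blast
  \<comment> \<open>A tolerance of \<open>(1/4)^k\<close> for squared distances becomes the
    geometric rate \<open>(1/2)^k\<close> that the completeness lemma requires.\<close>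
  have "\<exists>\<phi>\<in>?T. d \<phi> < m + (1/4)^k" for k :: nat
    using cINF_less_iff[OF ne bdd, of "m + (1/4)^k"] by (simp add: m_def)
  then obtain \<phi> where \<phi>: "\<And>k. \<phi> k \<in> ?T" "\<And>k. d (\<phi> k) < m + (1/4)^k" by metis
  let ?d = "\<lambda>k. lap (\<phi> k)"
  have wd: "(\<lambda>x. w x - lap \<psi> x) \<in> L2 S" if "\<psi> \<in> ?T" for \<psi> using L2_diff[OF w lapL[OF that]] .
  have fast: "l2norm S (\<lambda>x. ?d j x - ?d k x) \<le> 2 * (1/2)^k" if "k \<le> j" for j k
  proof -
    let ?a = "\<lambda>x. w x - ?d j x" and ?b = "\<lambda>x. w x - ?d k x"
    \<comment> \<open>The midpoint is an admissible competitor, so the parallelogram law bounds the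
      difference of two near-minimizers by their excess over \<open>m\<close>.\<close>
    define \<psi> where "\<psi> x = (1/2) * (\<phi> j x + \<phi> k x)" for x
    have \<psi>: "\<psi> \<in> ?T" unfolding \<psi>_def[abs_def] by (intro test_functions_cmult test_functions_add \<phi>)
    have s: "smooth (\<phi> j)" "smooth (\<phi> k)" using \<phi>(1) test_functions_smooth by blast+
    have "lap \<psi> = (\<lambda>x. (1/2) * (?d j x + ?d k x))"
      unfolding \<psi>_def[abs_def] lap_cmult[OF smooth_add[OF s]] lap_add[OF s] ..
    then have lap: "lap \<psi> x = (1/2) * (?d j x + ?d k x)" for x by simp
    have "?a x + ?b x = 2 * (w x - lap \<psi> x)" for x using lap[of x] by argo
    then have "(\<lambda>x. ?a x + ?b x) = (\<lambda>x. 2 * (w x - lap \<psi> x))" by blast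
    then have "(l2norm S (\<lambda>x. ?a x + ?b x))\<^sup>2 = 4 * d \<psi>"
      by (simp only: l2norm_cmult power_mult_distrib d_def) simp
    then have sum: "(l2norm S (\<lambda>x. ?a x + ?b x))\<^sup>2 \<ge> 4 * m" using m[OF \<psi>] by simp
    have "(l2norm S (\<lambda>x. ?a x + - ?b x))\<^sup>2 = 2 * d (\<phi> j) + 2 * d (\<phi> k) - (l2norm S (\<lambda>x. ?a x + ?b x))\<^sup>2"
      unfolding l2norm_add_power2[OF wd[OF \<phi>(1)] wd[OF \<phi>(1)]]
        l2norm_add_power2[OF wd[OF \<phi>(1)] L2_minus[OF wd[OF \<phi>(1)]]] l2norm_minus
      using l2ip_cmult[of S "-1" ?b ?a] by (simp add: l2ip_commute[of S ?a] d_def)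
    also have "\<dots> \<le> 2 * (1/4)^j + 2 * (1/4)^k" using \<phi>(2)[of j] \<phi>(2)[of k] sum by simp
    also have "(1/4::real)^j \<le> (1/4)^k" using that by (intro power_decreasing) auto
    finally have "(l2norm S (\<lambda>x. ?a x + - ?b x))\<^sup>2 \<le> 4 * (1/4)^k" by simp
    also have "\<dots> = (2 * (1/2)^k)\<^sup>2" by (simp add: power_mult_distrib power2_eq_square power_mult_distrib[symmetric])
    finally have "l2norm S (\<lambda>x. ?a x + - ?b x) \<le> 2 * (1/2)^k" by (rule power2_le_imp_le) simp
    moreover have "l2norm S (\<lambda>x. ?a x + - ?b x) = l2norm S (\<lambda>x. ?d j x - ?d k x)"
      using l2norm_minus[of S "\<lambda>x. ?d j x - ?d k x"] by simp
    ultimately show ?thesis by simp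
  qed
  obtain r where r: "r \<in> L2 S" "\<And>k. l2norm S (\<lambda>x. r x - ?d k x) \<le> 2 * (1/2)^k"
    using L2_complete_fast[OF Sl lapL[OF \<phi>(1)] fast] by blast
  have half: "(\<lambda>k. C * (1/2::real)^k) \<longlonglongrightarrow> 0" for C
    by (intro tendsto_mult_right_zero LIMSEQ_power_zero) simp
  have orth: "l2ip S (\<lambda>x. w x - r x) (lap \<psi>) = 0" if \<psi>: "\<psi> \<in> ?T" for \<psi>
  proof -
    let ?D = "l2norm S (lap \<psi>)"
    have approx: "\<bar>l2ip S (\<lambda>x. w x - ?d k x) (lap \<psi>)\<bar> \<le> (1/2)^k * ?D" for k
    proof (cases "?D = 0")
      case True
      then show ?thesis using l2ip_le[OF wd[OF \<phi>(1)] lapL[OF \<psi>], of k] by simp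
    next
      case False
      then have D: "?D > 0" using l2norm_nonneg[of S "lap \<psi>"] by linarith
      let ?p = "l2ip S (\<lambda>x. w x - ?d k x) (lap \<psi>)"
      \<comment> \<open>This \<open>t\<close> minimizes the quadratic obtained by adding
        \<open>t * \<psi>\<close> to \<open>\<phi> k\<close>; the gain
        \<open>?p\<^sup>2 / ?D\<^sup>2\<close> cannot exceed the tolerance.\<close>
      define t where "t = ?p / ?D\<^sup>2"
      have s: "smooth (\<phi> k)" "smooth \<psi>" using \<phi>(1) \<psi> test_functions_smooth by blast+
      have T: "(\<lambda>x. \<phi> k x + t * \<psi> x) \<in> ?T" by (intro test_functions_add test_functions_cmult \<phi> \<psi>)
      have e: "(\<lambda>x. w x - lap (\<lambda>x. \<phi> k x + t * \<psi> x) x) = (\<lambda>x. (w x - ?d k x) + - t * lap \<psi> x)"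
        unfolding lap_add[OF s(1) smooth_cmult[OF s(2)]] lap_cmult[OF s(2)] by (simp add: fun_eq_iff)
      have "m \<le> d (\<lambda>x. \<phi> k x + t * \<psi> x)" using m[OF T] .
      also have "\<dots> = d (\<phi> k) + 2 * (- t * ?p) + (t * ?D)\<^sup>2"
        unfolding d_def e l2norm_add_power2[OF wd[OF \<phi>(1)] L2_cmult[OF lapL[OF \<psi>]]] l2norm_cmult
        using l2ip_cmult[of S "-t" "lap \<psi>" "\<lambda>x. w x - ?d k x"]
        by (simp add: l2ip_commute[of S "\<lambda>x. w x - ?d k x"] power_mult_distrib)
      also have "\<dots> = d (\<phi> k) - ?p\<^sup>2 / ?D\<^sup>2"
        using D by (simp add: t_def power2_eq_square field_simps)
      finally have "?p\<^sup>2 / ?D\<^sup>2 \<le> (1/4)^k" using \<phi>(2)[of k] by simp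
      then have "?p\<^sup>2 \<le> (1/4)^k * ?D\<^sup>2" using D by (simp add: divide_le_eq)
      also have "\<dots> = ((1/2)^k * ?D)\<^sup>2"
        by (simp add: power_mult_distrib power2_eq_square[of "(1/2)^k"] power_mult_distrib[symmetric])
      finally have "\<bar>?p\<bar>\<^sup>2 \<le> ((1/2)^k * ?D)\<^sup>2" by simp
      then show ?thesis by (rule power2_le_imp_le) simp
    qed
    have "\<bar>l2ip S (\<lambda>x. w x - r x) (lap \<psi>)\<bar> \<le> (3 * ?D) * (1/2)^k" for k
    proof -
      have "l2ip S (\<lambda>x. (w x - ?d k x) - (r x - ?d k x)) (lap \<psi>)
          = l2ip S (\<lambda>x. w x - ?d k x) (lap \<psi>) - l2ip S (\<lambda>x. r x - ?d k x) (lap \<psi>)"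
        by (intro l2ip_diff wd \<phi>(1) L2_diff r(1) lapL \<psi>)
      moreover have "\<bar>l2ip S (\<lambda>x. r x - ?d k x) (lap \<psi>)\<bar> \<le> l2norm S (\<lambda>x. r x - ?d k x) * ?D"
        by (intro l2ip_le L2_diff r(1) lapL \<phi>(1) \<psi>)
      moreover have "\<dots> \<le> (2 * (1/2)^k) * ?D" by (intro mult_right_mono r(2)) simp
      ultimately show ?thesis using approx[of k] by (simp add: algebra_simps)
    qed
    then have "\<bar>l2ip S (\<lambda>x. w x - r x) (lap \<psi>)\<bar> \<le> 0"
      using LIMSEQ_le_const[OF half[of "3 * ?D"]] by blast
    then show ?thesis by simp
  qed
  show ?thesis
  proof (rule that[OF r(1) orth])
    fix K assume K: "0 \<le> K" and bd: "\<And>\<phi>. \<phi> \<in> ?T \<Longrightarrow> \<bar>l2ip S w (lap \<phi>)\<bar> \<le> K * l2norm S (lap \<phi>)"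
    let ?R = "l2norm S r"
    \<comment> \<open>Write one factor \<open>r\<close> as \<open>?d k\<close> plus a small error.
      Orthogonality replaces \<open>l2ip S r (?d k)\<close> by \<open>l2ip S w (?d k)\<close>, where
      the assumed bound applies, and \<open>?d k\<close> is in turn almost as short as
      \<open>r\<close>.\<close>
    have "?R * ?R - K * ?R \<le> (2 * K + 2 * ?R) * (1/2)^k" for k
    proof -
      have "l2ip S r (?d k) = l2ip S w (?d k)"
        using orth[OF \<phi>(1), of k] l2ip_diff[OF w r(1) lapL[OF \<phi>(1)], of k] by simp
      then have 1: "l2ip S r (?d k) \<le> K * l2norm S (?d k)" using bd[OF \<phi>(1), of k] by linarith
      have rd: "(\<lambda>x. r x - ?d k x) \<in> L2 S" by (intro L2_diff r(1) lapL \<phi>(1))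
      have "l2norm S (\<lambda>x. r x - (r x - ?d k x)) \<le> ?R + l2norm S (\<lambda>x. r x - ?d k x)"
        by (rule l2norm_triangle_diff[OF r(1) rd])
      then have 2: "l2norm S (?d k) \<le> ?R + 2 * (1/2)^k" using r(2)[of k] by simp
      have "l2ip S (\<lambda>x. r x - ?d k x) r = l2ip S r r - l2ip S (?d k) r"
        by (intro l2ip_diff r(1) lapL \<phi>(1))
      then have "?R * ?R = l2ip S (\<lambda>x. r x - ?d k x) r + l2ip S r (?d k)"
        using l2norm_power2[of S r] l2ip_commute[of S "?d k" r] by (simp add: power2_eq_square)
      moreover have "l2ip S (\<lambda>x. r x - ?d k x) r \<le> (2 * (1/2)^k) * ?R"
        using l2ip_le[OF rd r(1)] mult_right_mono[OF r(2)[of k] l2norm_nonneg[of S r]] by linarith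
      moreover have "K * l2norm S (?d k) \<le> K * (?R + 2 * (1/2)^k)" using 2 K by (rule mult_left_mono)
      ultimately show ?thesis using 1 by (simp add: algebra_simps)
    qed
    then have "?R * ?R - K * ?R \<le> 0"
      using LIMSEQ_le_const[OF half[of "2 * K + 2 * ?R"]] by blast
    then have "?R * ?R \<le> K * ?R" by simp
    then show "?R \<le> K"
      using K l2norm_nonneg[of S r] mult_right_le_imp_le[of ?R ?R K] by (cases "?R = 0") auto
  qed
qed

text \<open>The hypothesis is a bound by \<open>h2norm\<close>; on test functions this is at most
  \<open>C\<close> times the norm of the Laplacian, which is the form the projection asks for.
  \<open>C\<close> depends on \<open>S\<close> alone, which makes the splitting uniform in
  \<open>w\<close>.\<close>

lemma harmonic_splitting:
  fixes S :: "(real^'n::finite) set"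
  assumes S: "open S" "bounded S"
  obtains C where "C \<ge> 0"
    "\<And>w H. w \<in> L2 S \<Longrightarrow> 0 \<le> H \<Longrightarrow> (\<And>v. v \<in> H20 S \<Longrightarrow> \<bar>opB S w v\<bar> \<le> H * h2norm S v) \<Longrightarrow>
       \<exists>h\<in>L2 S. harmonic_on S h \<and> l2norm S (\<lambda>x. w x - h x) \<le> C * H"
proof -
  obtain C where C: "C \<ge> 0" "\<And>\<phi>. \<phi> \<in> test_functions S \<Longrightarrow> h2norm S \<phi> \<le> C * l2norm S (lap \<phi>)"
    using test_h2norm_bound[OF S] by blast
  have "\<exists>h\<in>L2 S. harmonic_on S h \<and> l2norm S (\<lambda>x. w x - h x) \<le> C * H"
    if w: "w \<in> L2 S" and H: "0 \<le> H" and bd: "\<And>v. v \<in> H20 S \<Longrightarrow> \<bar>opB S w v\<bar> \<le> H * h2norm S v" for w H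
  proof -
    obtain r where r: "r \<in> L2 S" "\<And>\<phi>. \<phi> \<in> test_functions S \<Longrightarrow> l2ip S (\<lambda>x. w x - r x) (lap \<phi>) = 0"
      "\<And>K. 0 \<le> K \<Longrightarrow> (\<And>\<phi>. \<phi> \<in> test_functions S \<Longrightarrow> \<bar>l2ip S w (lap \<phi>)\<bar> \<le> K * l2norm S (lap \<phi>)) \<Longrightarrow> l2norm S r \<le> K"
      using lap_projection[OF S w] by blast
    have wr: "(\<lambda>x. w x - r x) \<in> L2 S" by (rule L2_diff[OF w r(1)])
    obtain h where h: "harmonic_on S h" "h \<in> L2 S" "AE x in lebesgue_on S. h x = w x - r x"
      using weyl[OF S wr r(2)] by blast
    have "AE x in lebesgue_on S. w x - h x = r x" using h(3) by eventually_elim simp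
    then have "l2norm S (\<lambda>x. w x - h x) = l2norm S r"
      by (intro l2norm_cong_AE L2_diff w h(2) r(1))
    also have "\<dots> \<le> C * H"
    proof (rule r(3))
      show "0 \<le> C * H" using C(1) H by simp
      fix \<phi> assume \<phi>: "\<phi> \<in> test_functions S"
      have "\<bar>l2ip S w (lap \<phi>)\<bar> \<le> H * h2norm S \<phi>"
        using bd[OF test_H20[OF S \<phi>]] opB_test[OF S \<phi> w] by simp
      also have "\<dots> \<le> H * (C * l2norm S (lap \<phi>))" using C(2)[OF \<phi>] H by (rule mult_left_mono)
      finally show "\<bar>l2ip S w (lap \<phi>)\<bar> \<le> C * H * l2norm S (lap \<phi>)" by (simp add: mult_ac)
    qed
    finally show ?thesis using h by blast
  qed
  then show ?thesis using that C(1) by blast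
qed

section \<open>Dual norms\<close>

text \<open>A real supremum is meaningful only for sets bounded above. Elements of norm 0 contribute
  the quotient 0, whereas \<open>C\<close> may be negative; hence \<open>max C 0\<close> in the
  proof.\<close>

lemma dual_norm_bdd:
  fixes f N :: "'a \<Rightarrow> real"
  assumes "\<And>v. v \<in> V \<Longrightarrow> 0 \<le> N v" "\<And>v. v \<in> V \<Longrightarrow> \<bar>f v\<bar> \<le> C * N v"
  shows "bdd_above ((\<lambda>v. \<bar>f v\<bar> / N v) ` V)"
proof (rule bdd_aboveI2)
  fix v assume v: "v \<in> V"
  show "\<bar>f v\<bar> / N v \<le> max C 0"
  proof (cases "N v = 0")
    case False
    then have "N v > 0" using assms(1)[OF v] by linarith
    then have "\<bar>f v\<bar> / N v \<le> C" using assms(2)[OF v] by (simp add: pos_divide_le_eq)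
    then show ?thesis by simp
  qed simp
qed

text \<open>The bound with an arbitrary \<open>C\<close> serves twice: it makes the supremum finite,
  and it forces \<open>f v = 0\<close> where the norm vanishes.\<close>

lemma dual_norm_bound:
  assumes N: "\<And>v. v \<in> V \<Longrightarrow> 0 \<le> N v" and f: "\<And>v. v \<in> V \<Longrightarrow> \<bar>f v\<bar> \<le> C * N v" and v: "v \<in> V"
  shows "\<bar>f v\<bar> \<le> dual_norm V N f * N v"
proof (cases "N v = 0")
  case True
  then show ?thesis using f[OF v] by simp
next
  case False
  have "\<bar>f v\<bar> / N v \<le> dual_norm V N f"
    unfolding dual_norm_def by (rule cSUP_upper[OF v dual_norm_bdd[OF N f]])
  moreover have "N v > 0" using False N[OF v] by linarith
  ultimately show ?thesis by (simp add: pos_divide_le_eq)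
qed

lemma dual_norm_le:
  assumes N: "\<And>v. v \<in> V \<Longrightarrow> 0 \<le> N v" and f: "\<And>v. v \<in> V \<Longrightarrow> \<bar>f v\<bar> \<le> C * N v" and "V \<noteq> {}" "0 \<le> C"
  shows "dual_norm V N f \<le> C"
  unfolding dual_norm_def
proof (rule cSUP_least[OF \<open>V \<noteq> {}\<close>])
  fix v assume v: "v \<in> V"
  show "\<bar>f v\<bar> / N v \<le> C"
  proof (cases "N v = 0")
    case False
    then have "N v > 0" using N[OF v] by linarith
    then show ?thesis using f[OF v] by (simp add: pos_divide_le_eq)
  qed (simp add: \<open>0 \<le> C\<close>)
qed

lemma dual_norm_nonneg:
  assumes N: "\<And>v. v \<in> V \<Longrightarrow> 0 \<le> N v" and f: "\<And>v. v \<in> V \<Longrightarrow> \<bar>f v\<bar> \<le> C * N v" and "V \<noteq> {}"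
  shows "0 \<le> dual_norm V N f"
proof -
  obtain v where v: "v \<in> V" using \<open>V \<noteq> {}\<close> by blast
  have "0 \<le> \<bar>f v\<bar> / N v" using N[OF v] by simp
  also have "\<dots> \<le> dual_norm V N f"
    unfolding dual_norm_def by (rule cSUP_upper[OF v dual_norm_bdd[OF N f]])
  finally show ?thesis .
qed

lemma op_norm_bound:
  assumes N: "\<And>v. v \<in> V \<Longrightarrow> 0 \<le> N v" and M: "\<And>v. v \<in> V \<Longrightarrow> 0 \<le> M (T v)"
    and T: "\<And>v. v \<in> V \<Longrightarrow> M (T v) \<le> C * N v" and v: "v \<in> V"
  shows "M (T v) \<le> op_norm V N M T * N v"
proof -
  have "op_norm V N M T = dual_norm V N (\<lambda>v. M (T v))"
    using M by (simp add: op_norm_def dual_norm_def cong: SUP_cong)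
  then show ?thesis
    using dual_norm_bound[of V N "\<lambda>v. M (T v)" C v] N T M v by fastforce
qed

section \<open>Finite dimensional spaces\<close>

lemma fin_dim_space_comb:
  assumes "fin_dim_space S X" "f \<in> X" "g \<in> X"
  shows "(\<lambda>x. s * f x + t * g x) \<in> X"
proof -
  obtain m b where X: "X = {f. \<exists>c. ae_eq S f (\<lambda>x. \<Sum>k<(m::nat). c k * b k x)}"
    using assms(1) by (auto simp: fin_dim_space_def)
  obtain c d where c: "AE x in lebesgue_on S. f x = (\<Sum>k<m. c k * b k x)"
    and d: "AE x in lebesgue_on S. g x = (\<Sum>k<m. d k * b k x)"
    using assms(2,3) unfolding X ae_eq_def by blast
  from c d have "AE x in lebesgue_on S. s * f x + t * g x = (\<Sum>k<m. (s * c k + t * d k) * b k x)"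
    by eventually_elim (simp add: sum_distrib_left sum.distrib distrib_right mult.assoc)
  then show ?thesis unfolding X ae_eq_def by (intro CollectI exI[of _ "\<lambda>k. s * c k + t * d k"])
qed

lemma fin_dim_space_zero:
  assumes "fin_dim_space S X"
  shows "(\<lambda>x. 0) \<in> X"
proof -
  obtain m b where X: "X = {f. \<exists>c. ae_eq S f (\<lambda>x. \<Sum>k<(m::nat). c k * b k x)}"
    using assms(1) by (auto simp: fin_dim_space_def)
  show ?thesis unfolding X ae_eq_def by (intro CollectI exI[of _ "\<lambda>_. 0"]) simp
qed

lemma fin_dim_space_sum:
  assumes "fin_dim_space S X" "\<And>i. i \<in> A \<Longrightarrow> e i \<in> X"
  shows "(\<lambda>x. \<Sum>i\<in>A. c i * e i x) \<in> X"
  using assms(2)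
proof (induction A rule: infinite_finite_induct)
  case (insert a A)
  then show ?case using fin_dim_space_comb[OF assms(1), of "e a" "\<lambda>x. \<Sum>i\<in>A. c i * e i x" "c a" 1] by simp
qed (auto simp: fin_dim_space_zero[OF assms(1)])

text \<open>Gram-Schmidt, discarding generators that depend on the previous ones.\<close>

lemma orthonormal_generators:
  fixes b :: "nat \<Rightarrow> 'n::finite fn"
  assumes X: "fin_dim_space S X" "X \<subseteq> L2 S" and b: "\<And>k. k < M \<Longrightarrow> b k \<in> X"
  shows "\<exists>(m::nat) e. (\<forall>i<m. e i \<in> X) \<and> (\<forall>i<m. \<forall>j<m. l2ip S (e i) (e j) = (if i = j then 1 else 0)) \<and>
    (\<forall>k<M. \<exists>d. AE x in lebesgue_on S. b k x = (\<Sum>i<m. d i * e i x))"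
  using b
proof (induction M)
  case 0
  show ?case by (rule exI[of _ 0]) auto
next
  case (Suc M)
  have "\<exists>(m::nat) e. (\<forall>i<m. e i \<in> X) \<and> (\<forall>i<m. \<forall>j<m. l2ip S (e i) (e j) = (if i = j then 1 else 0)) \<and>
    (\<forall>k<M. \<exists>d. AE x in lebesgue_on S. b k x = (\<Sum>i<m. d i * e i x))"
    by (rule Suc.IH) (simp add: Suc.prems)
  then obtain m :: nat and e where e': "\<forall>i<m. e i \<in> X"
    "\<forall>i<m. \<forall>j<m. l2ip S (e i) (e j) = (if i = j then 1 else 0)"
    "\<forall>k<M. \<exists>d. AE x in lebesgue_on S. b k x = (\<Sum>i<m. d i * e i x)"
    by blast
  note e = e'(1)[rule_format] e'(2)[rule_format] e'(3)[rule_format]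
  have eL: "e i \<in> L2 S" if "i < m" for i using e(1)[OF that] X(2) by blast
  have bX: "b M \<in> X" using Suc.prems by simp
  then have bL: "b M \<in> L2 S" using X(2) by blast
  define p where "p x = (\<Sum>i<m. l2ip S (b M) (e i) * e i x)" for x
  have pX: "p \<in> X" unfolding p_def[abs_def] by (rule fin_dim_space_sum[OF X(1)]) (use e in auto)
  then have pL: "p \<in> L2 S" using X(2) by blast
  define r where "r x = b M x - p x" for x
  have rX: "r \<in> X" using fin_dim_space_comb[OF X(1) bX pX, of 1 "-1"] by (simp add: r_def[abs_def])
  then have rL: "r \<in> L2 S" using X(2) by blast
  have orth: "l2ip S r (e j) = 0" if j: "j < m" for j
  proof -
    have "l2ip S p (e j) = (\<Sum>i<m. l2ip S (\<lambda>x. l2ip S (b M) (e i) * e i x) (e j))"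
      unfolding p_def[abs_def] by (rule l2ip_sum) (use eL j in \<open>auto intro: L2_cmult\<close>)
    also have "\<dots> = (\<Sum>i<m. l2ip S (b M) (e i) * (if i = j then 1 else 0))"
      by (rule sum.cong) (use e(2) j in \<open>auto simp: l2ip_cmult\<close>)
    also have "\<dots> = l2ip S (b M) (e j)" using j by (simp add: if_distrib cong: if_cong)
    finally show ?thesis
      unfolding r_def[abs_def] using l2ip_diff[OF bL pL eL[OF j]] by simp
  qed
  show ?case
  proof (cases "l2norm S r = 0")
    case True
    have "AE x in lebesgue_on S. b M x = (\<Sum>i<m. l2ip S (b M) (e i) * e i x)"
      using l2norm_eq_0_AE[OF rL True] by eventually_elim (simp add: r_def p_def)
    then have "\<exists>d. AE x in lebesgue_on S. b k x = (\<Sum>i<m. d i * e i x)" if "k < Suc M" for k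
      using that e(3)[of k] by (cases "k = M") (auto intro: exI[of _ "\<lambda>i. l2ip S (b M) (e i)"])
    then show ?thesis using e(1,2) by (intro exI[of _ m] exI[of _ e]) auto
  next
    case False
    let ?R = "l2norm S r"
    define e' where "e' i = (if i < m then e i else (\<lambda>x. (1 / ?R) * r x))" for i
    have sum': "(\<Sum>i<Suc m. d i * e' i x) = (\<Sum>i<m. d i * e i x) + d m * ((1 / ?R) * r x)" for d x
      by (simp add: e'_def)
    have "e' i \<in> X" if "i < Suc m" for i
      using e(1) fin_dim_space_comb[OF X(1) rX rX, of "1 / ?R" 0] by (simp add: e'_def)
    moreover have "l2ip S (e' i) (e' j) = (if i = j then 1 else 0)" if ij: "i < Suc m" "j < Suc m" for i j
    proof -
      have 1: "l2ip S (\<lambda>x. (1 / ?R) * r x) (e k) = 0" if "k < m" for k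
        by (simp add: l2ip_cmult[of S "1 / ?R" r] orth[OF that] del: times_divide_eq_left)
      have 2: "l2ip S (\<lambda>x. (1 / ?R) * r x) (\<lambda>x. (1 / ?R) * r x) = 1"
        using False l2norm_power2[of S "\<lambda>x. (1 / ?R) * r x"] l2norm_cmult[of S "1 / ?R" r] by simp
      have 3: "l2ip S (e k) (\<lambda>x. (1 / ?R) * r x) = 0" if "k < m" for k
        using 1[OF that] by (rule trans[OF l2ip_commute])
      consider "i < m" "j < m" | "i < m" "j = m" | "i = m" "j < m" | "i = m" "j = m"
        using ij unfolding less_Suc_eq by blast
      then show ?thesis
        by cases (simp_all add: e'_def e(2) 1 2 3 del: times_divide_eq_left)
    qed
    moreover have "\<exists>d. AE x in lebesgue_on S. b k x = (\<Sum>i<Suc m. d i * e' i x)" if k: "k < Suc M" for k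
    proof (cases "k = M")
      case True
      have "b M x = (\<Sum>i<Suc m. (if i < m then l2ip S (b M) (e i) else ?R) * e' i x)" for x
        using False unfolding sum' by (simp add: r_def p_def)
      then show ?thesis unfolding True by (intro exI[of _ "\<lambda>i. if i < m then l2ip S (b M) (e i) else ?R"]) simp
    next
      case False
      then obtain d where d: "AE x in lebesgue_on S. b k x = (\<Sum>i<m. d i * e i x)" using e(3)[of k] k by auto
      then have "AE x in lebesgue_on S. b k x = (\<Sum>i<Suc m. (if i < m then d i else 0) * e' i x)"
        by eventually_elim (simp only: sum', simp)
      then show ?thesis by (intro exI[of _ "\<lambda>i. if i < m then d i else 0"])
    qed
    ultimately show ?thesis by (intro exI[of _ "Suc m"] exI[of _ e']) blast
  qed
qed

text \<open>Orthonormality identifies the coefficients of an expansion as inner products. They are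
  therefore bounded by the L2 norm, on which compactness of bounded sets rests.\<close>

lemma orthonormal_basis:
  assumes X: "fin_dim_space S X" "X \<subseteq> L2 S"
  obtains m :: nat and e where "\<forall>i<m. e i \<in> X"
    "\<forall>z\<in>X. AE x in lebesgue_on S. z x = (\<Sum>i<m. l2ip S z (e i) * e i x)"
    "\<forall>i<m. l2norm S (e i) = 1"
proof -
  obtain M b where Xb: "X = {f. \<exists>c. ae_eq S f (\<lambda>x. \<Sum>k<(M::nat). c k * b k x)}"
    using assms(1) by (auto simp: fin_dim_space_def)
  have bX: "b k \<in> X" if "k < M" for k
  proof -
    have "b k x = (\<Sum>j<M. (if j = k then 1 else 0) * b j x)" for x
      using that by (simp add: if_distrib[of "\<lambda>a. a * _"] cong: if_cong)
    then have "AE x in lebesgue_on S. b k x = (\<Sum>j<M. (if j = k then 1 else 0) * b j x)" by (rule AE_I2)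
    then show ?thesis unfolding Xb ae_eq_def by (intro CollectI exI[of _ "\<lambda>j. if j = k then 1 else 0"])
  qed
  have "\<exists>(m::nat) e. (\<forall>i<m. e i \<in> X) \<and> (\<forall>i<m. \<forall>j<m. l2ip S (e i) (e j) = (if i = j then 1 else 0)) \<and>
    (\<forall>k<M. \<exists>d. AE x in lebesgue_on S. b k x = (\<Sum>i<m. d i * e i x))"
    by (rule orthonormal_generators[OF X]) (rule bX)
  then obtain m :: nat and e where e: "\<forall>i<m. e i \<in> X"
    "\<forall>i<m. \<forall>j<m. l2ip S (e i) (e j) = (if i = j then 1 else 0)"
    "\<forall>k<M. \<exists>d. AE x in lebesgue_on S. b k x = (\<Sum>i<m. d i * e i x)"
    by blast
  then have "\<forall>k. \<exists>d. k < M \<longrightarrow> (AE x in lebesgue_on S. b k x = (\<Sum>i<m. d i * e i x))" by blast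
  then obtain d where "\<forall>k. k < M \<longrightarrow> (AE x in lebesgue_on S. b k x = (\<Sum>i<m. d k i * e i x))"
    unfolding choice_iff by (elim exE) (rule that)
  note d = this[rule_format]
  have eL: "e i \<in> L2 S" if "i < m" for i using e(1) that X(2) by blast
  have "AE x in lebesgue_on S. z x = (\<Sum>i<m. l2ip S z (e i) * e i x)" if z: "z \<in> X" for z
  proof -
    obtain c where c: "AE x in lebesgue_on S. z x = (\<Sum>k<M. c k * b k x)"
      using z unfolding Xb ae_eq_def by blast
    have "AE x in lebesgue_on S. \<forall>k\<in>{..<M}. b k x = (\<Sum>i<m. d k i * e i x)"
      by (intro AE_finite_allI) (use d in auto)
    with c have ae: "AE x in lebesgue_on S. z x = (\<Sum>i<m. (\<Sum>k<M. c k * d k i) * e i x)"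
    proof eventually_elim
      case (elim x)
      have "z x = (\<Sum>k<M. \<Sum>i<m. c k * d k i * e i x)"
        using elim by (simp add: sum_distrib_left mult.assoc)
      also have "\<dots> = (\<Sum>i<m. \<Sum>k<M. c k * d k i * e i x)" by (rule sum.swap)
      finally show ?case by (simp add: sum_distrib_right)
    qed
    have "l2ip S z (e j) = (\<Sum>k<M. c k * d k j)" if j: "j < m" for j
    proof -
      have "l2ip S z (e j) = l2ip S (\<lambda>x. \<Sum>i<m. (\<Sum>k<M. c k * d k i) * e i x) (e j)"
        using z X(2) j by (intro l2ip_cong_AE[OF _ _ _ ae] L2_sum L2_cmult eL) auto
      also have "\<dots> = (\<Sum>i<m. l2ip S (\<lambda>x. (\<Sum>k<M. c k * d k i) * e i x) (e j))"
        by (rule l2ip_sum) (use eL j in \<open>auto intro: L2_cmult\<close>)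
      also have "\<dots> = (\<Sum>i<m. (\<Sum>k<M. c k * d k i) * (if i = j then 1 else 0))"
        by (rule sum.cong) (use e(2) j in \<open>auto simp: l2ip_cmult\<close>)
      also have "\<dots> = (\<Sum>k<M. c k * d k j)" using j by (simp add: if_distrib cong: if_cong)
      finally show ?thesis .
    qed
    with ae show ?thesis by simp
  qed
  moreover have "l2norm S (e i) = 1" if "i < m" for i
  proof -
    have "(l2norm S (e i))\<^sup>2 = 1" using e(2) that l2norm_power2[of S "e i"] by simp
    then show ?thesis using l2norm_nonneg[of S "e i"] power2_eq_1_iff[of "l2norm S (e i)"] by linarith
  qed
  ultimately show ?thesis using that e(1) by blast
qed

text \<open>Bolzano-Weierstrass, one coordinate after the other. Indices below \<open>m\<close>
  stand in for a Euclidean space because the dimension is a number here and not a type.\<close>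

lemma convergent_subsequence_finite:
  fixes d :: "nat \<Rightarrow> nat \<Rightarrow> real"
  assumes "\<And>k i. i < m \<Longrightarrow> \<bar>d k i\<bar> \<le> R"
  shows "\<exists>\<sigma> l. strict_mono (\<sigma> :: nat \<Rightarrow> nat) \<and> (\<forall>i<m. (\<lambda>k. d (\<sigma> k) i) \<longlonglongrightarrow> l i)"
  using assms
proof (induction m)
  case 0
  show ?case by (intro exI[of _ id]) (auto simp: strict_mono_def)
next
  case (Suc m)
  then obtain \<sigma> l where \<sigma>: "strict_mono (\<sigma> :: nat \<Rightarrow> nat)" "\<forall>i<m. (\<lambda>k. d (\<sigma> k) i) \<longlonglongrightarrow> l i" by auto
  have "bounded (range (\<lambda>k. d (\<sigma> k) m))"
    using Suc.prems[of m] by (auto simp: bounded_iff intro!: exI[of _ R])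
  then obtain a \<tau> where \<tau>: "strict_mono (\<tau> :: nat \<Rightarrow> nat)" "((\<lambda>k. d (\<sigma> k) m) \<circ> \<tau>) \<longlonglongrightarrow> a"
    using bounded_imp_convergent_subsequence by blast
  have "(\<lambda>k. d (\<sigma> (\<tau> k)) i) \<longlonglongrightarrow> (if i < m then l i else a)" if "i < Suc m" for i
    using that \<sigma>(2) \<tau>(2) LIMSEQ_subseq_LIMSEQ[OF _ \<tau>(1), of "\<lambda>k. d (\<sigma> k) i" "l i"]
    by (cases "i < m") (auto simp: comp_def less_Suc_eq)
  then show ?case
    using strict_mono_o[OF \<sigma>(1) \<tau>(1)] unfolding comp_def
    by (intro exI[of _ "\<lambda>k. \<sigma> (\<tau> k)"] exI[of _ "\<lambda>i. if i < m then l i else a"]) auto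
qed

text \<open>\<open>arg_min\<close> is a choice that is informative only if a minimizer exists.
  Coercivity bounds a minimizing sequence, so its coefficients converge along a subsequence, and
  sequential continuity in L2 finishes the argument.\<close>

lemma fin_dim_minimizer:
  fixes F :: "'n::finite fn \<Rightarrow> real"
  assumes X: "fin_dim_space S X" "X \<subseteq> L2 S"
    and a: "a > 0" and coercive: "\<And>z. z \<in> X \<Longrightarrow> a * (l2norm S z)\<^sup>2 \<le> F z"
    and cont: "\<And>f z. (\<And>k. f k \<in> X) \<Longrightarrow> z \<in> X \<Longrightarrow> (\<lambda>k. l2norm S (\<lambda>x. f k x - z x)) \<longlonglongrightarrow> 0 \<Longrightarrow> (\<lambda>k. F (f k)) \<longlonglongrightarrow> F z"
  obtains z where "z \<in> X" "\<And>z'. z' \<in> X \<Longrightarrow> F z \<le> F z'"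
proof -
  obtain m :: nat and e where e: "\<forall>i<m. e i \<in> X"
    "\<forall>z\<in>X. AE x in lebesgue_on S. z x = (\<Sum>i<m. l2ip S z (e i) * e i x)" "\<forall>i<m. l2norm S (e i) = 1"
    using orthonormal_basis[OF X] by blast
  have eL: "e i \<in> L2 S" if "i < m" for i using e(1) that X(2) by blast
  have ne: "X \<noteq> {}" using fin_dim_space_zero[OF X(1)] by blast
  have "0 \<le> F z" if "z \<in> X" for z
    using coercive[OF that] a zero_le_power2[of "l2norm S z"] mult_nonneg_nonneg[of a "(l2norm S z)\<^sup>2"] by linarith
  then have bdd: "bdd_below (F ` X)" by (rule bdd_belowI2)
  define I where "I = (INF z\<in>X. F z)"
  have I: "I \<le> F z" if "z \<in> X" for z unfolding I_def by (rule cINF_lower[OF bdd that])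
  have "\<exists>z\<in>X. F z < I + 1 / real (Suc k)" for k
    using cINF_less_iff[OF ne bdd, of "I + 1 / real (Suc k)"] by (simp add: I_def)
  then obtain f where f: "\<And>k. f k \<in> X" "\<And>k. F (f k) < I + 1 / real (Suc k)" by metis
  \<comment> \<open>Coercivity combined with \<open>F (f k) \<le> I + 1\<close>.\<close>
  define R where "R = sqrt ((I + 1) / a)"
  have R: "l2norm S (f k) \<le> R" for k
  proof -
    have "1 / real (Suc k) \<le> 1" by simp
    then have "a * (l2norm S (f k))\<^sup>2 \<le> I + 1" using coercive[OF f(1), of k] f(2)[of k] by linarith
    then have "(l2norm S (f k))\<^sup>2 \<le> (I + 1) / a" using a by (simp add: pos_le_divide_eq mult.commute)
    then show ?thesis unfolding R_def by (rule real_le_rsqrt)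
  qed
  let ?d = "\<lambda>k i. l2ip S (f k) (e i)"
  have "\<bar>?d k i\<bar> \<le> R" if "i < m" for k i
  proof -
    have "f k \<in> L2 S" using f(1) X(2) by blast
    then have "\<bar>?d k i\<bar> \<le> l2norm S (f k) * l2norm S (e i)" using eL[OF that] by (rule l2ip_le)
    then show ?thesis using e(3) that R[of k] by simp
  qed
  then obtain \<sigma> l where \<sigma>: "strict_mono (\<sigma> :: nat \<Rightarrow> nat)" "\<forall>i<m. (\<lambda>k. ?d (\<sigma> k) i) \<longlonglongrightarrow> l i"
    using convergent_subsequence_finite[of m ?d R] by blast
  define z where "z x = (\<Sum>i<m. l i * e i x)" for x
  have z: "z \<in> X" unfolding z_def[abs_def] by (rule fin_dim_space_sum[OF X(1)]) (use e(1) in auto)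
  have close: "l2norm S (\<lambda>x. f (\<sigma> k) x - z x) \<le> (\<Sum>i<m. \<bar>?d (\<sigma> k) i - l i\<bar>)" for k
  proof -
    have "AE x in lebesgue_on S. f (\<sigma> k) x - z x = (\<Sum>i<m. (?d (\<sigma> k) i - l i) * e i x)"
      using e(2)[rule_format, OF f(1)]
      by eventually_elim (simp add: z_def sum_subtractf left_diff_distrib)
    then have "l2norm S (\<lambda>x. f (\<sigma> k) x - z x) = l2norm S (\<lambda>x. \<Sum>i<m. (?d (\<sigma> k) i - l i) * e i x)"
      using f(1) z X(2) by (intro l2norm_cong_AE L2_diff L2_sum L2_cmult eL) auto
    also have "\<dots> \<le> (\<Sum>i<m. l2norm S (\<lambda>x. (?d (\<sigma> k) i - l i) * e i x))"
      by (intro l2norm_sum_le L2_cmult eL) auto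
    also have "\<dots> = (\<Sum>i<m. \<bar>?d (\<sigma> k) i - l i\<bar>)"
      by (intro sum.cong) (use e(3) in \<open>auto simp: l2norm_cmult\<close>)
    finally show ?thesis .
  qed
  have "(\<lambda>k. \<Sum>i<m. \<bar>?d (\<sigma> k) i - l i\<bar>) \<longlonglongrightarrow> (\<Sum>i<m. \<bar>l i - l i\<bar>)"
    using \<sigma>(2) by (intro tendsto_sum tendsto_rabs tendsto_diff tendsto_const) auto
  then have lim0: "(\<lambda>k. \<Sum>i<m. \<bar>?d (\<sigma> k) i - l i\<bar>) \<longlonglongrightarrow> 0" by simp
  have "(\<lambda>k. l2norm S (\<lambda>x. f (\<sigma> k) x - z x)) \<longlonglongrightarrow> 0"
    by (rule Lim_null_comparison[OF _ lim0]) (use close in auto)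
  then have lim: "(\<lambda>k. F (f (\<sigma> k))) \<longlonglongrightarrow> F z" using cont[of "\<lambda>k. f (\<sigma> k)" z] f(1) z by blast
  have "(\<lambda>k. I + 1 / real (Suc k)) \<longlonglongrightarrow> I + 0"
    by (intro tendsto_add tendsto_const LIMSEQ_Suc[OF lim_const_over_n])
  then have "(\<lambda>k. I + 1 / real (Suc (\<sigma> k))) \<longlonglongrightarrow> I"
    using LIMSEQ_subseq_LIMSEQ[OF _ \<sigma>(1)] by (fastforce simp: comp_def)
  then have "F z \<le> I" using LIMSEQ_le[OF lim] f(2) less_imp_le by blast
  then show ?thesis using that[OF z] I by (meson order_trans)
qed

section \<open>The regularized least squares solution\<close>

lemma l2norm_cong: "(\<And>x. x \<in> S \<Longrightarrow> f x = g x) \<Longrightarrow> l2norm S f = l2norm S g"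
  unfolding l2norm_def by (intro arg_cong[of _ _ sqrt] Bochner_Integration.integral_cong) auto

lemma l2norm_opC: "l2norm \<omega> (\<lambda>x. opC \<omega> z x - q x) = l2norm \<omega> (\<lambda>x. z x - q x)"
  by (rule l2norm_cong) (simp add: opC_def)

text \<open>The regularization term is coercive because \<open>\<epsilon> > 0\<close>, and the
  residual norms are Lipschitz in L2. \<open>C\<close> and \<open>D\<close> enter only through
  finiteness and continuity, so they may depend on the discretization.\<close>

lemma lsq_solution_minimizes:
  fixes B :: "'n::finite fn \<Rightarrow> 'n fn \<Rightarrow> real"
  assumes X: "fin_dim_space S X" "X \<subseteq> L2 S"
    and om: "\<omega> \<subseteq> S" "\<omega> \<in> sets lebesgue" "S \<in> sets lebesgue"
    and Y: "Y \<noteq> {}" "\<And>v. v \<in> Y \<Longrightarrow> 0 \<le> N v"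
    and B: "0 \<le> C" "\<And>z v. z \<in> L2 S \<Longrightarrow> v \<in> Y \<Longrightarrow> \<bar>B z v\<bar> \<le> C * l2norm S z * N v"
      "\<And>z z' v. z \<in> L2 S \<Longrightarrow> z' \<in> L2 S \<Longrightarrow> v \<in> Y \<Longrightarrow> B (\<lambda>x. z x - z' x) v = B z v - B z' v"
    and ld: "\<And>v. v \<in> Y \<Longrightarrow> \<bar>ld v\<bar> \<le> D * N v"
    and q: "q \<in> L2 \<omega>" and eps: "\<epsilon> > 0"
  shows "lsq_solution S \<omega> X Y N B \<epsilon> ld q \<in> X"
    "z \<in> X \<Longrightarrow> lsq_functional S \<omega> Y N B \<epsilon> ld q (lsq_solution S \<omega> X Y N B \<epsilon> ld q) \<le> lsq_functional S \<omega> Y N B \<epsilon> ld q z"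
proof -
  let ?F = "lsq_functional S \<omega> Y N B \<epsilon> ld q"
  define a where "a z = dual_norm Y N (\<lambda>v. B z v - ld v)" for z
  define b where "b z = l2norm \<omega> (\<lambda>x. z x - q x)" for z
  have F: "?F z = (a z)\<^sup>2 + (b z)\<^sup>2 + \<epsilon>\<^sup>2 * (l2norm S z)\<^sup>2" for z
    by (simp add: lsq_functional_def a_def b_def l2norm_opC)
  have bd: "\<bar>B z v - ld v\<bar> \<le> (C * l2norm S z + D) * N v" if "z \<in> L2 S" "v \<in> Y" for z v
    using B(2)[OF that] ld[OF that(2)] by (simp add: distrib_right)
  have a1: "a z \<le> a z' + C * l2norm S (\<lambda>x. z x - z' x)" if z: "z \<in> L2 S" "z' \<in> L2 S" for z z'
    unfolding a_def[of z]
  proof (rule dual_norm_le[OF Y(2) _ Y(1)])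
    show "0 \<le> a z' + C * l2norm S (\<lambda>x. z x - z' x)"
      unfolding a_def using dual_norm_nonneg[OF Y(2) bd[OF z(2)] Y(1)] B(1) by simp
    fix v assume v: "v \<in> Y"
    have "\<bar>B z' v - ld v\<bar> \<le> a z' * N v"
      unfolding a_def using dual_norm_bound[OF Y(2) bd[OF z(2)] v] .
    moreover have "\<bar>B z v - B z' v\<bar> \<le> C * l2norm S (\<lambda>x. z x - z' x) * N v"
      using B(2)[OF L2_diff[OF z] v] B(3)[OF z v] by simp
    ultimately show "\<bar>B z v - ld v\<bar> \<le> (a z' + C * l2norm S (\<lambda>x. z x - z' x)) * N v"
      by (simp add: distrib_right)
  qed
  have b1: "b z \<le> b z' + l2norm S (\<lambda>x. z x - z' x)" if z: "z \<in> L2 S" "z' \<in> L2 S" for z z'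
  proof -
    have "b z \<le> l2norm \<omega> (\<lambda>x. z x - z' x) + b z'"
      unfolding b_def using L2_subset(1)[OF _ om] z q by (intro l2norm_triangle3) auto
    then show ?thesis using L2_subset(2)[OF L2_diff[OF z] om] by simp
  qed
  have c1: "l2norm S z \<le> l2norm S z' + l2norm S (\<lambda>x. z x - z' x)" if z: "z \<in> L2 S" "z' \<in> L2 S" for z z'
    using l2norm_triangle[OF z(2) L2_diff[OF z]] by simp
  \<comment> \<open>A one-sided Lipschitz bound is enough, since it can be applied with
    \<open>z\<close> and \<open>f k\<close> exchanged.\<close>
  have conv: "(\<lambda>k. g (f k)) \<longlonglongrightarrow> g z"
    if g: "\<And>z z'. z \<in> L2 S \<Longrightarrow> z' \<in> L2 S \<Longrightarrow> g z \<le> g z' + K * l2norm S (\<lambda>x. z x - z' x)"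
      and f: "\<And>k. f k \<in> X" "z \<in> X" "(\<lambda>k. l2norm S (\<lambda>x. f k x - z x)) \<longlonglongrightarrow> 0" for g :: "'n fn \<Rightarrow> real" and K f z
  proof -
    have "(\<lambda>k. g (f k) - g z) \<longlonglongrightarrow> 0"
    proof (rule Lim_null_comparison)
      show "\<forall>\<^sub>F k in sequentially. norm (g (f k) - g z) \<le> K * l2norm S (\<lambda>x. f k x - z x)"
      proof (rule always_eventually, rule allI)
        fix k
        have L: "f k \<in> L2 S" "z \<in> L2 S" using f X(2) by auto
        show "norm (g (f k) - g z) \<le> K * l2norm S (\<lambda>x. f k x - z x)"
          using g[OF L] g[OF L(2,1)] l2norm_minus_commute[of S "f k" z] by (simp add: abs_le_iff)
      qed
      show "(\<lambda>k. K * l2norm S (\<lambda>x. f k x - z x)) \<longlonglongrightarrow> 0" using f(3) by (rule tendsto_mult_right_zero)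
    qed
    then show ?thesis by (rule LIM_zero_cancel)
  qed
  obtain z0 where z0: "z0 \<in> X" "\<And>z'. z' \<in> X \<Longrightarrow> ?F z0 \<le> ?F z'"
  proof (rule fin_dim_minimizer[OF X, of "\<epsilon>\<^sup>2" ?F])
    show "\<epsilon>\<^sup>2 > 0" using eps by simp
    show "\<epsilon>\<^sup>2 * (l2norm S z)\<^sup>2 \<le> ?F z" for z by (simp add: F)
    show "(\<lambda>k. ?F (f k)) \<longlonglongrightarrow> ?F z"
      if f: "\<And>k. f k \<in> X" "z \<in> X" "(\<lambda>k. l2norm S (\<lambda>x. f k x - z x)) \<longlonglongrightarrow> 0" for f z
      unfolding F
      using conv[of a C f z] conv[of b 1 f z] conv[of "l2norm S" 1 f z] a1 b1 c1 f
      by (intro tendsto_intros) auto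
  qed blast
  have "is_arg_min ?F (\<lambda>z. z \<in> X) z0" using z0 by (simp add: is_arg_min_linorder)
  then have "is_arg_min ?F (\<lambda>z. z \<in> X) (lsq_solution S \<omega> X Y N B \<epsilon> ld q)"
    unfolding lsq_solution_def arg_min_def by (rule someI[of "is_arg_min ?F (\<lambda>z. z \<in> X)"])
  then show "lsq_solution S \<omega> X Y N B \<epsilon> ld q \<in> X"
    "z \<in> X \<Longrightarrow> ?F (lsq_solution S \<omega> X Y N B \<epsilon> ld q) \<le> ?F z"
    by (auto simp: is_arg_min_linorder)
qed

section \<open>The error estimate\<close>

lemma rpow_nonneg [simp]: "0 \<le> rpow x a"
  by (simp add: rpow_def)

lemma rpow_mono: "0 \<le> x \<Longrightarrow> x \<le> y \<Longrightarrow> 0 \<le> a \<Longrightarrow> rpow x a \<le> rpow y a"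
  by (simp add: rpow_def powr_mono2)

lemma rpow_mult: "0 \<le> x \<Longrightarrow> 0 \<le> y \<Longrightarrow> rpow (x * y) a = rpow x a * rpow y a"
  by (simp add: rpow_def powr_mult)

text \<open>Holds at \<open>x = 0\<close> too: at most one of the exponents is 0, and the factor
  with the other exponent vanishes.\<close>

lemma rpow_split: "0 \<le> x \<Longrightarrow> x = rpow x a * rpow x (1 - a)"
  by (auto simp: rpow_def powr_add[symmetric])

lemma E_data_bounds:
  shows "l2norm \<omega> (\<lambda>x. u x - q x) \<le> E_data S \<omega> u l q"
    and "0 \<le> hm2norm S (\<lambda>v. l v - opB S u v) \<Longrightarrow> hm2norm S (\<lambda>v. l v - opB S u v) \<le> E_data S \<omega> u l q"
proof -
  have h: "hm2norm S (\<lambda>v. opB S u v - l v) = hm2norm S (\<lambda>v. l v - opB S u v)"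
    by (simp add: hm2norm_def dual_norm_def abs_minus_commute)
  have E: "E_data S \<omega> u l q = sqrt ((hm2norm S (\<lambda>v. l v - opB S u v))\<^sup>2 + (l2norm \<omega> (\<lambda>x. u x - q x))\<^sup>2)"
    by (simp add: E_data_def prod_norm_def opA_def h l2norm_opC)
  show "l2norm \<omega> (\<lambda>x. u x - q x) \<le> E_data S \<omega> u l q" unfolding E by (rule real_le_rsqrt) simp
  show "hm2norm S (\<lambda>v. l v - opB S u v) \<le> E_data S \<omega> u l q" unfolding E by (rule real_le_rsqrt) simp
qed

lemma sum_norm_le:
  assumes "\<And>v. v \<in> V \<Longrightarrow> 0 \<le> N v" "\<And>w. w \<in> W \<Longrightarrow> 0 \<le> M w"
    and "v \<in> V" "w \<in> W"
  shows "sum_norm V N W M (\<lambda>x. v x + w x) \<le> N v + M w"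
  unfolding sum_norm_def
proof (rule cInf_lower)
  show "bdd_below {N v' + M w' |v' w'. v' \<in> V \<and> w' \<in> W \<and> (\<lambda>x. v x + w x) = (\<lambda>x. v' x + w' x)}"
    by (rule bdd_belowI[of _ 0]) (use assms in \<open>auto intro: add_nonneg_nonneg\<close>)
qed (use assms in blast)

lemma sum_norm_nonneg:
  assumes "\<And>v. v \<in> V \<Longrightarrow> 0 \<le> N v" "\<And>w. w \<in> W \<Longrightarrow> 0 \<le> M w" "u \<in> sum_space V W"
  shows "0 \<le> sum_norm V N W M u"
  unfolding sum_norm_def
  by (rule cInf_greatest) (use assms in \<open>auto simp: sum_space_def intro: add_nonneg_nonneg\<close>)

text \<open>The analysis of a single discretization; all constants are independent of it.\<close>

lemma lsq_estimate:
  fixes S \<omega> :: "(real^'n::finite) set"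
  assumes S: "open S" "bounded S" and om: "\<omega> \<subseteq> S" "open \<omega>"
    and X: "fin_dim_space S X" "X \<subseteq> L2 S"
    and Y: "fin_dim_space S Y" "inner_product_on S Y ip"
    and E: "\<And>v. v \<in> Y \<Longrightarrow> E v \<in> H20 S" "\<And>v. v \<in> Y \<Longrightarrow> h2norm S (E v) \<le> KE * ip_norm ip v" "0 \<le> KE"
    and Q: "\<And>v. v \<in> H20 S \<Longrightarrow> Q v \<in> Y" "\<And>v. v \<in> H20 S \<Longrightarrow> ip_norm ip (Q v) \<le> KQ * h2norm S v" "0 \<le> KQ"
      "\<And>z v. z \<in> X \<Longrightarrow> v \<in> H20 S \<Longrightarrow> B z (\<lambda>x. v x - Q v x) = 0"
    and B: "B \<in> bounded_dual_op (L2 S) (l2norm S) (sum_space (H20 S) Y) (sum_norm (H20 S) (h2norm S) Y (ip_norm ip))"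
      "\<And>z v. z \<in> L2 S \<Longrightarrow> v \<in> H20 S \<Longrightarrow> B z v = opB S z v"
    and l: "l \<in> Hm2 S" and ld: "ld \<in> dual Y (ip_norm ip)" and q: "q \<in> L2 \<omega>" and u: "u \<in> L2 S"
    and osc: "0 \<le> osc" "0 \<le> C1"
      "\<And>z. z \<in> X \<Longrightarrow> dual_norm Y (ip_norm ip) (\<lambda>v. B z (\<lambda>x. v x - E v x) + l (E v) - ld v)
         \<le> C1 * (hm2norm S (\<lambda>v. l v - opB S u v) + l2norm S (\<lambda>x. u x - z x) + osc)"
    and \<E>: "\<E> = E_data S \<omega> u l q + E_appr S X u + osc"
    and eps: "0 < \<epsilon>" "\<epsilon> \<le> \<epsilon>0" "\<epsilon> * l2norm S u \<le> c2 * \<E>" "0 \<le> c2"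
    and A1: "A1 = C1 + (real CARD('n) + 1) * KE" and A2: "A2 = A1 + 2 + c2 + \<epsilon>0"
    and A3: "A3 = (A2 + A1) * KQ + real CARD('n)"
    and ue: "ue = lsq_solution S \<omega> X Y (ip_norm ip) B \<epsilon> ld q"
  shows "0 \<le> \<E>" and "ue \<in> L2 S" and "l2norm \<omega> (\<lambda>x. u x - ue x) \<le> (1 + A2) * \<E>"
    and "\<epsilon> * l2norm S ue \<le> A2 * \<E>"
    and "\<And>v. v \<in> H20 S \<Longrightarrow> \<bar>opB S (\<lambda>x. u x - ue x) v\<bar> \<le> A3 * \<E> * h2norm S v"
proof -
  let ?N = "ip_norm ip" and ?n = "real CARD('n)"
  let ?H = "H20 S" and ?h = "h2norm S"
  let ?W = "sum_space ?H Y" and ?M = "sum_norm ?H ?h Y ?N"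
  have N0: "0 \<le> ?N v" if "v \<in> Y" for v using Y(2) that by (simp add: inner_product_on_def ip_norm_def)
  have h0: "0 \<le> ?h v" for v by simp
  have zY: "(\<lambda>x. 0) \<in> Y" by (rule fin_dim_space_zero[OF Y(1)])
  have zH: "(\<lambda>x. 0) \<in> ?H" by (rule test_H20[OF S test_functions_zero])
  have Yne: "Y \<noteq> {}" and Hne: "?H \<noteq> {}" using zY zH by blast+
  have Nz: "?N (\<lambda>x. 0) = 0"
  proof -
    have "ip (\<lambda>x. 0) (\<lambda>x. 0) = 0 \<longleftrightarrow> ae_eq S (\<lambda>x. 0 :: real) (\<lambda>x. 0)"
      using Y(2) zY unfolding inner_product_on_def by blast
    then show ?thesis by (simp add: ip_norm_def ae_eq_def)
  qed
  have HW: "v \<in> ?W" if "v \<in> ?H" for v unfolding sum_space_def using that zY by force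
  have YW: "v \<in> ?W" if "v \<in> Y" for v unfolding sum_space_def using that zH by force
  have mY: "(\<lambda>x. - v x) \<in> Y" if "v \<in> Y" for v using fin_dim_space_comb[OF Y(1) that that, of "-1" 0] by simp
  have mH: "(\<lambda>x. - v x) \<in> ?H" if "v \<in> ?H" for v by (rule H20_minus[OF S that])
  \<comment> \<open>The decomposition \<open>v = 0 + v\<close> shows that functionals on the sum
    space restrict to \<open>Y\<close> with no larger norm.\<close>
  have MY: "?M v \<le> ?N v" if "v \<in> Y" for v
    using sum_norm_le[of ?H ?h Y ?N "\<lambda>x. 0" v] zH that N0 h2norm_zero[OF S] by simp
  have M0: "0 \<le> ?M v" if "v \<in> ?W" for v by (rule sum_norm_nonneg[OF h0 N0 that])
  have Bd: "B z \<in> dual ?W ?M" if "z \<in> L2 S" for z using B(1) that by (simp add: bounded_dual_op_def)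
  have Badd: "B z (\<lambda>x. v x + w x) = B z v + B z w" if "z \<in> L2 S" "v \<in> ?W" "w \<in> ?W" for z v w
    using Bd[OF that(1)] that by (simp add: dual_def)
  have Bneg: "B z (\<lambda>x. - v x) = - B z v" if "z \<in> L2 S" "v \<in> ?W" for z v
  proof -
    have "B z (\<lambda>x. -1 * v x) = -1 * B z v" using Bd[OF that(1)] that(2) unfolding dual_def by blast
    then show ?thesis by simp
  qed
  have Bzdiff: "B (\<lambda>x. z x - z' x) v = B z v - B z' v" if z: "z \<in> L2 S" "z' \<in> L2 S" and v: "v \<in> ?W" for z z' v
  proof -
    have add: "\<forall>z\<in>L2 S. \<forall>z'\<in>L2 S. \<forall>w\<in>?W. B (\<lambda>x. z x + z' x) w = B z w + B z' w"
      and mult: "\<forall>c. \<forall>z\<in>L2 S. \<forall>w\<in>?W. B (\<lambda>x. c * z x) w = c * B z w"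
      using B(1) unfolding bounded_dual_op_def mem_Collect_eq by blast+
    have "B (\<lambda>x. z x + (-1) * z' x) v = B z v + B (\<lambda>x. (-1) * z' x) v"
      by (rule add[rule_format, OF z(1) L2_cmult[OF z(2)] v])
    moreover have "B (\<lambda>x. (-1) * z' x) v = (-1) * B z' v"
      by (rule mult[rule_format, OF z(2) v])
    ultimately show ?thesis by simp
  qed
  obtain CB0 where CB0: "\<And>z. z \<in> L2 S \<Longrightarrow> dual_norm ?W ?M (B z) \<le> CB0 * l2norm S z"
    using B(1) unfolding bounded_dual_op_def by blast
  \<comment> \<open>This bound for \<open>B\<close> on \<open>Y\<close> may depend on the
    discretization. It guarantees finite suprema and a continuous functional, and is kept out of
    \<open>A1\<close>, \<open>A2\<close> and \<open>A3\<close>.\<close>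
  define CB where "CB = max CB0 0"
  have BY: "\<bar>B z v\<bar> \<le> CB * l2norm S z * ?N v" if z: "z \<in> L2 S" and v: "v \<in> Y" for z v
  proof -
    obtain C where C: "\<And>v. v \<in> ?W \<Longrightarrow> \<bar>B z v\<bar> \<le> C * ?M v" using Bd[OF z] unfolding dual_def by blast
    have "\<bar>B z v\<bar> \<le> dual_norm ?W ?M (B z) * ?M v" by (rule dual_norm_bound[OF M0 C YW[OF v]])
    also have "\<dots> \<le> (CB0 * l2norm S z) * ?M v" by (rule mult_right_mono[OF CB0[OF z] M0[OF YW[OF v]]])
    also have "\<dots> \<le> (CB * l2norm S z) * ?M v"
      using M0[OF YW[OF v]] by (intro mult_right_mono) (auto simp: CB_def)
    also have "\<dots> \<le> (CB * l2norm S z) * ?N v"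
      by (rule mult_left_mono[OF MY[OF v]]) (simp add: CB_def)
    finally show ?thesis .
  qed
  obtain D where D: "\<And>v. v \<in> Y \<Longrightarrow> \<bar>ld v\<bar> \<le> D * ?N v" using ld unfolding dual_def by blast
  obtain Cl where Cl: "\<And>v. v \<in> ?H \<Longrightarrow> \<bar>l v\<bar> \<le> Cl * ?h v" using l unfolding Hm2_def dual_def by blast
  have oB: "\<bar>opB S z v\<bar> \<le> ?n * l2norm S z * ?h v" if "z \<in> L2 S" "v \<in> ?H" for z v
    by (rule opB_bound[OF S that(1) H20_H2[OF S that(2)]])
  have oBd: "opB S (\<lambda>x. z x - z' x) v = opB S z v - opB S z' v" if "z \<in> L2 S" "z' \<in> L2 S" "v \<in> ?H" for z z' v
    by (rule opB_diff[OF S that(1,2) H20_H2[OF S that(3)]])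
  let ?d = "hm2norm S (\<lambda>v. l v - opB S u v)"
  have lB: "\<bar>l v - opB S u v\<bar> \<le> (Cl + ?n * l2norm S u) * ?h v" if "v \<in> ?H" for v
    using Cl[OF that] oB[OF u that] by (simp add: distrib_right)
  have d: "\<bar>l v - opB S u v\<bar> \<le> ?d * ?h v" if "v \<in> ?H" for v
    unfolding hm2norm_def by (rule dual_norm_bound[OF h0 lB that])
  have d0: "0 \<le> ?d" unfolding hm2norm_def by (rule dual_norm_nonneg[OF h0 lB Hne])
  have dE: "?d \<le> E_data S \<omega> u l q" by (rule E_data_bounds(2)[OF d0])
  have Xne: "X \<noteq> {}" using fin_dim_space_zero[OF X(1)] by blast
  have Ebdd: "bdd_below ((\<lambda>z. l2norm S (\<lambda>x. u x - z x)) ` X)" by (rule bdd_belowI2[of _ 0]) simp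
  have Ea0: "0 \<le> E_appr S X u" unfolding E_appr_def by (rule cINF_greatest[OF Xne]) simp
  have Ed0: "0 \<le> E_data S \<omega> u l q" using d0 dE by linarith
  show E0: "0 \<le> \<E>" using Ed0 Ea0 osc(1) by (simp add: \<E>)
  have oms: "\<omega> \<in> sets lebesgue" "S \<in> sets lebesgue" using om(2) S(1) by auto
  let ?F = "lsq_functional S \<omega> Y ?N B \<epsilon> ld q"
  have CB: "0 \<le> CB" by (simp add: CB_def)
  have ueX: "ue \<in> X"
    unfolding ue
    by (rule lsq_solution_minimizes(1)[where N="?N" and B=B and ld=ld and C=CB and D=D,
          OF X om(1) oms Yne N0 CB BY Bzdiff[OF _ _ YW] D q eps(1)])
  have min: "?F ue \<le> ?F z" if "z \<in> X" for z
    unfolding ue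
    by (rule lsq_solution_minimizes(2)[where N="?N" and B=B and ld=ld and C=CB and D=D,
          OF X om(1) oms Yne N0 CB BY Bzdiff[OF _ _ YW] D q eps(1) that])
  show ueL: "ue \<in> L2 S" using ueX X(2) by blast
  have uq: "l2norm \<omega> (\<lambda>x. u x - q x) \<le> \<E>"
    using E_data_bounds(1)[of \<omega> u q S l] Ea0 osc(1) by (simp add: \<E>)
  have A10: "0 \<le> A1" using osc(2) E(3) by (simp add: A1)
  have A20: "0 \<le> A2" using A10 eps by (simp add: A2)
  have dn0: "0 \<le> dual_norm Y ?N (\<lambda>v. B z v - ld v)"
    and dnb: "v \<in> Y \<Longrightarrow> \<bar>B z v - ld v\<bar> \<le> dual_norm Y ?N (\<lambda>v. B z v - ld v) * ?N v" if "z \<in> L2 S" for z v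
  proof -
    have *: "\<bar>B z v - ld v\<bar> \<le> (CB * l2norm S z + D) * ?N v" if "v \<in> Y" for v
      using BY[OF \<open>z \<in> L2 S\<close> that] D[OF that] by (simp add: distrib_right)
    show "0 \<le> dual_norm Y ?N (\<lambda>v. B z v - ld v)" by (rule dual_norm_nonneg[OF N0 * Yne])
    show "v \<in> Y \<Longrightarrow> \<bar>B z v - ld v\<bar> \<le> dual_norm Y ?N (\<lambda>v. B z v - ld v) * ?N v"
      by (rule dual_norm_bound[OF N0 *])
  qed
  \<comment> \<open>\<open>E_appr\<close> is an infimum. Any \<open>t\<close> above
    \<open>\<E>\<close> leaves room for a competitor \<open>z\<close> in \<open>X\<close> with
    \<open>?d + ?a + osc \<le> t\<close>.\<close>
  have key: "l2norm \<omega> (\<lambda>x. ue x - q x) \<le> A2 * t \<and> \<epsilon> * l2norm S ue \<le> A2 * t \<and>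
      (\<forall>v\<in>?H. \<bar>opB S (\<lambda>x. u x - ue x) v\<bar> \<le> A3 * t * ?h v)" if t: "t > \<E>" for t
  proof -
    have t0: "0 \<le> t" using t E0 by simp
    have "E_appr S X u < E_appr S X u + (t - \<E>)" using t by simp
    then obtain z where z: "z \<in> X" "l2norm S (\<lambda>x. u x - z x) < E_appr S X u + (t - \<E>)"
      unfolding E_appr_def using cINF_less_iff[OF Xne Ebdd] by blast
    let ?a = "l2norm S (\<lambda>x. u x - z x)"
    have zL: "z \<in> L2 S" using z(1) X(2) by blast
    have sum_t: "?d + ?a + osc \<le> t" using dE z(2) by (simp add: \<E>)
    have at: "?a \<le> t" and dt: "?d \<le> t" using sum_t d0 osc(1) l2norm_nonneg[of S "\<lambda>x. u x - z x"] by linarith+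
    have zu: "\<bar>opB S z v - opB S u v\<bar> \<le> ?n * t * ?h v" if v: "v \<in> ?H" for v
    proof -
      have "\<bar>opB S z v - opB S u v\<bar> \<le> ?n * ?a * ?h v"
        using oB[OF L2_diff[OF u zL] v] oBd[OF u zL v] by (simp add: abs_minus_commute)
      also have "\<dots> \<le> ?n * t * ?h v" using at by (intro mult_right_mono mult_left_mono) auto
      finally show ?thesis .
    qed
    \<comment> \<open>Insert the continuous residual at \<open>E v\<close>. The consistency
      functional contributes \<open>C1\<close>; the residual \<open>opB S z (E v) - l (E v)\<close>
      contributes \<open>(?n + 1) * KE\<close>, with \<open>?n\<close> from replacing
      \<open>z\<close> by \<open>u\<close> and 1 from the data error. This is the origin of
      \<open>A1\<close>.\<close>
    have n1: "dual_norm Y ?N (\<lambda>v. B z v - ld v) \<le> A1 * t"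
    proof (rule dual_norm_le[OF N0 _ Yne])
      show "0 \<le> A1 * t" using A10 t0 by simp
      let ?g = "\<lambda>v. B z (\<lambda>x. v x - E v x) + l (E v) - ld v"
      have split: "B z (\<lambda>x. v x - E v x) = B z v - opB S z (E v)" if v: "v \<in> Y" for v
        using Badd[OF zL YW[OF v] HW[OF mH[OF E(1)[OF v]]]] Bneg[OF zL HW[OF E(1)[OF v]]] B(2)[OF zL E(1)[OF v]]
        by simp
      have gb: "\<bar>?g v\<bar> \<le> (CB * l2norm S z + ?n * l2norm S z * KE + \<bar>Cl\<bar> * KE + D) * ?N v" if v: "v \<in> Y" for v
      proof -
        have "\<bar>opB S z (E v)\<bar> \<le> ?n * l2norm S z * (KE * ?N v)"
          by (rule order_trans[OF oB[OF zL E(1)[OF v]] mult_left_mono[OF E(2)[OF v]]]) simp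
        moreover have "\<bar>l (E v)\<bar> \<le> \<bar>Cl\<bar> * (KE * ?N v)"
        proof -
          have "\<bar>l (E v)\<bar> \<le> Cl * ?h (E v)" by (rule Cl[OF E(1)[OF v]])
          also have "\<dots> \<le> \<bar>Cl\<bar> * ?h (E v)" by (intro mult_right_mono) auto
          also have "\<dots> \<le> \<bar>Cl\<bar> * (KE * ?N v)" by (intro mult_left_mono E(2)[OF v]) auto
          finally show ?thesis .
        qed
        ultimately show ?thesis
          using BY[OF zL v] D[OF v] unfolding split[OF v] by (simp add: distrib_right mult.assoc)
      qed
      fix v assume v: "v \<in> Y"
      have "\<bar>?g v\<bar> \<le> dual_norm Y ?N ?g * ?N v" by (rule dual_norm_bound[OF N0 gb v])
      also have "\<dots> \<le> (C1 * t) * ?N v"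
      proof (rule mult_right_mono[OF _ N0[OF v]])
        have "dual_norm Y ?N ?g \<le> C1 * (?d + ?a + osc)" by (rule osc(3)[OF z(1)])
        also have "\<dots> \<le> C1 * t" using sum_t osc(2) by (rule mult_left_mono)
        finally show "dual_norm Y ?N ?g \<le> C1 * t" .
      qed
      finally have 1: "\<bar>?g v\<bar> \<le> C1 * t * ?N v" .
      have "\<bar>opB S z (E v) - l (E v)\<bar> \<le> ?n * t * ?h (E v) + ?d * ?h (E v)"
        using zu[OF E(1)[OF v]] d[OF E(1)[OF v]] by linarith
      also have "\<dots> \<le> ?n * t * ?h (E v) + t * ?h (E v)" using dt by (intro add_left_mono mult_right_mono) auto
      also have "\<dots> = (?n + 1) * t * ?h (E v)" by (simp add: distrib_right)
      also have "\<dots> \<le> (?n + 1) * t * (KE * ?N v)" using t0 by (intro mult_left_mono E(2)[OF v]) auto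
      finally have "\<bar>opB S z (E v) - l (E v)\<bar> \<le> (?n + 1) * KE * t * ?N v" by (simp add: mult_ac)
      moreover have "B z v - ld v = ?g v + (opB S z (E v) - l (E v))" by (simp add: split[OF v])
      ultimately show "\<bar>B z v - ld v\<bar> \<le> A1 * t * ?N v" using 1 by (simp add: A1 distrib_right)
    qed
    \<comment> \<open>One \<open>t\<close> for \<open>z - u\<close> and one for the data error of
      \<open>u\<close>: this is the 2 in \<open>A2\<close>.\<close>
    have n2: "l2norm \<omega> (\<lambda>x. z x - q x) \<le> 2 * t"
    proof -
      have "l2norm \<omega> (\<lambda>x. z x - q x) \<le> l2norm \<omega> (\<lambda>x. z x - u x) + l2norm \<omega> (\<lambda>x. u x - q x)"
        using L2_subset(1)[OF _ om(1) oms] zL u q by (intro l2norm_triangle3) auto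
      moreover have "l2norm \<omega> (\<lambda>x. z x - u x) \<le> ?a"
        using L2_subset(2)[OF L2_diff[OF zL u] om(1) oms] l2norm_minus_commute[of S z u] by simp
      ultimately show ?thesis using at uq t by simp
    qed
    \<comment> \<open>The upper coupling bound takes care of \<open>\<epsilon> * l2norm S u\<close>,
      and \<open>\<epsilon> \<le> \<epsilon>0\<close> of the difference
      \<open>u - z\<close>.\<close>
    have n3: "\<epsilon> * l2norm S z \<le> (c2 + \<epsilon>0) * t"
    proof -
      have "l2norm S z \<le> l2norm S u + ?a"
        using l2norm_triangle_diff[OF u L2_diff[OF u zL]] by simp
      then have "\<epsilon> * l2norm S z \<le> \<epsilon> * l2norm S u + \<epsilon> * ?a" using eps(1) by (simp add: distrib_left[symmetric])
      moreover have "\<epsilon> * ?a \<le> \<epsilon>0 * t" using eps at by (intro mult_mono) auto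
      moreover have "c2 * \<E> \<le> c2 * t" using t eps(4) by (intro mult_left_mono) auto
      ultimately show ?thesis using eps(3) by (simp add: distrib_right)
    qed
    have Fz: "?F z \<le> (A2 * t)\<^sup>2"
    proof -
      have 1: "0 \<le> A1 * t" "0 \<le> 2 * t" "0 \<le> (c2 + \<epsilon>0) * t" using A10 t0 eps by auto
      have "?F z \<le> (A1 * t)\<^sup>2 + (2 * t)\<^sup>2 + ((c2 + \<epsilon>0) * t)\<^sup>2"
        unfolding lsq_functional_def l2norm_opC power_mult_distrib[of \<epsilon>, symmetric]
        using dn0[OF zL] eps(1) by (intro add_mono power_mono n1 n2 n3) auto
      also have "\<dots> \<le> (A1 * t + 2 * t + (c2 + \<epsilon>0) * t)\<^sup>2"
        using mult_nonneg_nonneg[OF 1(1,2)] mult_nonneg_nonneg[OF 1(1,3)] mult_nonneg_nonneg[OF 1(2,3)]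
        by (simp add: power2_sum) (simp add: power2_eq_square algebra_simps)
      also have "\<dots> = (A2 * t)\<^sup>2" by (simp add: A2 algebra_simps)
      finally show ?thesis .
    qed
    then have Fu: "?F ue \<le> (A2 * t)\<^sup>2" using min[OF z(1)] by linarith
    have At: "0 \<le> A2 * t" using A20 t0 by simp
    have sq: "(dual_norm Y ?N (\<lambda>v. B ue v - ld v))\<^sup>2 + (l2norm \<omega> (\<lambda>x. ue x - q x))\<^sup>2 + (\<epsilon> * l2norm S ue)\<^sup>2 \<le> (A2 * t)\<^sup>2"
      using Fu unfolding lsq_functional_def l2norm_opC power_mult_distrib[of \<epsilon>, symmetric] .
    have p: "(dual_norm Y ?N (\<lambda>v. B ue v - ld v))\<^sup>2 \<le> (A2 * t)\<^sup>2" "(l2norm \<omega> (\<lambda>x. ue x - q x))\<^sup>2 \<le> (A2 * t)\<^sup>2"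
      "(\<epsilon> * l2norm S ue)\<^sup>2 \<le> (A2 * t)\<^sup>2"
      using sq zero_le_power2[of "dual_norm Y ?N (\<lambda>v. B ue v - ld v)"] zero_le_power2[of "l2norm \<omega> (\<lambda>x. ue x - q x)"]
        zero_le_power2[of "\<epsilon> * l2norm S ue"] by linarith+
    have m1: "dual_norm Y ?N (\<lambda>v. B ue v - ld v) \<le> A2 * t" by (rule power2_le_imp_le[OF p(1) At])
    \<comment> \<open>Elements of \<open>X\<close> cannot distinguish \<open>v\<close> from
      \<open>Q v\<close>, so a residual bound on the finite dimensional \<open>Y\<close> yields one
      on all of \<open>H20\<close>.\<close>
    have fortin: "B z' v = B z' (Q v)" if z': "z' \<in> X" and v: "v \<in> ?H" for z' v
    proof -
      have L: "z' \<in> L2 S" using z' X(2) by blast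
      have "B z' (\<lambda>x. v x + - Q v x) = B z' v - B z' (Q v)"
        using Badd[OF L HW[OF v] YW[OF mY[OF Q(1)[OF v]]]] Bneg[OF L YW[OF Q(1)[OF v]]] by simp
      then show ?thesis using Q(4)[OF z' v] by simp
    qed
    \<comment> \<open>The comparison passes through \<open>z\<close>, because the Fortin identity
      speaks about elements of \<open>X\<close>. The discrete residuals of \<open>ue\<close> and
      \<open>z\<close> give \<open>(A2 + A1) * KQ\<close>, and replacing \<open>z\<close> by
      \<open>u\<close> gives the summand \<open>?n\<close> of \<open>A3\<close>.\<close>
    have "\<bar>opB S (\<lambda>x. u x - ue x) v\<bar> \<le> A3 * t * ?h v" if v: "v \<in> ?H" for v
    proof -
      have b: "opB S ue v = B ue (Q v)" "opB S z v = B z (Q v)"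
        using fortin[OF ueX v] fortin[OF z(1) v] B(2)[OF ueL v] B(2)[OF zL v] by simp_all
      have NQ: "0 \<le> ?N (Q v)" by (rule N0[OF Q(1)[OF v]])
      have "\<bar>B ue (Q v) - ld (Q v)\<bar> \<le> A2 * t * ?N (Q v)"
        using dnb[OF ueL Q(1)[OF v]] mult_right_mono[OF m1 NQ] by linarith
      moreover have "\<bar>B z (Q v) - ld (Q v)\<bar> \<le> A1 * t * ?N (Q v)"
        using dnb[OF zL Q(1)[OF v]] mult_right_mono[OF n1 NQ] by linarith
      ultimately have "\<bar>opB S ue v - opB S z v\<bar> \<le> (A2 + A1) * t * ?N (Q v)"
        unfolding b by (simp add: distrib_right)
      also have "\<dots> \<le> (A2 + A1) * t * (KQ * ?h v)"
        using A10 A20 t0 by (intro mult_left_mono Q(2)[OF v]) auto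
      finally have "\<bar>opB S ue v - opB S z v\<bar> \<le> (A2 + A1) * KQ * t * ?h v" by (simp add: mult_ac)
      then show ?thesis
        using zu[OF v] unfolding oBd[OF u ueL v] by (simp add: A3 distrib_right)
    qed
    then show ?thesis
      using power2_le_imp_le[OF p(2) At] power2_le_imp_le[OF p(3) At] by blast
  qed
  \<comment> \<open>A limit is taken because \<open>\<E>\<close> may be 0, in which case no fixed
    multiple of \<open>\<E>\<close> would be an admissible \<open>t\<close>.\<close>
  have limit: "a \<le> K * \<E>" if "\<And>t. t > \<E> \<Longrightarrow> a \<le> K * t" for a K
  proof (rule tendsto_lowerbound)
    show "((\<lambda>t. K * t) \<longlongrightarrow> K * \<E>) (at_right \<E>)" by (intro tendsto_intros)
    show "\<forall>\<^sub>F t in at_right \<E>. a \<le> K * t" using that by (auto simp: eventually_at_filter)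
  qed simp
  have "l2norm \<omega> (\<lambda>x. ue x - q x) \<le> A2 * \<E>" by (rule limit) (use key in blast)
  moreover have "l2norm \<omega> (\<lambda>x. u x - ue x) \<le> l2norm \<omega> (\<lambda>x. u x - q x) + l2norm \<omega> (\<lambda>x. q x - ue x)"
    using L2_subset(1)[OF _ om(1) oms] ueL u q by (intro l2norm_triangle3) auto
  ultimately show "l2norm \<omega> (\<lambda>x. u x - ue x) \<le> (1 + A2) * \<E>"
    using uq l2norm_minus_commute[of \<omega> q ue] by (simp add: distrib_right)
  show "\<epsilon> * l2norm S ue \<le> A2 * \<E>" by (rule limit) (use key in blast)
  show "\<bar>opB S (\<lambda>x. u x - ue x) v\<bar> \<le> A3 * \<E> * ?h v" if v: "v \<in> ?H" for v
  proof -
    have "\<bar>opB S (\<lambda>x. u x - ue x) v\<bar> \<le> (A3 * ?h v) * \<E>"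
    proof (rule limit)
      fix t assume "t > \<E>"
      then have "\<bar>opB S (\<lambda>x. u x - ue x) v\<bar> \<le> A3 * t * ?h v" using key v by blast
      then show "\<bar>opB S (\<lambda>x. u x - ue x) v\<bar> \<le> (A3 * ?h v) * t" by (simp add: mult_ac)
    qed
    then show ?thesis by (simp add: mult_ac)
  qed
qed

section \<open>Uniform constants and interpolation of the harmonic part\<close>

theorem corollary5p3:
  fixes \<omega> G \<Omega> :: "(real^'n) set"
    and \<alpha> \<epsilon>\<^sub>0 c\<^sub>1 c\<^sub>2 C\<^sub>1 :: real
    and I :: "'i set"
    and X Y :: "'i \<Rightarrow> 'n fn set"
    and ip :: "'i \<Rightarrow> 'n fn \<Rightarrow> 'n fn \<Rightarrow> real"
    and E Q :: "'i \<Rightarrow> 'n fn \<Rightarrow> 'n fn"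
    and B :: "'i \<Rightarrow> 'n fn \<Rightarrow> 'n fn \<Rightarrow> real"
  assumes domains: "bounded_domain \<omega>" "bounded_domain G" "bounded_domain \<Omega>"
      "\<omega> \<subseteq> G" "G \<Subset> \<Omega>"
    and alpha: "0 < \<alpha>" "\<alpha> \<le> 1"
      "\<exists>C\<^sub>0. \<forall>w\<in>L2 \<Omega>. harmonic_on \<Omega> w \<longrightarrow>
         l2norm G w \<le> C\<^sub>0 * rpow (l2norm \<omega> w) \<alpha> * rpow (l2norm \<Omega> w) (1 - \<alpha>)"
    and X: "\<forall>\<delta>\<in>I. fin_dim_space \<Omega> (X \<delta>) \<and> X \<delta> \<subseteq> L2 \<Omega>"
    and Y: "\<forall>\<delta>\<in>I. fin_dim_space \<Omega> (Y \<delta>) \<and> inner_product_on \<Omega> (Y \<delta>) (ip \<delta>)"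
    and E: "\<forall>\<delta>\<in>I. E \<delta> \<in> bounded_op \<Omega> (Y \<delta>) (ip_norm (ip \<delta>)) (H20 \<Omega>) (h2norm \<Omega>)"
      "bdd_above ((\<lambda>\<delta>. op_norm (Y \<delta>) (ip_norm (ip \<delta>)) (h2norm \<Omega>) (E \<delta>)) ` I)"
    and B: "\<forall>\<delta>\<in>I. B \<delta> \<in> bounded_dual_op (L2 \<Omega>) (l2norm \<Omega>)
              (sum_space (H20 \<Omega>) (Y \<delta>))
              (sum_norm (H20 \<Omega>) (h2norm \<Omega>) (Y \<delta>) (ip_norm (ip \<delta>)))"
      "\<forall>\<delta>\<in>I. \<forall>z\<in>L2 \<Omega>. \<forall>v\<in>H20 \<Omega>. B \<delta> z v = opB \<Omega> z v"
    and Q: "\<forall>\<delta>\<in>I. Q \<delta> \<in> bounded_op \<Omega> (H20 \<Omega>) (h2norm \<Omega>) (Y \<delta>) (ip_norm (ip \<delta>))"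
      "bdd_above ((\<lambda>\<delta>. op_norm (H20 \<Omega>) (h2norm \<Omega>) (ip_norm (ip \<delta>)) (Q \<delta>)) ` I)"
      "\<forall>\<delta>\<in>I. \<forall>z\<in>X \<delta>. \<forall>v\<in>H20 \<Omega>. B \<delta> z (\<lambda>x. v x - Q \<delta> v x) = 0"
    and pos: "\<epsilon>\<^sub>0 > 0" "c\<^sub>1 > 0" "c\<^sub>2 > 0" "C\<^sub>1 > 0"
  shows "\<exists>K. \<forall>\<delta>\<in>I. \<forall>l\<in>Hm2 \<Omega>. \<forall>l\<delta>\<in>dual (Y \<delta>) (ip_norm (ip \<delta>)). \<forall>q\<in>L2 \<omega>. \<forall>u\<in>L2 \<Omega>.
    \<forall>osc\<ge>0. \<forall>\<epsilon>. \<forall>\<E>.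
      (\<forall>z\<in>X \<delta>.
         dual_norm (Y \<delta>) (ip_norm (ip \<delta>))
           (\<lambda>v. B \<delta> z (\<lambda>x. v x - E \<delta> v x) + l (E \<delta> v) - l\<delta> v)
         \<le> C\<^sub>1 * (hm2norm \<Omega> (\<lambda>v. l v - opB \<Omega> u v) + l2norm \<Omega> (\<lambda>x. u x - z x) + osc)) \<longrightarrow>
      \<E> = E_data \<Omega> \<omega> u l q + E_appr \<Omega> (X \<delta>) u + osc \<longrightarrow>
      0 < \<epsilon> \<and> \<epsilon> \<le> \<epsilon>\<^sub>0 \<longrightarrow>
      c\<^sub>1 * \<E> \<le> \<epsilon> * l2norm \<Omega> u \<and> \<epsilon> * l2norm \<Omega> u \<le> c\<^sub>2 * \<E> \<longrightarrow>
      l2norm G (\<lambda>x. u x - lsq_solution \<Omega> \<omega> (X \<delta>) (Y \<delta>) (ip_norm (ip \<delta>)) (B \<delta>) \<epsilon> l\<delta> q x)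
        \<le> K * rpow \<E> \<alpha> * rpow (max \<E> (l2norm \<Omega> u)) (1 - \<alpha>)"
proof -
  note open_domains = domains[unfolded bounded_domain_def]
  have S: "open \<Omega>" "bounded \<Omega>" using open_domains by auto
  have om: "\<omega> \<subseteq> \<Omega>" "open \<omega>"
    using open_domains domains(4,5) closure_subset[of G] by (auto simp: compactly_inside_def)
  have G: "G \<subseteq> \<Omega>" "open G"
    using open_domains domains(5) closure_subset[of G] by (auto simp: compactly_inside_def)
  have sets: "\<Omega> \<in> sets lebesgue" "\<omega> \<in> sets lebesgue" "G \<in> sets lebesgue" using S om G by auto
  obtain C\<^sub>0 where C0: "\<And>w. w \<in> L2 \<Omega> \<Longrightarrow> harmonic_on \<Omega> w \<Longrightarrow>
      l2norm G w \<le> C\<^sub>0 * rpow (l2norm \<omega> w) \<alpha> * rpow (l2norm \<Omega> w) (1 - \<alpha>)"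
    using alpha(3) by blast
  obtain CH where CH: "CH \<ge> 0"
    "\<And>w H. w \<in> L2 \<Omega> \<Longrightarrow> 0 \<le> H \<Longrightarrow> (\<And>v. v \<in> H20 \<Omega> \<Longrightarrow> \<bar>opB \<Omega> w v\<bar> \<le> H * h2norm \<Omega> v) \<Longrightarrow>
       \<exists>h\<in>L2 \<Omega>. harmonic_on \<Omega> h \<and> l2norm \<Omega> (\<lambda>x. w x - h x) \<le> CH * H"
    using harmonic_splitting[OF S] by blast
  obtain KE0 where KE0: "\<And>\<delta>. \<delta> \<in> I \<Longrightarrow> op_norm (Y \<delta>) (ip_norm (ip \<delta>)) (h2norm \<Omega>) (E \<delta>) \<le> KE0"
    using E(2) by (auto simp: bdd_above_def)
  obtain KQ0 where KQ0: "\<And>\<delta>. \<delta> \<in> I \<Longrightarrow> op_norm (H20 \<Omega>) (h2norm \<Omega>) (ip_norm (ip \<delta>)) (Q \<delta>) \<le> KQ0"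
    using Q(2) by (auto simp: bdd_above_def)
  \<comment> \<open>Upper bounds delivered by \<open>bdd_above\<close> carry no sign, hence the
    maximum with 0.\<close>
  define KE KQ where "KE = max KE0 0" and "KQ = max KQ0 0"
  define A1 where "A1 = C\<^sub>1 + (real CARD('n) + 1) * KE"
  define A2 where "A2 = A1 + 2 + c\<^sub>2 + \<epsilon>\<^sub>0"
  define A3 where "A3 = (A2 + A1) * KQ + real CARD('n)"
  \<comment> \<open>\<open>A4\<close> bounds the harmonic part on \<open>\<omega>\<close>:
    \<open>1 + A2\<close> accounts for \<open>w\<close> and \<open>CH * A3\<close> for the part
    split off. In \<open>A5\<close>, which serves on the whole domain, 1 accounts for
    \<open>u\<close> and \<open>A2 / c\<^sub>1\<close> for \<open>ue\<close>.\<close>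
  define A4 where "A4 = 1 + A2 + CH * A3"
  define A5 where "A5 = 1 + A2 / c\<^sub>1 + CH * A3"
  \<comment> \<open>The absolute value makes the interpolation bound monotone in the norms of the
    harmonic part, as \<open>C\<^sub>0\<close> carries no sign. The last summand pays for the
    remaining part on \<open>G\<close>.\<close>
  define K where "K = \<bar>C\<^sub>0\<bar> * rpow A4 \<alpha> * rpow A5 (1 - \<alpha>) + CH * A3"
  have nn: "0 \<le> KE" "0 \<le> KQ" "0 \<le> A1" "0 \<le> A2" "0 \<le> A3" "0 \<le> A4" "0 \<le> A5"
    using pos CH(1) by (auto simp: KE_def KQ_def A1_def A2_def A3_def A4_def A5_def)
  show ?thesis
  proof (intro exI[of _ K] ballI allI impI, elim conjE)
    fix \<delta> l l\<delta> q u osc \<epsilon> \<E>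
    assume \<delta>: "\<delta> \<in> I" and l: "l \<in> Hm2 \<Omega>" and l\<delta>: "l\<delta> \<in> dual (Y \<delta>) (ip_norm (ip \<delta>))"
      and q: "q \<in> L2 \<omega>" and u: "u \<in> L2 \<Omega>" and osc: "0 \<le> (osc::real)"
      and cons: "\<forall>z\<in>X \<delta>.
         dual_norm (Y \<delta>) (ip_norm (ip \<delta>))
           (\<lambda>v. B \<delta> z (\<lambda>x. v x - E \<delta> v x) + l (E \<delta> v) - l\<delta> v)
         \<le> C\<^sub>1 * (hm2norm \<Omega> (\<lambda>v. l v - opB \<Omega> u v) + l2norm \<Omega> (\<lambda>x. u x - z x) + osc)"
      and \<E>: "\<E> = E_data \<Omega> \<omega> u l q + E_appr \<Omega> (X \<delta>) u + osc"
      and eps: "0 < \<epsilon>" "\<epsilon> \<le> \<epsilon>\<^sub>0" "c\<^sub>1 * \<E> \<le> \<epsilon> * l2norm \<Omega> u" "\<epsilon> * l2norm \<Omega> u \<le> c\<^sub>2 * \<E>"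
    let ?N = "ip_norm (ip \<delta>)"
    define ue where "ue = lsq_solution \<Omega> \<omega> (X \<delta>) (Y \<delta>) ?N (B \<delta>) \<epsilon> l\<delta> q"
    have N0: "0 \<le> ?N v" if "v \<in> Y \<delta>" for v
      using Y[rule_format, OF \<delta>] that by (simp add: inner_product_on_def ip_norm_def)
    have E': "E \<delta> v \<in> H20 \<Omega>" "h2norm \<Omega> (E \<delta> v) \<le> KE * ?N v" if v: "v \<in> Y \<delta>" for v
    proof -
      obtain C where C: "\<And>v. v \<in> Y \<delta> \<Longrightarrow> h2norm \<Omega> (E \<delta> v) \<le> C * ?N v"
        using E(1)[rule_format, OF \<delta>] unfolding bounded_op_def by blast
      have "h2norm \<Omega> (E \<delta> v) \<le> op_norm (Y \<delta>) ?N (h2norm \<Omega>) (E \<delta>) * ?N v"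
        by (rule op_norm_bound[where M="h2norm \<Omega>" and C=C]) (use N0 C v in auto)
      also have "\<dots> \<le> KE * ?N v"
        using KE0[OF \<delta>] N0[OF v] by (intro mult_right_mono) (auto simp: KE_def)
      finally show "h2norm \<Omega> (E \<delta> v) \<le> KE * ?N v" .
      show "E \<delta> v \<in> H20 \<Omega>" using E(1)[rule_format, OF \<delta>] v unfolding bounded_op_def by blast
    qed
    have Q': "Q \<delta> v \<in> Y \<delta>" "?N (Q \<delta> v) \<le> KQ * h2norm \<Omega> v" if v: "v \<in> H20 \<Omega>" for v
    proof -
      have QY: "Q \<delta> v \<in> Y \<delta>" if "v \<in> H20 \<Omega>" for v
        using Q(1)[rule_format, OF \<delta>] that unfolding bounded_op_def by blast
      then show "Q \<delta> v \<in> Y \<delta>" using v .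
      obtain C where C: "\<And>v. v \<in> H20 \<Omega> \<Longrightarrow> ?N (Q \<delta> v) \<le> C * h2norm \<Omega> v"
        using Q(1)[rule_format, OF \<delta>] unfolding bounded_op_def by blast
      have "?N (Q \<delta> v) \<le> op_norm (H20 \<Omega>) (h2norm \<Omega>) ?N (Q \<delta>) * h2norm \<Omega> v"
        by (rule op_norm_bound[where M="?N" and C=C]) (use N0 QY C v in auto)
      also have "\<dots> \<le> KQ * h2norm \<Omega> v"
        using KQ0[OF \<delta>] by (intro mult_right_mono) (auto simp: KQ_def)
      finally show "?N (Q \<delta> v) \<le> KQ * h2norm \<Omega> v" .
    qed
    have est: "0 \<le> \<E>" "ue \<in> L2 \<Omega>" "l2norm \<omega> (\<lambda>x. u x - ue x) \<le> (1 + A2) * \<E>"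
      "\<epsilon> * l2norm \<Omega> ue \<le> A2 * \<E>"
      "\<And>v. v \<in> H20 \<Omega> \<Longrightarrow> \<bar>opB \<Omega> (\<lambda>x. u x - ue x) v\<bar> \<le> A3 * \<E> * h2norm \<Omega> v"
    proof -
      have c2: "0 \<le> c\<^sub>2" and C1: "0 \<le> C\<^sub>1" using pos by auto
      have Xd: "fin_dim_space \<Omega> (X \<delta>)" "X \<delta> \<subseteq> L2 \<Omega>" using X \<delta> by auto
      have Yd: "fin_dim_space \<Omega> (Y \<delta>)" "inner_product_on \<Omega> (Y \<delta>) (ip \<delta>)" using Y \<delta> by auto
      note est = lsq_estimate[where E="E \<delta>" and Q="Q \<delta>" and B="B \<delta>" and ld=l\<delta>,
          OF S om Xd Yd E' nn(1) Q' nn(2) Q(3)[rule_format, OF \<delta>] B(1)[rule_format, OF \<delta>]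
            B(2)[rule_format, OF \<delta>] l l\<delta> q u osc C1 cons[rule_format] \<E> eps(1,2,4) c2 A1_def A2_def A3_def ue_def]
      show "0 \<le> \<E>" by (rule est(1))
      show "ue \<in> L2 \<Omega>" by (rule est(2))
      show "l2norm \<omega> (\<lambda>x. u x - ue x) \<le> (1 + A2) * \<E>" by (rule est(3))
      show "\<epsilon> * l2norm \<Omega> ue \<le> A2 * \<E>" by (rule est(4))
      show "\<bar>opB \<Omega> (\<lambda>x. u x - ue x) v\<bar> \<le> A3 * \<E> * h2norm \<Omega> v" if "v \<in> H20 \<Omega>" for v
        by (rule est(5)) (simp_all add: that)
    qed
    define w where "w x = u x - ue x" for x
    have wL: "w \<in> L2 \<Omega>" unfolding w_def[abs_def] by (rule L2_diff[OF u est(2)])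
    obtain h where h: "h \<in> L2 \<Omega>" "harmonic_on \<Omega> h" "l2norm \<Omega> (\<lambda>x. w x - h x) \<le> CH * (A3 * \<E>)"
      using CH(2)[OF wL, of "A3 * \<E>"] est(1,5) nn(5) by (auto simp: w_def[abs_def])
    let ?m = "max \<E> (l2norm \<Omega> u)"
    have m: "0 \<le> ?m" "\<E> \<le> ?m" "l2norm \<Omega> u \<le> ?m" using est(1) by auto
    have wh: "(\<lambda>x. w x - h x) \<in> L2 \<Omega>" by (rule L2_diff[OF wL h(1)])
    have sub: "f \<in> L2 T" "l2norm T f \<le> l2norm \<Omega> f" if "f \<in> L2 \<Omega>" "T = \<omega> \<or> T = G" for f T
      using L2_subset[OF that(1), of T] that(2) om G sets by auto
    have h\<omega>: "l2norm \<omega> h \<le> A4 * \<E>"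
    proof -
      have "l2norm \<omega> h \<le> l2norm \<omega> w + l2norm \<Omega> (\<lambda>x. w x - h x)"
        using l2norm_triangle_diff[OF sub(1)[OF wL, of \<omega>] sub(1)[OF wh, of \<omega>]] sub(2)[OF wh, of \<omega>] by simp
      also have "\<dots> \<le> (1 + A2) * \<E> + CH * (A3 * \<E>)"
        using est(3) h(3) by (intro add_mono) (auto simp: w_def[abs_def])
      finally show ?thesis by (simp add: A4_def algebra_simps)
    qed
    have h\<Omega>: "l2norm \<Omega> h \<le> A5 * ?m"
    proof -
      \<comment> \<open>The lower coupling bound replaces \<open>\<E>\<close> by a multiple of
        \<open>\<epsilon> * l2norm \<Omega> u\<close>, after which \<open>\<epsilon>\<close> cancels
        and the size of \<open>ue\<close> is controlled however small \<open>\<epsilon>\<close>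
        is.\<close>
      have "A2 * \<E> \<le> A2 * (\<epsilon> * l2norm \<Omega> u / c\<^sub>1)"
        using eps(3) pos nn(4) by (intro mult_left_mono) (auto simp: pos_le_divide_eq mult.commute)
      with est(4) have "\<epsilon> * l2norm \<Omega> ue \<le> \<epsilon> * (A2 / c\<^sub>1 * l2norm \<Omega> u)" by (simp add: mult_ac)
      then have ue: "l2norm \<Omega> ue \<le> A2 / c\<^sub>1 * l2norm \<Omega> u" using eps(1) by (simp only: mult_le_cancel_left_pos)
      have "l2norm \<Omega> (\<lambda>x. w x - (w x - h x)) \<le> l2norm \<Omega> w + l2norm \<Omega> (\<lambda>x. w x - h x)"
        by (intro l2norm_triangle_diff wL wh)
      then have "l2norm \<Omega> h \<le> l2norm \<Omega> w + l2norm \<Omega> (\<lambda>x. w x - h x)" by simp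
      moreover have "l2norm \<Omega> w \<le> l2norm \<Omega> u + l2norm \<Omega> ue"
        unfolding w_def[abs_def] by (rule l2norm_triangle_diff[OF u est(2)])
      ultimately have "l2norm \<Omega> h \<le> (1 + A2 / c\<^sub>1) * l2norm \<Omega> u + (CH * A3) * \<E>"
        using ue h(3) by (simp add: distrib_right)
      also have "\<dots> \<le> (1 + A2 / c\<^sub>1) * ?m + (CH * A3) * ?m"
        using m nn pos CH(1) by (intro add_mono mult_left_mono) auto
      finally show ?thesis by (simp add: A5_def distrib_right)
    qed
    let ?P = "rpow \<E> \<alpha> * rpow ?m (1 - \<alpha>)"
    have hG: "l2norm G h \<le> (\<bar>C\<^sub>0\<bar> * rpow A4 \<alpha> * rpow A5 (1 - \<alpha>)) * ?P"
    proof -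
      have "l2norm G h \<le> C\<^sub>0 * (rpow (l2norm \<omega> h) \<alpha> * rpow (l2norm \<Omega> h) (1 - \<alpha>))"
        using C0[OF h(1,2)] by (simp add: mult.assoc)
      also have "\<dots> \<le> \<bar>C\<^sub>0\<bar> * (rpow (l2norm \<omega> h) \<alpha> * rpow (l2norm \<Omega> h) (1 - \<alpha>))"
        by (intro mult_right_mono) auto
      also have "\<dots> \<le> \<bar>C\<^sub>0\<bar> * (rpow (A4 * \<E>) \<alpha> * rpow (A5 * ?m) (1 - \<alpha>))"
        using h\<omega> h\<Omega> alpha(1,2) by (intro mult_left_mono mult_mono rpow_mono) auto
      also have "\<dots> = (\<bar>C\<^sub>0\<bar> * rpow A4 \<alpha> * rpow A5 (1 - \<alpha>)) * ?P"
        using nn est(1) m(1) by (simp add: rpow_mult mult_ac)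
      finally show ?thesis .
    qed
    have rG: "l2norm G (\<lambda>x. w x - h x) \<le> (CH * A3) * ?P"
    proof -
      have 1: "l2norm G (\<lambda>x. w x - h x) \<le> (CH * A3) * \<E>" using sub(2)[OF wh, of G] h(3) by (simp add: mult.assoc)
      \<comment> \<open>The part split off is of order \<open>\<E>\<close> and has to fit the
        interpolated rate: split the power of \<open>\<E>\<close> and enlarge the base of the second
        factor to \<open>?m\<close>.\<close>
      have "\<E> \<le> ?P"
      proof -
        have "\<E> = rpow \<E> \<alpha> * rpow \<E> (1 - \<alpha>)" by (rule rpow_split[OF est(1)])
        also have "\<dots> \<le> ?P" using est(1) m(2) alpha(2) by (intro mult_left_mono rpow_mono) auto
        finally show ?thesis .
      qed
      then have "(CH * A3) * \<E> \<le> (CH * A3) * ?P" using CH(1) nn(5) by (intro mult_left_mono) auto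
      with 1 show ?thesis by linarith
    qed
    have "l2norm G w \<le> l2norm G h + l2norm G (\<lambda>x. w x - h x)"
      using l2norm_triangle[OF sub(1)[OF h(1), of G] sub(1)[OF wh, of G]] by simp
    also have "\<dots> \<le> (\<bar>C\<^sub>0\<bar> * rpow A4 \<alpha> * rpow A5 (1 - \<alpha>)) * ?P + (CH * A3) * ?P" by (rule add_mono[OF hG rG])
    also have "\<dots> = K * rpow \<E> \<alpha> * rpow ?m (1 - \<alpha>)" by (simp add: K_def distrib_right mult.assoc)
    finally show "l2norm G (\<lambda>x. u x - lsq_solution \<Omega> \<omega> (X \<delta>) (Y \<delta>) ?N (B \<delta>) \<epsilon> l\<delta> q x)
        \<le> K * rpow \<E> \<alpha> * rpow ?m (1 - \<alpha>)"
      by (simp add: w_def[abs_def] ue_def)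
  qed
qed

end
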